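(* Let $I$ be a non-zero left ideal of $\mathcal{D}$ and let $\{\alpha(1),\ldots,\alpha(s)\}$ be a $\delta$-stair of $I$. 1. If $C(0;I)=I\cap\mathcal{H}\neq(0)$, then $U=\mathrm{Spec}(\mathcal{H})\setminus V(C(0;I))$ is the maximal open set of flatness, i.e. the largest open subset $W$ of $\mathrm{Spec}(\mathcal{H})$ such that $\mathcal{D}_{\mathfrak{P}}/I_{\mathfrak{P}}$ is a flat $\mathcal{H}_{\mathfrak{P}}$-module for every $\mathfrak{P}\in W$. 2. If $C(\alpha(k);I)=\mathcal{H}$ for each $k\in\{1,\ldots,s\}$, then $\mathcal{D}/I$ is a flat $\mathcal{H}$-module.
   Context: $\mathbf{k}$ is a field of characteristic zero, $n\ge 1$, $m\ge 0$, and $\mathbf{k}((\tilde X))$ is the fraction field of the formal power series ring $\mathbf{k}[[x_1,\ldots,x_{n+m}]]$. $\mathcal{H}\subset \mathbf{k}((\tilde X))$ is a noetherian $\mathbf{k}$-subalgebra stable under the partial derivatives $\partial_1,\ldots,\partial_n$ (with respect to $x_1,\ldots,x_n$). It is also assumed to be effective: (1) for any finite subset $\{f_1,\ldots,f_r\}\subset\mathcal{H}$ and $f\in\mathcal{H}$ one can decide whether $f$ lies in the ideal generated by $f_1,\ldots,f_r$ and, if so, find $q_i\in\mathcal{H}$ with $f=\sum q_if_i$; (2) for any finite subset of $\mathcal{H}$ one can find a system of generators of its $\mathcal{H}$-module of syzygies. $\mathcal{D}=\mathcal{H}[\partial]=\mathcal{H}[\partial_1,\ldots,\partial_n]$ is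 the ring of linear differential operators generated by $\mathcal{H}$ and $\partial_1,\ldots,\partial_n$; its elements are the finite sums $\sum_{\alpha\in\mathbb{N}^n}p_\alpha\partial^\alpha$ with $p_\alpha\in\mathcal{H}$ (unique expression), $0\in\mathbb{N}$. Fix a (total) well-ordering $<$ on $\mathbb{N}^n$ compatible with the sum: $\alpha+\gamma<\beta+\gamma$ iff $\alpha<\beta$. For nonzero $P=\sum p_\alpha\partial^\alpha\in\mathcal{D}$, $\exp^\delta(P)=\max_<\{\alpha: p_\alpha\ne 0\}$ and $c^\delta(P)=p_{\exp^\delta(P)}\in\mathcal{H}$. For a non-zero left ideal $I$ of $\mathcal{D}$, $\mathrm{Exp}^\delta(I)=\{\exp^\delta(P):P\in I\setminus\{0\}\}$; a $\delta$-stair of $I$ is a finite subset $E\subseteq\mathrm{Exp}^\delta(I)$ with $\mathrm{Exp}^\delta(I)=\bigcup_{\alpha\in E}(\alpha+\mathbb{N}^n)$ (one exists by Dickson's Lemma). For $\alpha\in\mathbb{N}^n$, $C(\alpha;I)$ is the ideal of $\mathcal{H}$ generated by $\{c^\delta(P):P\in I\setminus\{0\},\ \alpha\in\exp^\delta(P)+\mathbb{N}^n\}$ ($\{0\}$ if this set is empty); in particular $C(0;I)=I\cap\mathcal{H}$. $\mathrm{Spec}(\mathcal{H})$ carries the Zariski topology, and for an ideal $\mathcal{K}$ of $\mathcal{H}$, $V(\mathcal{K})=\{\mathfrak{P}\in\mathrm{Spec}(\mathcal{H}):\mathcal{K}\subseteq\mathfrak{P}\}$. For $\mathfrak{P}\in\mathrm{Spec}(\mathcal{H})$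 and $S=\mathcal{H}\setminus\mathfrak{P}$, $\mathcal{H}_{\mathfrak{P}}=S^{-1}\mathcal{H}\subset\mathbf{k}((\tilde X))$; $\mathcal{D}_{\mathfrak{P}}=S^{-1}\mathcal{D}$ is the subalgebra of $\mathbf{k}((\tilde X))[\partial_1,\ldots,\partial_n]$ generated by $\mathcal{H}_{\mathfrak{P}}$ and $\partial_1,\ldots,\partial_n$; and $I_{\mathfrak{P}}=S^{-1}I$ is the left ideal of $\mathcal{D}_{\mathfrak{P}}$ generated by $I$. Quotients are regarded as left modules. *)

theory Defs
  imports
    "HOL-Algebra.Algebra"
    "HOL-Computational_Algebra.Fraction_Field"
    "HOL-Analysis.Finite_Cartesian_Product"
    "HOL-Analysis.Abstract_Topology"
begin

section \<open>Formal power series in finitely many variables\<close>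

typedef (overloaded) ('a, 'v) mvps = "UNIV :: (nat ^ 'v::finite \<Rightarrow> 'a) set"
  morphisms mvps_coeff Abs_mvps ..

setup_lifting type_definition_mvps

lemma mvps_eq_iff: "f = g \<longleftrightarrow> (\<forall>\<alpha>. mvps_coeff f \<alpha> = mvps_coeff g \<alpha>)"
  by (metis ext mvps_coeff_inject)

lemma mvps_eqI: "(\<And>\<alpha>. mvps_coeff f \<alpha> = mvps_coeff g \<alpha>) \<Longrightarrow> f = g"
  by (simp add: mvps_eq_iff)

definition exponent_splits :: "nat ^ 'v::finite \<Rightarrow> ((nat ^ 'v) \<times> (nat ^ 'v)) set" where
  "exponent_splits \<alpha> = {(\<beta>, \<gamma>). \<beta> + \<gamma> = \<alpha>}"

lemma finite_exponents_le: "finite {\<beta> :: nat ^ 'v::finite. \<forall>i. \<beta> $ i \<le> \<alpha> $ i}"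
proof -
  have "vec_nth ` {\<beta> :: nat ^ 'v. \<forall>i. \<beta> $ i \<le> \<alpha> $ i} \<subseteq> PiE UNIV (\<lambda>i. {..\<alpha> $ i})"
    by auto
  then have "finite (vec_nth ` {\<beta> :: nat ^ 'v. \<forall>i. \<beta> $ i \<le> \<alpha> $ i})"
    by (rule finite_subset) (simp add: finite_PiE)
  then show ?thesis
    by (rule finite_imageD) (simp add: inj_on_def vec_nth_inject)
qed

lemma finite_exponent_splits [simp]: "finite (exponent_splits \<alpha>)"
proof -
  let ?B = "{\<beta> :: nat ^ 'a. \<forall>i. \<beta> $ i \<le> \<alpha> $ i}"
  have "exponent_splits \<alpha> \<subseteq> ?B \<times> ?B"
    by (auto simp: exponent_splits_def)
  then show ?thesis
    using finite_exponents_le[of \<alpha>] finite_subset by blast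
qed

instantiation mvps :: (comm_ring_1, finite) comm_ring_1
begin

lift_definition zero_mvps :: "('a, 'b) mvps" is "\<lambda>_. 0" .
lift_definition one_mvps :: "('a, 'b) mvps" is "\<lambda>\<alpha>. if \<alpha> = 0 then 1 else 0" .
lift_definition plus_mvps :: "('a, 'b) mvps \<Rightarrow> ('a, 'b) mvps \<Rightarrow> ('a, 'b) mvps"
  is "\<lambda>f g \<alpha>. f \<alpha> + g \<alpha>" .
lift_definition minus_mvps :: "('a, 'b) mvps \<Rightarrow> ('a, 'b) mvps \<Rightarrow> ('a, 'b) mvps"
  is "\<lambda>f g \<alpha>. f \<alpha> - g \<alpha>" .
lift_definition uminus_mvps :: "('a, 'b) mvps \<Rightarrow> ('a, 'b) mvps"
  is "\<lambda>f \<alpha>. - f \<alpha>" .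
lift_definition times_mvps :: "('a, 'b) mvps \<Rightarrow> ('a, 'b) mvps \<Rightarrow> ('a, 'b) mvps"
  is "\<lambda>f g \<alpha>. \<Sum>(\<beta>, \<gamma>)\<in>exponent_splits \<alpha>. f \<beta> * g \<gamma>" .

instance
proof
  fix f g h :: "('a, 'b) mvps"
  show "f * g * h = f * (g * h)"
  proof (rule mvps_eqI)
    fix \<alpha> :: "nat ^ 'b"
    let ?t = "\<lambda>x y z. mvps_coeff f x * mvps_coeff g y * mvps_coeff h z"
    have "mvps_coeff (f * g * h) \<alpha> =
        (\<Sum>p\<in>exponent_splits \<alpha>. \<Sum>q\<in>exponent_splits (fst p). ?t (fst q) (snd q) (snd p))"
      by (simp add: times_mvps.rep_eq case_prod_unfold sum_distrib_right)
    also have "\<dots> = (\<Sum>(p, q)\<in>Sigma (exponent_splits \<alpha>) (\<lambda>p. exponent_splits (fst p)).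
        ?t (fst q) (snd q) (snd p))"
      by (subst sum.Sigma) auto
    also have "\<dots> = (\<Sum>(p, q)\<in>Sigma (exponent_splits \<alpha>) (\<lambda>p. exponent_splits (snd p)).
        ?t (fst p) (fst q) (snd q))"
      by (rule sum.reindex_bij_witness[where
            i = "\<lambda>(p, q). ((fst p + fst q, snd q), (fst p, fst q))" and
            j = "\<lambda>(p, q). ((fst q, snd q + snd p), (snd q, snd p))"])
        (auto simp: exponent_splits_def add.assoc)
    also have "\<dots> =
        (\<Sum>p\<in>exponent_splits \<alpha>. \<Sum>q\<in>exponent_splits (snd p). ?t (fst p) (fst q) (snd q))"
      by (subst sum.Sigma) auto
    also have "\<dots> = mvps_coeff (f * (g * h)) \<alpha>"
      by (simp add: times_mvps.rep_eq case_prod_unfold sum_distrib_left mult.assoc)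
    finally show "mvps_coeff (f * g * h) \<alpha> = mvps_coeff (f * (g * h)) \<alpha>" .
  qed
  show "f * g = g * f"
  proof (rule mvps_eqI)
    fix \<alpha> :: "nat ^ 'b"
    show "mvps_coeff (f * g) \<alpha> = mvps_coeff (g * f) \<alpha>"
      unfolding times_mvps.rep_eq
      by (rule sum.reindex_bij_witness[where i = prod.swap and j = prod.swap])
        (auto simp: exponent_splits_def add.commute mult.commute)
  qed
  show "1 * f = f"
  proof (rule mvps_eqI)
    fix \<alpha> :: "nat ^ 'b"
    have "mvps_coeff (1 * f) \<alpha> = (\<Sum>p\<in>exponent_splits \<alpha>.
        if p = (0, \<alpha>) then mvps_coeff f \<alpha> else 0)"
      unfolding times_mvps.rep_eq
      by (rule sum.cong) (auto simp: exponent_splits_def one_mvps.rep_eq split: if_splits)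
    also have "\<dots> = mvps_coeff f \<alpha>"
      by (subst sum.delta[OF finite_exponent_splits]) (auto simp: exponent_splits_def)
    finally show "mvps_coeff (1 * f) \<alpha> = mvps_coeff f \<alpha>" .
  qed
  show "(f + g) * h = f * h + g * h"
    by (rule mvps_eqI)
      (simp add: times_mvps.rep_eq plus_mvps.rep_eq case_prod_unfold distrib_right sum.distrib)
  show "(0 :: ('a, 'b) mvps) \<noteq> 1"
    by (auto simp: mvps_eq_iff zero_mvps.rep_eq one_mvps.rep_eq intro!: exI[of _ 0])
qed (auto simp: mvps_eq_iff plus_mvps.rep_eq minus_mvps.rep_eq uminus_mvps.rep_eq
       zero_mvps.rep_eq add.assoc add.commute)

end

lemma sum_mvps_coeff: "mvps_coeff (sum f A) \<alpha> = (\<Sum>x\<in>A. mvps_coeff (f x) \<alpha>)"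
  by (induction A rule: infinite_finite_induct) (auto simp: zero_mvps.rep_eq plus_mvps.rep_eq)

text \<open>
  For the absence of zero divisors, exponents are ordered by the integers
  \<open>\<Prod>i. p\<^sub>i ^ \<alpha>\<^sub>i\<close>, with distinct primes \<open>p\<^sub>i\<close>.
\<close>

lemma exponent_weight:
  obtains w :: "nat ^ 'v::finite \<Rightarrow> nat"
  where "inj w" "\<And>\<alpha> \<beta>. w (\<alpha> + \<beta>) = w \<alpha> * w \<beta>" "\<And>\<alpha>. w \<alpha> > 0"
proof -
  obtain e :: "'v \<Rightarrow> nat" where e: "inj e"
    using finite_imp_inj_to_nat_seg[of "UNIV :: 'v set"] by auto
  obtain q :: "nat \<Rightarrow> nat" where q: "inj q" "range q \<subseteq> {p. Factorial_Ring.prime p}"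
    using infinite_countable_subset[OF primes_infinite] by blast
  define p where "p = q \<circ> e"
  have p: "inj p" "\<And>i. Factorial_Ring.prime (p i)"
    using e q by (auto simp: p_def inj_compose)
  define w where "w = (\<lambda>\<alpha> :: nat ^ 'v. \<Prod>i\<in>UNIV. p i ^ (\<alpha> $ i))"
  have mult: "multiplicity (p j) (w \<alpha>) = \<alpha> $ j" for j \<alpha>
  proof -
    have "multiplicity (p j) (w \<alpha>) = (\<Sum>i\<in>UNIV. multiplicity (p j) (p i ^ (\<alpha> $ i)))"
      unfolding w_def using p(2)
      by (subst prime_elem_multiplicity_prod_distrib) (auto, metis not_prime_0)
    also have "\<dots> = (\<Sum>i\<in>UNIV. if i = j then \<alpha> $ j else 0)"
    proof (rule sum.cong)
      fix i
      show "multiplicity (p j) (p i ^ (\<alpha> $ i)) = (if i = j then \<alpha> $ j else 0)"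
        using p by (auto simp: multiplicity_same_power multiplicity_distinct_prime_power
            prime_gt_0_nat inj_eq not_prime_unit)
    qed simp
    finally show ?thesis by simp
  qed
  show thesis
  proof (rule that)
    show "inj w"
      by (metis injI mult vec_eq_iff)
    show "w (\<alpha> + \<beta>) = w \<alpha> * w \<beta>" for \<alpha> \<beta>
      by (simp add: w_def power_add prod.distrib)
    show "w \<alpha> > 0" for \<alpha>
      using p(2) by (auto simp: w_def prime_gt_0_nat intro!: prod_pos)
  qed
qed

instance mvps :: (idom, finite) idom
proof
  fix f g :: "('a, 'b) mvps"
  assume "f \<noteq> 0" "g \<noteq> 0"
  obtain w :: "nat ^ 'b \<Rightarrow> nat" where w: "inj w"
      "\<And>\<alpha> \<beta>. w (\<alpha> + \<beta>) = w \<alpha> * w \<beta>" "\<And>\<alpha>. w \<alpha> > 0"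
    using exponent_weight by blast
  have least: "\<exists>\<alpha>. mvps_coeff h \<alpha> \<noteq> 0 \<and> (\<forall>\<beta>. mvps_coeff h \<beta> \<noteq> 0 \<longrightarrow> w \<alpha> \<le> w \<beta>)"
    if "h \<noteq> 0" for h :: "('a, 'b) mvps"
  proof -
    have "\<exists>\<alpha>. mvps_coeff h \<alpha> \<noteq> 0"
      using that by (auto simp: mvps_eq_iff zero_mvps.rep_eq)
    then show ?thesis
      using ex_has_least_nat[of "\<lambda>\<alpha>. mvps_coeff h \<alpha> \<noteq> 0" _ w] by blast
  qed
  obtain a where a: "mvps_coeff f a \<noteq> 0" "\<And>\<beta>. mvps_coeff f \<beta> \<noteq> 0 \<Longrightarrow> w a \<le> w \<beta>"
    using least[OF \<open>f \<noteq> 0\<close>] by blast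
  obtain b where b: "mvps_coeff g b \<noteq> 0" "\<And>\<beta>. mvps_coeff g \<beta> \<noteq> 0 \<Longrightarrow> w b \<le> w \<beta>"
    using least[OF \<open>g \<noteq> 0\<close>] by blast
  have "mvps_coeff f \<beta> * mvps_coeff g \<gamma> = 0"
    if *: "\<beta> + \<gamma> = a + b" "(\<beta>, \<gamma>) \<noteq> (a, b)" for \<beta> \<gamma>
  proof (rule ccontr)
    assume "\<not> ?thesis"
    then have le: "w a \<le> w \<beta>" "w b \<le> w \<gamma>"
      using a b by auto
    have eq: "w \<beta> * w \<gamma> = w a * w b"
      using * w(2) by metis
    have "w a = w \<beta>"
    proof (rule ccontr)
      assume "w a \<noteq> w \<beta>"
      then have "w a * w b < w \<beta> * w \<gamma>"
        using le w(3) by (intro mult_less_le_imp_less) auto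
      then show False using eq by simp
    qed
    then have "\<beta> = a"
      using w(1) by (auto dest: injD)
    then show False using * by auto
  qed
  then have "mvps_coeff (f * g) (a + b) = (\<Sum>p\<in>exponent_splits (a + b).
      if p = (a, b) then mvps_coeff f a * mvps_coeff g b else 0)"
    unfolding times_mvps.rep_eq
    by (intro sum.cong refl) (clarsimp simp: exponent_splits_def; metis)
  also have "\<dots> = mvps_coeff f a * mvps_coeff g b"
    by (subst sum.delta[OF finite_exponent_splits]) (auto simp: exponent_splits_def)
  finally have "mvps_coeff (f * g) (a + b) \<noteq> 0"
    using a b by simp
  then show "f * g \<noteq> 0"
    by (auto simp: zero_mvps.rep_eq)
qed

lift_definition mvps_const :: "'a::comm_ring_1 \<Rightarrow> ('a, 'v::finite) mvps"
  is "\<lambda>c \<alpha>. if \<alpha> = 0 then c else 0" .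

definition unit_exponent :: "'v::finite \<Rightarrow> nat ^ 'v" where
  "unit_exponent v = axis v 1"

lemma unit_exponent_nth: "unit_exponent v $ w = (if w = v then 1 else 0)"
  by (simp add: unit_exponent_def axis_def)

lemma unit_exponent_self [simp]: "unit_exponent v $ v = 1"
  by (simp add: unit_exponent_nth)

lift_definition mvps_deriv :: "'v::finite \<Rightarrow> ('a::comm_ring_1, 'v) mvps \<Rightarrow> ('a, 'v) mvps"
  is "\<lambda>v f \<alpha>. of_nat (\<alpha> $ v + 1) * f (\<alpha> + unit_exponent v)" .

lemma mvps_deriv_add: "mvps_deriv v (f + g) = mvps_deriv v f + mvps_deriv v g"
  by (rule mvps_eqI) (simp add: mvps_deriv.rep_eq plus_mvps.rep_eq distrib_left)

lemma mvps_deriv_mult: "mvps_deriv v (f * g) = mvps_deriv v f * g + f * mvps_deriv v g"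
proof (rule mvps_eqI)
  fix \<alpha> :: "nat ^ 'b"
  let ?e = "unit_exponent v :: nat ^ 'b"
  let ?S = "exponent_splits (\<alpha> + ?e)"
  have e: "\<beta> = (\<beta> - ?e) + ?e" if "\<beta> $ v \<noteq> 0" for \<beta> :: "nat ^ 'b"
    using that by (auto simp: vec_eq_iff unit_exponent_nth)
  have split: "(\<Sum>(\<beta>, \<gamma>)\<in>?S. of_nat (\<beta> $ v) * f' \<beta> * g' \<gamma>) =
      (\<Sum>(\<beta>, \<gamma>)\<in>exponent_splits \<alpha>. of_nat (\<beta> $ v + 1) * f' (\<beta> + ?e) * g' \<gamma>)"
    for f' g' :: "nat ^ 'b \<Rightarrow> 'a"
  proof -
    have "(\<Sum>(\<beta>, \<gamma>)\<in>?S. of_nat (\<beta> $ v) * f' \<beta> * g' \<gamma>) =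
        (\<Sum>(\<beta>, \<gamma>)\<in>{p\<in>?S. fst p $ v \<noteq> 0}. of_nat (\<beta> $ v) * f' \<beta> * g' \<gamma>)"
      by (rule sum.mono_neutral_right) (auto intro: gr0I)
    also have "\<dots> = (\<Sum>(\<beta>, \<gamma>)\<in>exponent_splits \<alpha>. of_nat (\<beta> $ v + 1) * f' (\<beta> + ?e) * g' \<gamma>)"
    proof (rule sum.reindex_bij_witness[where
            i = "\<lambda>(\<beta>, \<gamma>). (\<beta> + ?e, \<gamma>)" and j = "\<lambda>(\<beta>, \<gamma>). (\<beta> - ?e, \<gamma>)"])
      fix p assume p: "p \<in> {p\<in>?S. fst p $ v \<noteq> 0}"
      obtain \<beta> \<gamma> where [simp]: "p = (\<beta>, \<gamma>)" by (cases p)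
      obtain \<delta> where \<delta>: "\<beta> = \<delta> + ?e" using p e[of \<beta>] by auto
      have d: "\<beta> - ?e = \<delta>" by (simp add: \<delta> vec_eq_iff)
      show "(case case p of (\<beta>, \<gamma>) \<Rightarrow> (\<beta> - ?e, \<gamma>) of (\<beta>, \<gamma>) \<Rightarrow> (\<beta> + ?e, \<gamma>)) = p"
        by (simp add: d) (simp add: \<delta>)
      have "(\<delta> + \<gamma>) + ?e = \<alpha> + ?e"
        using p by (simp add: exponent_splits_def \<delta> add_ac)
      then show "(case p of (\<beta>, \<gamma>) \<Rightarrow> (\<beta> - ?e, \<gamma>)) \<in> exponent_splits \<alpha>"
        by (simp add: exponent_splits_def d)
      have "\<delta> $ v + 1 = \<beta> $ v"
        by (simp add: \<delta> unit_exponent_nth)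
      then show "(case case p of (\<beta>, \<gamma>) \<Rightarrow> (\<beta> - ?e, \<gamma>) of
            (\<beta>, \<gamma>) \<Rightarrow> of_nat (\<beta> $ v + 1) * f' (\<beta> + ?e) * g' \<gamma>) =
          (case p of (\<beta>, \<gamma>) \<Rightarrow> of_nat (\<beta> $ v) * f' \<beta> * g' \<gamma>)"
        by (simp only: \<open>p = (\<beta>, \<gamma>)\<close> prod.case d \<delta>[symmetric])
    next
      fix p assume p: "p \<in> exponent_splits \<alpha>"
      obtain \<beta> \<gamma> where [simp]: "p = (\<beta>, \<gamma>)" by (cases p)
      show "(case case p of (\<beta>, \<gamma>) \<Rightarrow> (\<beta> + ?e, \<gamma>) of (\<beta>, \<gamma>) \<Rightarrow> (\<beta> - ?e, \<gamma>)) = p"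
        by (simp add: vec_eq_iff)
      show "(case p of (\<beta>, \<gamma>) \<Rightarrow> (\<beta> + ?e, \<gamma>)) \<in> {p\<in>?S. fst p $ v \<noteq> 0}"
        using p by (auto simp: exponent_splits_def unit_exponent_nth add_ac)
    qed
    finally show ?thesis .
  qed
  have swap: "(\<Sum>(\<beta>, \<gamma>)\<in>exponent_splits \<delta>. h \<beta> \<gamma>) = (\<Sum>(\<beta>, \<gamma>)\<in>exponent_splits \<delta>. h \<gamma> \<beta>)"
    for h :: "nat ^ 'b \<Rightarrow> nat ^ 'b \<Rightarrow> 'a" and \<delta>
    by (rule sum.reindex_bij_witness[where i = prod.swap and j = prod.swap])
      (auto simp: exponent_splits_def add.commute)
  have "mvps_coeff (mvps_deriv v (f * g)) \<alpha> =
      (\<Sum>p\<in>?S. of_nat (\<alpha> $ v + 1) * (mvps_coeff f (fst p) * mvps_coeff g (snd p)))"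
    by (simp add: mvps_deriv.rep_eq times_mvps.rep_eq sum_distrib_left case_prod_unfold)
  also have "\<dots> = (\<Sum>p\<in>?S. of_nat (fst p $ v) * mvps_coeff f (fst p) * mvps_coeff g (snd p) +
      of_nat (snd p $ v) * mvps_coeff g (snd p) * mvps_coeff f (fst p))"
  proof (rule sum.cong)
    fix p assume "p \<in> ?S"
    then have "fst p + snd p = \<alpha> + ?e" by (auto simp: exponent_splits_def)
    then have "\<alpha> $ v + 1 = fst p $ v + snd p $ v"
      by (metis unit_exponent_self vector_add_component)
    then have "of_nat (\<alpha> $ v + 1) = (of_nat (fst p $ v) + of_nat (snd p $ v) :: 'a)"
      by (metis of_nat_add)
    then show "of_nat (\<alpha> $ v + 1) * (mvps_coeff f (fst p) * mvps_coeff g (snd p)) =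
        of_nat (fst p $ v) * mvps_coeff f (fst p) * mvps_coeff g (snd p) +
        of_nat (snd p $ v) * mvps_coeff g (snd p) * mvps_coeff f (fst p)"
      by (simp only:) (simp add: algebra_simps)
  qed simp
  also have "\<dots> = (\<Sum>(\<beta>, \<gamma>)\<in>?S. of_nat (\<beta> $ v) * mvps_coeff f \<beta> * mvps_coeff g \<gamma>) +
      (\<Sum>(\<beta>, \<gamma>)\<in>?S. of_nat (\<gamma> $ v) * mvps_coeff g \<gamma> * mvps_coeff f \<beta>)"
    by (simp add: sum.distrib case_prod_unfold)
  also have "(\<Sum>(\<beta>, \<gamma>)\<in>?S. of_nat (\<gamma> $ v) * mvps_coeff g \<gamma> * mvps_coeff f \<beta>) =
      (\<Sum>(\<beta>, \<gamma>)\<in>?S. of_nat (\<beta> $ v) * mvps_coeff g \<beta> * mvps_coeff f \<gamma>)"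
    by (rule swap)
  also have "\<dots> = (\<Sum>(\<beta>, \<gamma>)\<in>exponent_splits \<alpha>.
      of_nat (\<beta> $ v + 1) * mvps_coeff g (\<beta> + ?e) * mvps_coeff f \<gamma>)"
    by (rule split)
  also have "\<dots> = (\<Sum>(\<beta>, \<gamma>)\<in>exponent_splits \<alpha>.
      of_nat (\<gamma> $ v + 1) * mvps_coeff g (\<gamma> + ?e) * mvps_coeff f \<beta>)"
    by (rule swap)
  also have "(\<Sum>(\<beta>, \<gamma>)\<in>?S. of_nat (\<beta> $ v) * mvps_coeff f \<beta> * mvps_coeff g \<gamma>) =
      (\<Sum>(\<beta>, \<gamma>)\<in>exponent_splits \<alpha>. of_nat (\<beta> $ v + 1) * mvps_coeff f (\<beta> + ?e) * mvps_coeff g \<gamma>)"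
    by (rule split)
  finally show "mvps_coeff (mvps_deriv v (f * g)) \<alpha> =
      mvps_coeff (mvps_deriv v f * g + f * mvps_deriv v g) \<alpha>"
    unfolding plus_mvps.rep_eq times_mvps.rep_eq mvps_deriv.rep_eq
    by (simp add: case_prod_unfold mult_ac)
qed

lemma mvps_deriv_commute: "mvps_deriv u (mvps_deriv v f) = mvps_deriv v (mvps_deriv u f)"
  by (cases "u = v"; rule mvps_eqI)
    (auto simp: mvps_deriv.rep_eq unit_exponent_nth algebra_simps)


section \<open>The fraction field and its derivations\<close>

type_synonym ('k, 'v) mvfrac = "('k, 'v) mvps fract"

definition mvfrac_const :: "'k::idom \<Rightarrow> ('k, 'v::finite) mvfrac" where
  "mvfrac_const c = Fract (mvps_const c) 1"

definition pderiv_frac :: "'v::finite \<Rightarrow> ('k::idom, 'v) mvfrac \<Rightarrow> ('k, 'v) mvfrac" where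
  "pderiv_frac v q = (THE r. \<forall>a b. b \<noteq> 0 \<and> q = Fract a b \<longrightarrow>
     r = Fract (mvps_deriv v a * b - a * mvps_deriv v b) (b * b))"

lemma pderiv_frac_Fract:
  fixes a b :: "('k::idom, 'v::finite) mvps"
  assumes b: "b \<noteq> 0"
  shows "pderiv_frac v (Fract a b) = Fract (mvps_deriv v a * b - a * mvps_deriv v b) (b * b)"
proof -
  let ?D = "mvps_deriv v"
  have unique: "Fract (?D a * b - a * ?D b) (b * b) = Fract (?D c * d - c * ?D d) (d * d)"
    if d: "d \<noteq> 0" and "Fract a b = Fract c d" for c d
  proof -
    have ad: "a * d = c * b" using that b by (simp add: eq_fract)
    then have eq: "?D a * d + a * ?D d = ?D c * b + c * ?D b"
      by (metis mvps_deriv_mult)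
    have "(?D a * b - a * ?D b) * (d * d) = b * d * (?D a * d) - (a * d) * (d * ?D b)"
      by (simp add: algebra_simps)
    also have "?D a * d = ?D c * b + c * ?D b - a * ?D d"
      using eq by (simp add: algebra_simps)
    also have "b * d * (?D c * b + c * ?D b - a * ?D d) - (a * d) * (d * ?D b) =
        (b * d) * (?D c * b + c * ?D b) - (a * d) * (b * ?D d) - (a * d) * (d * ?D b)"
      by (simp add: algebra_simps)
    also have "\<dots> = (?D c * d - c * ?D d) * (b * b)"
      unfolding ad by (simp add: algebra_simps)
    finally show ?thesis using b d by (simp add: eq_fract)
  qed
  show ?thesis
    unfolding pderiv_frac_def
  proof (rule the_equality)
    show "\<forall>c d. d \<noteq> 0 \<and> Fract a b = Fract c d \<longrightarrow>
        Fract (?D a * b - a * ?D b) (b * b) = Fract (?D c * d - c * ?D d) (d * d)"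
      using unique by blast
  qed (use b in blast)
qed

lemma pderiv_frac_add: "pderiv_frac v (p + q) = pderiv_frac v p + pderiv_frac v q"
  by (cases p; cases q)
    (simp add: pderiv_frac_Fract mvps_deriv_add mvps_deriv_mult eq_fract algebra_simps)

lemma pderiv_frac_mult: "pderiv_frac v (p * q) = pderiv_frac v p * q + p * pderiv_frac v q"
  by (cases p; cases q)
    (simp add: pderiv_frac_Fract mvps_deriv_add mvps_deriv_mult eq_fract algebra_simps)

lemma pderiv_frac_of_mvps: "pderiv_frac v (Fract a 1) = Fract (mvps_deriv v a) 1"
proof -
  have "mvps_deriv v (1 :: ('a, 'b) mvps) = 0"
    using mvps_deriv_mult[of v "1 :: ('a, 'b) mvps" 1]
    by (metis add_cancel_right_right mult.left_neutral mult.right_neutral)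
  then show ?thesis by (simp add: pderiv_frac_Fract)
qed

lemma pderiv_frac_0 [simp]: "pderiv_frac v 0 = 0"
  using pderiv_frac_add[of v 0 0] by (metis add_0 add_cancel_right_right)

lemma pderiv_frac_minus: "pderiv_frac v (- p) = - pderiv_frac v p"
  using pderiv_frac_add[of v p "- p"] by (simp add: eq_neg_iff_add_eq_0 add.commute)

lemma pderiv_frac_sum: "pderiv_frac v (sum f A) = (\<Sum>x\<in>A. pderiv_frac v (f x))"
  by (induction A rule: infinite_finite_induct) (auto simp: pderiv_frac_add)

lemma pderiv_frac_commute: "pderiv_frac u (pderiv_frac v p) = pderiv_frac v (pderiv_frac u p)"
proof -
  define E where "E q = pderiv_frac u (pderiv_frac v q) - pderiv_frac v (pderiv_frac u q)"
    for q :: "('a, 'b) mvfrac"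
  have E_mult: "E (q * r) = E q * r + q * E r" for q r
    by (simp add: E_def pderiv_frac_mult pderiv_frac_add algebra_simps)
  have E_0: "E (Fract a 1) = 0" for a
    by (simp add: E_def pderiv_frac_of_mvps mvps_deriv_commute[of u v])
  obtain a b where ab: "p = Fract a b" "b \<noteq> 0" by (cases p)
  have "p * Fract b 1 = Fract a 1"
    using ab by (simp add: eq_fract)
  then have "E p * Fract b 1 = 0"
    using E_mult[of p "Fract b 1"] E_0 by simp
  moreover have "Fract b 1 \<noteq> 0"
    using ab by (simp add: Zero_fract_def eq_fract)
  ultimately show ?thesis by (simp add: E_def)
qed


section \<open>Linear differential operators\<close>

text \<open>
  The ring \<open>k((X))[\<partial>\<^sub>1, \<dots>, \<partial>\<^sub>n]\<close> is realised inside the ring of additive endomorphisms of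
  \<open>k((X))\<close>. The injection \<open>\<iota> :: 'n \<Rightarrow> 'v\<close> selects the \<open>n\<close> variables with respect to which
  one differentiates, so \<open>n = CARD('n)\<close> and \<open>n + m = CARD('v)\<close>.
\<close>

definition operator_ring :: "('a::ab_group_add \<Rightarrow> 'a) ring" where
  "operator_ring = \<lparr>carrier = {P. \<forall>f g. P (f + g) = P f + P g},
     monoid.mult = (\<circ>), one = id, ring.zero = (\<lambda>_. 0), add = (\<lambda>P Q f. P f + Q f)\<rparr>"

lemma operator_ring_simps [simp]:
  "P \<in> carrier operator_ring \<longleftrightarrow> (\<forall>f g. P (f + g) = P f + P g)"
  "P \<otimes>\<^bsub>operator_ring\<^esub> Q = P \<circ> Q"
  "\<one>\<^bsub>operator_ring\<^esub> = id"
  "\<zero>\<^bsub>operator_ring\<^esub> = (\<lambda>_. 0)"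
  "P \<oplus>\<^bsub>operator_ring\<^esub> Q = (\<lambda>f. P f + Q f)"
  by (auto simp: operator_ring_def)

lemma ring_operator_ring: "ring operator_ring"
proof (rule ringI)
  show "abelian_group (operator_ring :: ('a \<Rightarrow> 'a) ring)"
  proof (rule abelian_groupI)
    fix P :: "'a \<Rightarrow> 'a" assume "P \<in> carrier operator_ring"
    then show "\<exists>Q\<in>carrier operator_ring. Q \<oplus>\<^bsub>operator_ring\<^esub> P = \<zero>\<^bsub>operator_ring\<^esub>"
      by (intro bexI[of _ "\<lambda>f. - P f"]) auto
  qed (auto simp: algebra_simps)
  show "Group.monoid operator_ring"
    by (rule monoidI) (auto simp: comp_assoc)
qed (auto simp: fun_eq_iff)

lemma a_inv_operator_ring:
  assumes "P \<in> carrier operator_ring"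
  shows "\<ominus>\<^bsub>operator_ring\<^esub> P = (\<lambda>f. - P f)"
proof -
  interpret ring operator_ring by (rule ring_operator_ring)
  show ?thesis
    using assms by (intro minus_equality) auto
qed

definition ring_on :: "'a::comm_ring_1 set \<Rightarrow> 'a ring" where
  "ring_on R = \<lparr>carrier = R, monoid.mult = (*), one = 1, ring.zero = 0, add = (+)\<rparr>"

lemma ring_on_simps [simp]:
  "carrier (ring_on R) = R"
  "x \<otimes>\<^bsub>ring_on R\<^esub> y = x * y"
  "\<one>\<^bsub>ring_on R\<^esub> = 1"
  "\<zero>\<^bsub>ring_on R\<^esub> = 0"
  "x \<oplus>\<^bsub>ring_on R\<^esub> y = x + y"
  by (auto simp: ring_on_def)

lemma cring_ring_on_UNIV: "cring (ring_on (UNIV :: 'a::comm_ring_1 set))"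
proof (rule cringI)
  have "\<exists>y\<in>carrier (ring_on UNIV). y \<oplus>\<^bsub>ring_on UNIV\<^esub> x = \<zero>\<^bsub>ring_on UNIV\<^esub>" for x :: 'a
    by (rule bexI[of _ "- x"]) auto
  then show "abelian_group (ring_on (UNIV :: 'a set))"
    by (intro abelian_groupI) (auto simp: algebra_simps)
  show "Group.comm_monoid (ring_on (UNIV :: 'a set))"
    by (rule comm_monoidI) (auto simp: algebra_simps)
qed (auto simp: algebra_simps)

definition diffop_ring ::
  "('n::finite \<Rightarrow> 'v::finite) \<Rightarrow> ('k::idom, 'v) mvfrac set \<Rightarrow> (('k, 'v) mvfrac \<Rightarrow> ('k, 'v) mvfrac) ring"
  where
  "diffop_ring \<iota> R = operator_ring\<lparr>carrier :=
     generate_ring operator_ring ((\<lambda>h f. h * f) ` R \<union> range (\<lambda>i. pderiv_frac (\<iota> i)))\<rparr>"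

text \<open>
  The monomial \<open>\<partial> ^ \<alpha>\<close>; the derivations commute, so the order of composition is irrelevant.
\<close>

definition diff_monom ::
  "('n::finite \<Rightarrow> 'v::finite) \<Rightarrow> nat ^ 'n \<Rightarrow> ('k::idom, 'v) mvfrac \<Rightarrow> ('k, 'v) mvfrac" where
  "diff_monom \<iota> \<alpha> = Finite_Set.fold (\<lambda>i F. (pderiv_frac (\<iota> i) ^^ (\<alpha> $ i)) \<circ> F) id UNIV"

definition diffop ::
  "('n::finite \<Rightarrow> 'v::finite) \<Rightarrow> (nat ^ 'n \<Rightarrow> ('k::idom, 'v) mvfrac) \<Rightarrow>
    ('k, 'v) mvfrac \<Rightarrow> ('k, 'v) mvfrac" where
  "diffop \<iota> p f = (\<Sum>\<alpha> | p \<alpha> \<noteq> 0. p \<alpha> * diff_monom \<iota> \<alpha> f)"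

definition diffop_coeff ::
  "('n::finite \<Rightarrow> 'v::finite) \<Rightarrow> (('k::idom, 'v) mvfrac \<Rightarrow> ('k, 'v) mvfrac) \<Rightarrow>
    nat ^ 'n \<Rightarrow> ('k, 'v) mvfrac" where
  "diffop_coeff \<iota> P = (THE p. finite {\<alpha>. p \<alpha> \<noteq> 0} \<and> P = diffop \<iota> p)"

text \<open>
  The coefficients are well defined: every operator in the ring generated by \<open>R\<close> and the
  derivations is of the form \<open>diffop \<iota> p\<close> with \<open>p\<close> finitely supported and \<open>R\<close>-valued, provided
  that \<open>R\<close> is stable under the derivations, and \<open>p\<close> is unique in characteristic zero.
\<close>

lemma pderiv_funpow_commute:
  "(pderiv_frac u ^^ a) ((pderiv_frac v ^^ b) f) = (pderiv_frac v ^^ b) ((pderiv_frac u ^^ a) f)"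
proof -
  have 1: "pderiv_frac u ((pderiv_frac v ^^ b) f) = (pderiv_frac v ^^ b) (pderiv_frac u f)"
    for u f by (induction b) (auto simp: pderiv_frac_commute[of u v])
  show ?thesis by (induction a) (auto simp: 1)
qed

lemma diff_monom_step_commute:
  "comp_fun_commute_on UNIV (\<lambda>i F. (pderiv_frac (\<iota> i) ^^ (\<alpha> i)) \<circ> F)"
  by unfold_locales (auto simp: fun_eq_iff pderiv_funpow_commute)

lemma diff_monom_0 [simp]:
  fixes \<iota> :: "'n::finite \<Rightarrow> 'v::finite"
  shows "(diff_monom \<iota> 0 :: ('k::idom, 'v) mvfrac \<Rightarrow> ('k, 'v) mvfrac) = id"
proof -
  have "Finite_Set.fold (\<lambda>i F. F) (id :: ('k, 'v) mvfrac \<Rightarrow> _) A = id" if "finite A" for A :: "'n set"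
  proof -
    interpret comp_fun_commute "\<lambda>(i :: 'n) (F :: ('k, 'v) mvfrac \<Rightarrow> ('k, 'v) mvfrac). F"
      by unfold_locales auto
    show ?thesis using that by (induction A) auto
  qed
  then show ?thesis by (simp add: diff_monom_def)
qed

lemma diff_monom_step:
  fixes \<iota> :: "'n::finite \<Rightarrow> 'v::finite"
  shows "(diff_monom \<iota> (\<alpha> + unit_exponent i) :: ('k::idom, 'v) mvfrac \<Rightarrow> _) =
    pderiv_frac (\<iota> i) \<circ> diff_monom \<iota> \<alpha>"
proof -
  let ?F = "\<lambda>\<alpha> i (F :: ('k, 'v) mvfrac \<Rightarrow> ('k, 'v) mvfrac). (pderiv_frac (\<iota> i) ^^ (\<alpha> $ i)) \<circ> F"
  let ?\<beta> = "\<alpha> + unit_exponent i"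
  have rec: "Finite_Set.fold (?F \<beta>) id UNIV = ?F \<beta> i (Finite_Set.fold (?F \<beta>) id (UNIV - {i}))"
    for \<beta>
    by (rule comp_fun_commute_on.fold_rec[OF diff_monom_step_commute]) auto
  have "Finite_Set.fold (?F ?\<beta>) id (UNIV - {i}) = Finite_Set.fold (?F \<alpha>) id (UNIV - {i})"
    by (rule fold_closed_eq[where B = UNIV]) (auto simp: unit_exponent_nth)
  then show ?thesis
    unfolding diff_monom_def rec[of ?\<beta>] rec[of \<alpha>] by (simp add: comp_assoc unit_exponent_nth)
qed

definition exponent_degree :: "nat ^ 'n::finite \<Rightarrow> nat" where
  "exponent_degree \<alpha> = (\<Sum>i\<in>UNIV. \<alpha> $ i)"

lemma exponent_degree_step [simp]: "exponent_degree (\<alpha> + unit_exponent i) = Suc (exponent_degree \<alpha>)"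
  by (simp add: exponent_degree_def sum.distrib unit_exponent_nth)

lemma exponent_decomp:
  assumes "\<alpha> $ i \<noteq> 0"
  obtains \<beta> :: "nat ^ 'n::finite" where "\<alpha> = \<beta> + unit_exponent i"
proof
  show "\<alpha> = (\<alpha> - unit_exponent i) + unit_exponent i"
    using assms by (auto simp: vec_eq_iff unit_exponent_nth)
qed

lemma exponent_induct [case_names 0 step]:
  assumes "P 0" and "\<And>\<alpha> i. P \<alpha> \<Longrightarrow> P (\<alpha> + unit_exponent i)"
  shows "P (\<alpha> :: nat ^ 'n::finite)"
proof (induction "exponent_degree \<alpha>" arbitrary: \<alpha> rule: less_induct)
  case less
  show ?case
  proof (cases "\<alpha> = 0")
    case False
    then obtain i where "\<alpha> $ i \<noteq> 0" by (auto simp: vec_eq_iff)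
    then obtain \<beta> where "\<alpha> = \<beta> + unit_exponent i" by (rule exponent_decomp)
    then show ?thesis using assms(2) less by simp
  qed (use assms in simp)
qed

lemma diff_monom_add: "diff_monom \<iota> \<alpha> (f + g) = diff_monom \<iota> \<alpha> f + diff_monom \<iota> \<alpha> g"
  by (induction \<alpha> rule: exponent_induct) (auto simp: diff_monom_step pderiv_frac_add)

lemma diff_monom_zero [simp]: "diff_monom \<iota> \<alpha> 0 = 0"
  using diff_monom_add[of \<iota> \<alpha> 0 0] by (metis add_0 add_cancel_right_right)

lemma diff_monom_of_nat: "diff_monom \<iota> \<alpha> (of_nat c * f) = of_nat c * diff_monom \<iota> \<alpha> f"
  by (induction c) (auto simp: distrib_right diff_monom_add)

lemma diff_monom_commute:
  "diff_monom \<iota> \<alpha> (pderiv_frac v f) = pderiv_frac v (diff_monom \<iota> \<alpha> f)"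
  by (induction \<alpha> rule: exponent_induct) (auto simp: diff_monom_step pderiv_frac_commute[of v])

lemma diffop_superset:
  assumes "finite A" "{\<alpha>. p \<alpha> \<noteq> 0} \<subseteq> A"
  shows "diffop \<iota> p f = (\<Sum>\<alpha>\<in>A. p \<alpha> * diff_monom \<iota> \<alpha> f)"
  unfolding diffop_def using assms by (intro sum.mono_neutral_left) auto

context
  fixes \<iota> :: "'n::finite \<Rightarrow> 'v::finite"
  assumes inj: "inj \<iota>"
begin

definition var_monom :: "nat ^ 'n \<Rightarrow> ('k::field_char_0, 'v) mvps" where
  "var_monom \<alpha> = Abs_mvps (\<lambda>\<beta>.
     if \<beta> = (\<chi> v. if v \<in> range \<iota> then \<alpha> $ (inv_into UNIV \<iota> v) else 0) then 1 else 0)"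

lemma mvps_deriv_var_monom:
  "mvps_deriv (\<iota> i) (var_monom \<alpha> :: ('k::field_char_0, 'v) mvps) =
    of_nat (\<alpha> $ i) * var_monom (\<alpha> - unit_exponent i)"
proof -
  have of_nat_mult: "mvps_coeff (of_nat c * f) \<beta> = of_nat c * mvps_coeff f \<beta>"
    for c \<beta> and f :: "('k, 'v) mvps"
    by (induction c) (auto simp: distrib_right plus_mvps.rep_eq zero_mvps.rep_eq)
  define l where "l = (\<lambda>\<alpha> :: nat ^ 'n.
    (\<chi> v. if v \<in> range \<iota> then \<alpha> $ (inv_into UNIV \<iota> v) else 0) :: nat ^ 'v)"
  have coeff: "mvps_coeff (var_monom \<alpha> :: ('k, 'v) mvps) \<beta> = (if \<beta> = l \<alpha> then 1 else 0)" for \<alpha> \<beta>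
    by (simp add: var_monom_def Abs_mvps_inverse l_def)
  have l_nth: "l \<alpha> $ \<iota> i = \<alpha> $ i" for \<alpha>
    using inj by (simp add: l_def)
  have l_add: "l (\<alpha> + unit_exponent i) = l \<alpha> + unit_exponent (\<iota> i)" for \<alpha>
    using inj by (auto simp: l_def vec_eq_iff unit_exponent_nth)
  show ?thesis
  proof (cases "\<alpha> $ i = 0")
    case True
    then have "\<beta> + unit_exponent (\<iota> i) \<noteq> l \<alpha>" for \<beta>
      using l_nth[of \<alpha>] by (metis add_is_0 unit_exponent_self one_neq_zero vector_add_component)
    then show ?thesis
      using True by (simp add: mvps_eq_iff mvps_deriv.rep_eq coeff zero_mvps.rep_eq)
  next
    case False
    then obtain \<gamma> where \<gamma>: "\<alpha> = \<gamma> + unit_exponent i" by (rule exponent_decomp)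
    then have d: "\<alpha> - unit_exponent i = \<gamma>" by (simp add: vec_eq_iff)
    have iff: "\<beta> + unit_exponent (\<iota> i) = l \<alpha> \<longleftrightarrow> \<beta> = l \<gamma>" for \<beta>
      unfolding \<gamma> l_add by simp
    have nth: "l \<gamma> $ \<iota> i + 1 = \<alpha> $ i"
      using l_nth[of \<gamma>] \<gamma> by (simp add: unit_exponent_nth)
    show ?thesis
      unfolding d
    proof (rule mvps_eqI)
      fix \<beta>
      show "mvps_coeff (mvps_deriv (\<iota> i) (var_monom \<alpha> :: ('k, 'v) mvps)) \<beta> =
          mvps_coeff (of_nat (\<alpha> $ i) * var_monom \<gamma>) \<beta>"
        unfolding mvps_deriv.rep_eq of_nat_mult coeff iff
        by (cases "\<beta> = l \<gamma>") (simp_all only: nth if_True if_False mult_zero_right)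
    qed
  qed
qed

lemma of_nat_mvfrac_eq_0_iff: "(of_nat c :: ('k::field_char_0, 'v) mvfrac) = 0 \<longleftrightarrow> c = 0"
proof -
  have "mvps_coeff (of_nat c :: ('k, 'v) mvps) 0 = of_nat c"
    by (induction c) (auto simp: zero_mvps.rep_eq plus_mvps.rep_eq one_mvps.rep_eq)
  then have "(of_nat c :: ('k, 'v) mvps) = 0 \<longleftrightarrow> c = 0"
    by (metis of_nat_0 of_nat_eq_0_iff zero_mvps.rep_eq)
  then show ?thesis
    by (simp add: of_nat_fract Zero_fract_def eq_fract)
qed

lemma diff_monom_var_monom:
  assumes "exponent_degree \<alpha> \<le> exponent_degree \<beta>"
  shows "diff_monom \<iota> \<beta> (Fract (var_monom \<alpha>) 1 :: ('k::field_char_0, 'v) mvfrac) = 0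
    \<longleftrightarrow> \<alpha> \<noteq> \<beta>"
  using assms
proof (induction \<beta> arbitrary: \<alpha> rule: exponent_induct)
  case 0
  then have "\<alpha> = 0"
    by (auto simp: exponent_degree_def vec_eq_iff)
  moreover have "mvps_coeff (var_monom 0 :: ('k, 'v) mvps) 0 = 1"
    by (simp add: var_monom_def Abs_mvps_inverse vec_eq_iff)
  ultimately show ?case
    by (auto simp: Zero_fract_def eq_fract zero_mvps.rep_eq)
next
  case (step \<beta> i)
  have *: "diff_monom \<iota> (\<beta> + unit_exponent i) (Fract (var_monom \<alpha>) 1) =
      of_nat (\<alpha> $ i) * diff_monom \<iota> \<beta> (Fract (var_monom (\<alpha> - unit_exponent i)) 1 :: ('k, 'v) mvfrac)"
  proof -
    have "Fract (of_nat c * a) 1 = of_nat c * Fract a 1" for c and a :: "('k, 'v) mvps"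
      by (simp add: of_nat_fract)
    then show ?thesis
      by (simp add: diff_monom_step diff_monom_commute[symmetric] pderiv_frac_of_mvps
          mvps_deriv_var_monom diff_monom_of_nat)
  qed
  show ?case
  proof (cases "\<alpha> $ i = 0")
    case True
    then have "\<alpha> \<noteq> \<beta> + unit_exponent i"
      by (metis add_is_0 unit_exponent_self one_neq_zero vector_add_component)
    then show ?thesis using True * by simp
  next
    case False
    then obtain \<gamma> where \<gamma>: "\<alpha> = \<gamma> + unit_exponent i" by (rule exponent_decomp)
    then have d: "\<alpha> - unit_exponent i = \<gamma>" by (simp add: vec_eq_iff)
    have "(of_nat (\<alpha> $ i) :: ('k, 'v) mvfrac) \<noteq> 0"
      using False by (simp add: of_nat_mvfrac_eq_0_iff)
    moreover have "diff_monom \<iota> \<beta> (Fract (var_monom \<gamma>) 1 :: ('k, 'v) mvfrac) = 0 \<longleftrightarrow> \<gamma> \<noteq> \<beta>"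
      using step.IH[of \<gamma>] step.prems \<gamma> by simp
    ultimately show ?thesis
      unfolding * d by (simp add: \<gamma>)
  qed
qed

lemma diffop_eq_0:
  fixes p :: "nat ^ 'n \<Rightarrow> ('k::field_char_0, 'v) mvfrac"
  assumes "finite A" "\<And>f. (\<Sum>\<alpha>\<in>A. p \<alpha> * diff_monom \<iota> \<alpha> f) = 0" "\<alpha> \<in> A"
  shows "p \<alpha> = 0"
proof (rule ccontr)
  assume "p \<alpha> \<noteq> 0"
  then obtain \<beta> where \<beta>: "p \<beta> \<noteq> 0" "\<beta> \<in> A"
    "\<And>\<gamma>. \<gamma> \<in> A \<Longrightarrow> p \<gamma> \<noteq> 0 \<Longrightarrow> exponent_degree \<beta> \<le> exponent_degree \<gamma>"
    using ex_has_least_nat[of "\<lambda>\<beta>. p \<beta> \<noteq> 0 \<and> \<beta> \<in> A" \<alpha> exponent_degree] assms(3) by blast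
  let ?x = "Fract (var_monom \<beta>) 1 :: ('k, 'v) mvfrac"
  have "0 = (\<Sum>\<alpha>\<in>A. p \<alpha> * diff_monom \<iota> \<alpha> ?x)"
    using assms(2) by simp
  also have "\<dots> = (\<Sum>\<alpha>\<in>A. if \<alpha> = \<beta> then p \<beta> * diff_monom \<iota> \<beta> ?x else 0)"
  proof (rule sum.cong)
    fix \<gamma> assume "\<gamma> \<in> A"
    then show "p \<gamma> * diff_monom \<iota> \<gamma> ?x = (if \<gamma> = \<beta> then p \<beta> * diff_monom \<iota> \<beta> ?x else 0)"
      using \<beta>(3)[of \<gamma>] diff_monom_var_monom[of \<beta> \<gamma>, where 'k = 'k] by auto
  qed simp
  also have "\<dots> = p \<beta> * diff_monom \<iota> \<beta> ?x"
    using assms(1) \<beta>(2) by simp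
  finally show False
    using \<beta>(1) diff_monom_var_monom[of \<beta> \<beta>, where 'k = 'k] by simp
qed

lemma diffop_coeff_diffop:
  fixes p :: "nat ^ 'n \<Rightarrow> ('k::field_char_0, 'v) mvfrac"
  assumes p: "finite {\<alpha>. p \<alpha> \<noteq> 0}"
  shows "diffop_coeff \<iota> (diffop \<iota> p) = p"
  unfolding diffop_coeff_def
proof (rule the_equality)
  fix q assume q: "finite {\<alpha>. q \<alpha> \<noteq> 0} \<and> diffop \<iota> p = diffop \<iota> q"
  let ?A = "{\<alpha>. p \<alpha> \<noteq> 0} \<union> {\<alpha>. q \<alpha> \<noteq> 0}"
  have A: "finite ?A" using p q by simp
  have "(\<Sum>\<alpha>\<in>?A. (q \<alpha> - p \<alpha>) * diff_monom \<iota> \<alpha> f) = diffop \<iota> q f - diffop \<iota> p f" for f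
    using A by (simp add: diffop_superset[of ?A] sum_subtractf left_diff_distrib)
  then have eq: "q \<alpha> - p \<alpha> = 0" if "\<alpha> \<in> ?A" for \<alpha>
    using diffop_eq_0[OF A, of "\<lambda>\<alpha>. q \<alpha> - p \<alpha>"] q that by simp
  show "q = p"
  proof
    fix \<alpha>
    show "q \<alpha> = p \<alpha>"
      using eq[of \<alpha>] by (cases "\<alpha> \<in> ?A") auto
  qed
qed (use p in simp)

end

lemma generators_in_operator_ring:
  "(\<lambda>h f. h * f) ` R \<union> range (\<lambda>i. pderiv_frac (\<iota> i)) \<subseteq> carrier operator_ring"
  by (auto simp: distrib_left pderiv_frac_add)

lemma ring_diffop_ring: "ring (diffop_ring \<iota> R)"
  unfolding diffop_ring_def
  by (rule ring.generate_ring_is_ring[OF ring_operator_ring generators_in_operator_ring])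

lemma diffop_ring_normal_form:
  fixes R :: "('k::idom, 'v::finite) mvfrac set"
  assumes R: "subring R (ring_on UNIV)"
    and stable: "\<And>i h. h \<in> R \<Longrightarrow> pderiv_frac (\<iota> i) h \<in> R"
  shows "P \<in> carrier (diffop_ring \<iota> R) \<longleftrightarrow>
    (\<exists>p. finite {\<alpha>. p \<alpha> \<noteq> 0} \<and> range p \<subseteq> R \<and> P = diffop \<iota> p)"
proof
  let ?O = "operator_ring :: (('k, 'v) mvfrac \<Rightarrow> ('k, 'v) mvfrac) ring"
  let ?G = "(\<lambda>h f. h * f) ` R \<union> range (\<lambda>i. pderiv_frac (\<iota> i))"
  interpret O: ring ?O by (rule ring_operator_ring)
  interpret K: cring "ring_on UNIV :: ('k, 'v) mvfrac ring" by (rule cring_ring_on_UNIV)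
  have R_0: "0 \<in> R" and R_1: "1 \<in> R"
    using subringE(2,3)[OF R] by auto
  have R_add: "a + b \<in> R" and R_mult: "a * b \<in> R" if "a \<in> R" "b \<in> R" for a b
    using subringE(6,7)[OF R] that by auto
  have R_minus: "- a \<in> R" if "a \<in> R" for a
  proof -
    have "\<ominus>\<^bsub>ring_on UNIV\<^esub> a = - a"
      by (rule K.minus_equality) auto
    then show ?thesis using subringE(5)[OF R that] by simp
  qed
  define N where "N = {diffop \<iota> p | p. finite {\<alpha>. p \<alpha> \<noteq> 0} \<and> range p \<subseteq> R}"
  have N_add: "(\<lambda>f. P f + Q f) \<in> N" if PQ: "P \<in> N" "Q \<in> N" for P Q
  proof -
    obtain p q where p: "finite {\<alpha>. p \<alpha> \<noteq> 0}" "range p \<subseteq> R" "P = diffop \<iota> p"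
      and q: "finite {\<alpha>. q \<alpha> \<noteq> 0}" "range q \<subseteq> R" "Q = diffop \<iota> q"
      using PQ by (auto simp: N_def)
    let ?A = "{\<alpha>. p \<alpha> \<noteq> 0} \<union> {\<alpha>. q \<alpha> \<noteq> 0}"
    have A: "finite ?A" using p q by simp
    have sub: "{\<alpha>. p \<alpha> + q \<alpha> \<noteq> 0} \<subseteq> ?A" by auto
    have "(\<lambda>f. P f + Q f) = diffop \<iota> (\<lambda>\<alpha>. p \<alpha> + q \<alpha>)"
      using A sub by (simp add: fun_eq_iff p q diffop_superset[of ?A] sum.distrib distrib_right)
    moreover have "finite {\<alpha>. p \<alpha> + q \<alpha> \<noteq> 0}"
      using sub A by (rule finite_subset)
    moreover have "range (\<lambda>\<alpha>. p \<alpha> + q \<alpha>) \<subseteq> R"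
      using p q R_add by blast
    ultimately show ?thesis unfolding N_def by blast
  qed
  have N_monom: "(\<lambda>f. h * diff_monom \<iota> \<alpha> f) \<in> N" if "h \<in> R" for h \<alpha>
  proof -
    let ?p = "\<lambda>\<beta>. if \<beta> = \<alpha> then h else 0"
    have sub: "{\<beta>. ?p \<beta> \<noteq> 0} \<subseteq> {\<alpha>}" by auto
    have "(\<lambda>f. h * diff_monom \<iota> \<alpha> f) = diffop \<iota> ?p"
      using sub by (simp add: fun_eq_iff diffop_superset[of "{\<alpha>}"])
    moreover have "finite {\<beta>. ?p \<beta> \<noteq> 0}"
      using sub by (rule finite_subset) simp
    moreover have "range ?p \<subseteq> R"
      using that R_0 by auto
    ultimately show ?thesis unfolding N_def by blast
  qed
  have N_0: "(\<lambda>f. 0) \<in> N"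
    using N_monom[OF R_0] by simp
  have N_sum: "(\<lambda>f. \<Sum>x\<in>A. F x f) \<in> N" if "\<And>x. x \<in> A \<Longrightarrow> F x \<in> N" for F and A :: "(nat ^ 'a) set"
    using that by (induction A rule: infinite_finite_induct) (auto simp: N_0 N_add)
  have N_left: "Q \<circ> P \<in> N" if Q: "Q \<in> generate_ring ?O ?G" and P: "P \<in> N" for Q P
    using Q P
  proof (induction arbitrary: P)
    case one
    then show ?case by simp
  next
    case (incl Q)
    obtain p where p: "finite {\<alpha>. p \<alpha> \<noteq> 0}" "range p \<subseteq> R" "P = diffop \<iota> p"
      using incl.prems by (auto simp: N_def)
    let ?A = "{\<alpha>. p \<alpha> \<noteq> 0}"
    from incl.hyps show ?case
    proof
      assume "Q \<in> (\<lambda>h f. h * f) ` R"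
      then obtain h where h: "h \<in> R" "Q = (\<lambda>f. h * f)" by auto
      have "Q \<circ> P = (\<lambda>f. \<Sum>\<alpha>\<in>?A. (h * p \<alpha>) * diff_monom \<iota> \<alpha> f)"
        by (simp add: fun_eq_iff h p diffop_def sum_distrib_left mult.assoc)
      moreover have "h * p \<alpha> \<in> R" for \<alpha>
        using h p R_mult by blast
      ultimately show ?thesis
        using N_sum[of ?A "\<lambda>\<alpha> f. (h * p \<alpha>) * diff_monom \<iota> \<alpha> f"] N_monom by simp
    next
      assume "Q \<in> range (\<lambda>i. pderiv_frac (\<iota> i))"
      then obtain i where i: "Q = pderiv_frac (\<iota> i)" by auto
      have "Q \<circ> P = (\<lambda>f. \<Sum>\<alpha>\<in>?A. pderiv_frac (\<iota> i) (p \<alpha>) * diff_monom \<iota> \<alpha> f +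
          p \<alpha> * diff_monom \<iota> (\<alpha> + unit_exponent i) f)"
        by (simp add: fun_eq_iff i p diffop_def pderiv_frac_sum pderiv_frac_mult diff_monom_step)
      moreover have "p \<alpha> \<in> R" for \<alpha>
        using p by blast
      ultimately show ?thesis
        using N_sum[of ?A "\<lambda>\<alpha> f. pderiv_frac (\<iota> i) (p \<alpha>) * diff_monom \<iota> \<alpha> f +
            p \<alpha> * diff_monom \<iota> (\<alpha> + unit_exponent i) f"] N_monom N_add stable by simp
    qed
  next
    case (a_inv Q)
    have Q: "Q \<in> carrier ?O"
      by (rule O.generate_ring_in_carrier[OF generators_in_operator_ring a_inv.hyps])
    have "- 1 \<in> R" using R_1 R_minus by blast
    have "(\<lambda>f. - P' f) \<in> N" if P': "P' \<in> N" for P'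
    proof -
      obtain p where p: "finite {\<alpha>. p \<alpha> \<noteq> 0}" "range p \<subseteq> R" "P' = diffop \<iota> p"
        using P' by (auto simp: N_def)
      have "(\<lambda>f. - P' f) = diffop \<iota> (\<lambda>\<alpha>. - p \<alpha>)"
        by (simp add: fun_eq_iff p diffop_def sum_negf)
      moreover have "finite {\<alpha>. - p \<alpha> \<noteq> 0}" "range (\<lambda>\<alpha>. - p \<alpha>) \<subseteq> R"
        using p R_minus by auto
      ultimately show ?thesis unfolding N_def by blast
    qed
    from this[OF a_inv.IH[OF a_inv.prems]] show ?case
      by (simp add: a_inv_operator_ring[OF Q] comp_def)
  next
    case (eng_add Q1 Q2)
    then show ?case using N_add[of "Q1 \<circ> P" "Q2 \<circ> P"] by (simp add: comp_def)
  next
    case (eng_mult Q1 Q2)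
    then show ?case by (simp add: comp_assoc)
  qed
  have "id \<in> N"
    using N_monom[OF R_1, of 0] by (simp add: id_def)
  {
    assume "P \<in> carrier (diffop_ring \<iota> R)"
    then have "P \<in> generate_ring ?O ?G" by (simp add: diffop_ring_def)
    then have "P \<in> N" using N_left[OF _ \<open>id \<in> N\<close>, of P] by simp
    then show "\<exists>p. finite {\<alpha>. p \<alpha> \<noteq> 0} \<and> range p \<subseteq> R \<and> P = diffop \<iota> p"
      by (auto simp: N_def)
  }
  {
    assume "\<exists>p. finite {\<alpha>. p \<alpha> \<noteq> 0} \<and> range p \<subseteq> R \<and> P = diffop \<iota> p"
    then obtain p where p: "finite {\<alpha>. p \<alpha> \<noteq> 0}" "range p \<subseteq> R" "P = diffop \<iota> p" by blast
    have 0: "(\<lambda>f. 0) \<in> generate_ring ?O ?G"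
      using O.zero_in_generate by simp
    have monom: "diff_monom \<iota> \<alpha> \<in> generate_ring ?O ?G" for \<alpha>
    proof (induction \<alpha> rule: exponent_induct)
      case 0
      show ?case
        unfolding diff_monom_0
        using generate_ring.one[of ?O ?G] by (simp only: operator_ring_simps)
    next
      case (step \<alpha> i)
      have "pderiv_frac (\<iota> i) \<in> generate_ring ?O ?G"
        by (rule generate_ring.incl) auto
      from generate_ring.eng_mult[OF this step] show ?case
        by (simp add: diff_monom_step comp_def)
    qed
    have "(\<lambda>f. \<Sum>\<alpha>\<in>A. p \<alpha> * diff_monom \<iota> \<alpha> f) \<in> generate_ring ?O ?G" if "finite A" for A
      using that
    proof (induction A)
      case empty
      then show ?case using 0 by simp
    next
      case (insert \<alpha> A)
      have "(\<lambda>f. p \<alpha> * f) \<in> generate_ring ?O ?G"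
        using p by (intro generate_ring.incl) auto
      from generate_ring.eng_add[OF generate_ring.eng_mult[OF this monom] insert.IH]
      show ?case using insert.hyps by (simp add: comp_def)
    qed
    from this[OF p(1)] show "P \<in> carrier (diffop_ring \<iota> R)"
      by (simp add: diffop_ring_def p(3) diffop_def[abs_def])
  }
qed


section \<open>Leading exponents and coefficient ideals\<close>

definition exponent_order :: "(nat ^ 'n::finite) rel \<Rightarrow> bool" where
  "exponent_order r \<longleftrightarrow> well_order_on UNIV r \<and>
     (\<forall>\<alpha> \<beta> \<gamma>. (\<alpha> + \<gamma>, \<beta> + \<gamma>) \<in> r - Id \<longleftrightarrow> (\<alpha>, \<beta>) \<in> r - Id)"

definition delta_exp ::
  "(nat ^ 'n) rel \<Rightarrow> ('n::finite \<Rightarrow> 'v::finite) \<Rightarrow> (('k::idom, 'v) mvfrac \<Rightarrow> ('k, 'v) mvfrac) \<Rightarrow> nat ^ 'n"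
  where
  "delta_exp r \<iota> P = (THE \<alpha>. diffop_coeff \<iota> P \<alpha> \<noteq> 0 \<and>
     (\<forall>\<beta>. diffop_coeff \<iota> P \<beta> \<noteq> 0 \<longrightarrow> (\<beta>, \<alpha>) \<in> r))"

definition delta_coeff ::
  "(nat ^ 'n) rel \<Rightarrow> ('n::finite \<Rightarrow> 'v::finite) \<Rightarrow> (('k::idom, 'v) mvfrac \<Rightarrow> ('k, 'v) mvfrac) \<Rightarrow>
    ('k, 'v) mvfrac" where
  "delta_coeff r \<iota> P = diffop_coeff \<iota> P (delta_exp r \<iota> P)"

definition delta_Exp ::
  "(nat ^ 'n) rel \<Rightarrow> ('n::finite \<Rightarrow> 'v::finite) \<Rightarrow> (('k::idom, 'v) mvfrac \<Rightarrow> ('k, 'v) mvfrac) set \<Rightarrow>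
    (nat ^ 'n) set" where
  "delta_Exp r \<iota> I = delta_exp r \<iota> ` (I - {\<lambda>_. 0})"

definition exponent_cone :: "nat ^ 'n::finite \<Rightarrow> (nat ^ 'n) set" where
  "exponent_cone \<alpha> = {\<alpha> + \<gamma> | \<gamma>. True}"

definition delta_stair ::
  "(nat ^ 'n) rel \<Rightarrow> ('n::finite \<Rightarrow> 'v::finite) \<Rightarrow> (('k::idom, 'v) mvfrac \<Rightarrow> ('k, 'v) mvfrac) set \<Rightarrow>
    (nat ^ 'n) set \<Rightarrow> bool" where
  "delta_stair r \<iota> I E \<longleftrightarrow> finite E \<and> E \<subseteq> delta_Exp r \<iota> I \<and>
     delta_Exp r \<iota> I = (\<Union>\<alpha>\<in>E. exponent_cone \<alpha>)"

definition coeff_ideal ::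
  "(nat ^ 'n) rel \<Rightarrow> ('n::finite \<Rightarrow> 'v::finite) \<Rightarrow> ('k::idom, 'v) mvfrac set \<Rightarrow>
    (('k, 'v) mvfrac \<Rightarrow> ('k, 'v) mvfrac) set \<Rightarrow> nat ^ 'n \<Rightarrow> ('k, 'v) mvfrac set" where
  "coeff_ideal r \<iota> H I \<alpha> = Idl\<^bsub>ring_on H\<^esub>
     {delta_coeff r \<iota> P | P. P \<in> I - {\<lambda>_. 0} \<and> \<alpha> \<in> exponent_cone (delta_exp r \<iota> P)}"


section \<open>Left ideals, localisation and quotient modules\<close>

definition left_ideal :: "'a set \<Rightarrow> ('a, 'b) ring_scheme \<Rightarrow> bool" where
  "left_ideal I R \<longleftrightarrow> additive_subgroup I R \<and> (\<forall>a\<in>carrier R. \<forall>x\<in>I. a \<otimes>\<^bsub>R\<^esub> x \<in> I)"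

definition left_ideal_gen :: "('a, 'b) ring_scheme \<Rightarrow> 'a set \<Rightarrow> 'a set" where
  "left_ideal_gen R S = \<Inter>{I. left_ideal I R \<and> S \<subseteq> I}"

definition localization :: "'a::field set \<Rightarrow> 'a set \<Rightarrow> 'a set" where
  "localization H P = {a / s | a s. a \<in> H \<and> s \<in> H - P}"

text \<open>
  The left \<open>R\<close>-module \<open>D/I\<close>, for \<open>D = diffop_ring \<iota> R\<close>. The record fields \<open>mult\<close> and \<open>one\<close> play
  no role in modules.
\<close>

definition diffop_quotient ::
  "('n::finite \<Rightarrow> 'v::finite) \<Rightarrow> ('k::idom, 'v) mvfrac set \<Rightarrow>
    (('k, 'v) mvfrac \<Rightarrow> ('k, 'v) mvfrac) set \<Rightarrow>
    (('k, 'v) mvfrac, (('k, 'v) mvfrac \<Rightarrow> ('k, 'v) mvfrac) set) module" where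
  "diffop_quotient \<iota> R I = (let D = diffop_ring \<iota> R in
     \<lparr>carrier = a_rcosets\<^bsub>D\<^esub> I, monoid.mult = undefined, one = undefined,
      ring.zero = I, add = set_add D,
      smult = (\<lambda>h C. \<Union>P\<in>C. I +>\<^bsub>D\<^esub> ((\<lambda>f. h * f) \<otimes>\<^bsub>D\<^esub> P))\<rparr>)"


section \<open>Tensor products and flatness\<close>

definition linear_maps ::
  "('a, 'b) ring_scheme \<Rightarrow> ('a, 'c, 'e) module_scheme \<Rightarrow> ('a, 'd, 'f) module_scheme \<Rightarrow> ('c \<Rightarrow> 'd) set"
  where
  "linear_maps R M N = {f \<in> carrier M \<rightarrow> carrier N.
     (\<forall>x\<in>carrier M. \<forall>y\<in>carrier M. f (x \<oplus>\<^bsub>M\<^esub> y) = f x \<oplus>\<^bsub>N\<^esub> f y) \<and>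
     (\<forall>r\<in>carrier R. \<forall>x\<in>carrier M. f (r \<odot>\<^bsub>M\<^esub> x) = r \<odot>\<^bsub>N\<^esub> f x)}"

definition tensor_relations ::
  "('a, 'b) ring_scheme \<Rightarrow> ('a, 'c, 'e) module_scheme \<Rightarrow> ('a, 'd, 'f) module_scheme \<Rightarrow>
    ('c \<times> 'd \<Rightarrow>\<^sub>0 int) set" where
  "tensor_relations R M N = generate (free_Abelian_group (carrier M \<times> carrier N))
     ({frag_of (x \<oplus>\<^bsub>M\<^esub> x', y) - frag_of (x, y) - frag_of (x', y) | x x' y.
         x \<in> carrier M \<and> x' \<in> carrier M \<and> y \<in> carrier N} \<union>
      {frag_of (x, y \<oplus>\<^bsub>N\<^esub> y') - frag_of (x, y) - frag_of (x, y') | x y y'.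
         x \<in> carrier M \<and> y \<in> carrier N \<and> y' \<in> carrier N} \<union>
      {frag_of (r \<odot>\<^bsub>M\<^esub> x, y) - frag_of (x, r \<odot>\<^bsub>N\<^esub> y) | r x y.
         r \<in> carrier R \<and> x \<in> carrier M \<and> y \<in> carrier N})"

definition tensor_product ::
  "('a, 'b) ring_scheme \<Rightarrow> ('a, 'c, 'e) module_scheme \<Rightarrow> ('a, 'd, 'f) module_scheme \<Rightarrow>
    ('c \<times> 'd \<Rightarrow>\<^sub>0 int) set monoid" where
  "tensor_product R M N =
     free_Abelian_group (carrier M \<times> carrier N) Mod tensor_relations R M N"

text \<open>
  The map \<open>id \<otimes> f\<close> from \<open>M \<otimes> N'\<close> to \<open>M \<otimes> N\<close> induced by \<open>f : N' \<rightarrow> N\<close>, on cosets.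
\<close>

definition tensor_map ::
  "('a, 'b) ring_scheme \<Rightarrow> ('a, 'c, 'e) module_scheme \<Rightarrow> ('a, 'd, 'f) module_scheme \<Rightarrow>
    ('g \<Rightarrow> 'd) \<Rightarrow> ('c \<times> 'g \<Rightarrow>\<^sub>0 int) set \<Rightarrow> ('c \<times> 'd \<Rightarrow>\<^sub>0 int) set" where
  "tensor_map R M N f C = (\<Union>c\<in>C.
     tensor_relations R M N #>\<^bsub>free_Abelian_group (carrier M \<times> carrier N)\<^esub>
       frag_extend (\<lambda>(x, y). frag_of (x, f y)) c)"

text \<open>
  \<open>M\<close> is flat over \<open>R\<close> if tensoring with \<open>M\<close> preserves injectivity of linear maps. HOL cannot
  quantify over types inside a definition, so the modules to be tested have their elements in
  the type \<open>'c\<close>, which acts as a universe. Any \<open>'c\<close> into which \<open>R\<close> can be injected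
  is large enough: it accommodates the inclusions of ideals of \<open>R\<close>, and these already detect
  flatness.
\<close>

definition flat_module ::
  "'c itself \<Rightarrow> ('a, 'b) ring_scheme \<Rightarrow> ('a, 'd, 'e) module_scheme \<Rightarrow> bool" where
  "flat_module U R M \<longleftrightarrow> Module.module R M \<and>
     (\<forall>(N' :: ('a, 'c) module) (N :: ('a, 'c) module) f.
        Module.module R N' \<and> Module.module R N \<and> f \<in> linear_maps R N' N \<and>
        inj_on f (carrier N') \<longrightarrow>
        inj_on (tensor_map R M N f) (carrier (tensor_product R M N')))"


section \<open>The prime spectrum\<close>

definition spectrum :: "('a, 'b) ring_scheme \<Rightarrow> 'a set set" where
  "spectrum R = {P. primeideal P R}"

definition vanishing_set :: "('a, 'b) ring_scheme \<Rightarrow> 'a set \<Rightarrow> 'a set set" where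
  "vanishing_set R J = {P \<in> spectrum R. J \<subseteq> P}"

definition zariski_topology :: "('a, 'b) ring_scheme \<Rightarrow> 'a set topology" where
  "zariski_topology R = topology (\<lambda>W. \<exists>J. ideal J R \<and> W = spectrum R - vanishing_set R J)"

lemma openin_zariski_topology:
  assumes "cring R"
  shows "openin (zariski_topology R) W \<longleftrightarrow> (\<exists>J. ideal J R \<and> W = spectrum R - vanishing_set R J)"
proof -
  interpret cring R by fact
  let ?op = "\<lambda>W. \<exists>J. ideal J R \<and> W = spectrum R - vanishing_set R J"
  have "?op (S \<inter> T)" if "?op S" "?op T" for S T
  proof -
    obtain J K where J: "ideal J R" "S = spectrum R - vanishing_set R J"
      and K: "ideal K R" "T = spectrum R - vanishing_set R K"
      using \<open>?op S\<close> \<open>?op T\<close> by blast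
    interpret J: ideal J R by fact
    interpret K: ideal K R by fact
    have "J \<subseteq> P \<or> K \<subseteq> P" if P: "primeideal P R" "J \<inter> K \<subseteq> P" for P
    proof (rule ccontr)
      assume "\<not> ?thesis"
      then obtain a b where ab: "a \<in> J" "a \<notin> P" "b \<in> K" "b \<notin> P" by blast
      then have c: "a \<in> carrier R" "b \<in> carrier R"
        using J.a_subset K.a_subset by auto
      have "a \<otimes>\<^bsub>R\<^esub> b \<in> J \<inter> K"
        using ab c J.I_r_closed K.I_l_closed by blast
      then show False
        using primeideal.I_prime[OF P(1) c] ab(2,4) P(2) by blast
    qed
    then have "S \<inter> T = spectrum R - vanishing_set R (J \<inter> K)"
      using J K by (auto simp: vanishing_set_def spectrum_def)
    then show ?thesis
      using i_intersect[OF J(1) K(1)] by blast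
  qed
  moreover have "?op (\<Union>\<W>)" if *: "\<forall>W\<in>\<W>. ?op W" for \<W>
  proof -
    obtain J where J: "\<And>W. W \<in> \<W> \<Longrightarrow> ideal (J W) R"
      "\<And>W. W \<in> \<W> \<Longrightarrow> W = spectrum R - vanishing_set R (J W)"
      using * by metis
    let ?S = "\<Union>W\<in>\<W>. J W"
    have S: "?S \<subseteq> carrier R"
      using J(1) by (auto dest: additive_subgroup.a_subset[OF ideal.axioms(1)])
    have "Idl\<^bsub>R\<^esub> ?S \<subseteq> P \<longleftrightarrow> (\<forall>W\<in>\<W>. J W \<subseteq> P)" if "primeideal P R" for P
    proof
      assume "Idl\<^bsub>R\<^esub> ?S \<subseteq> P"
      then show "\<forall>W\<in>\<W>. J W \<subseteq> P"
        using genideal_self[OF S] by blast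
    next
      assume "\<forall>W\<in>\<W>. J W \<subseteq> P"
      then show "Idl\<^bsub>R\<^esub> ?S \<subseteq> P"
        using primeideal.axioms(1)[OF that] by (intro genideal_minimal) auto
    qed
    then have "(\<Union>W\<in>\<W>. spectrum R - vanishing_set R (J W)) =
        spectrum R - vanishing_set R (Idl\<^bsub>R\<^esub> ?S)"
      by (auto simp: vanishing_set_def spectrum_def)
    moreover have "(\<Union>W\<in>\<W>. W) = (\<Union>W\<in>\<W>. spectrum R - vanishing_set R (J W))"
      by (rule SUP_cong[OF refl J(2)])
    ultimately have "\<Union>\<W> = spectrum R - vanishing_set R (Idl\<^bsub>R\<^esub> ?S)"
      by (metis image_ident)
    then show ?thesis
      using genideal_ideal[OF S] by blast
  qed
  ultimately have "istopology ?op"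
    unfolding istopology_def by blast
  then show ?thesis
    by (simp add: zariski_topology_def)
qed

definition flat_open ::
  "'c itself \<Rightarrow> ('n::finite \<Rightarrow> 'v::finite) \<Rightarrow> ('k::idom, 'v) mvfrac set \<Rightarrow>
    (('k, 'v) mvfrac \<Rightarrow> ('k, 'v) mvfrac) set \<Rightarrow> ('k, 'v) mvfrac set set \<Rightarrow> bool" where
  "flat_open U \<iota> H I W \<longleftrightarrow> openin (zariski_topology (ring_on H)) W \<and>
     (\<forall>P\<in>W. let HP = localization H P in
        flat_module U (ring_on HP)
          (diffop_quotient \<iota> HP (left_ideal_gen (diffop_ring \<iota> HP) I)))"

end

theory Submission
  imports Defs
begin

text \<open>
  Flatness is handled by two criteria. A module \<open>M\<close> with a dual basis is flat: a tensor in \<open>M \<otimes> N\<close> is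
  determined by its coordinates in \<open>N\<close>, and these are compatible with every map \<open>id \<otimes> f\<close>
  (\<open>tensor_expansion\<close>, \<open>coordinate_hom_natural\<close>). On the other hand, a flat module has no torsion
  (\<open>flat_module_torsion_free\<close>): a regular element of the ring acts injectively on \<open>M \<otimes> R\<close>, which
  is \<open>M\<close>.

  Suppose that all coefficient ideals at the exponents of a stair are the unit ideal. Since multiplication by
  \<open>\<partial>\<^sup>\<gamma>\<close> shifts leading exponents and preserves leading coefficients, \<open>I\<close> then contains an operator with
  leading coefficient 1 at each of its leading exponents. Dividing by these operators, every operator is
  congruent modulo \<open>I\<close> to exactly one operator without exponents in \<open>Exp(I)\<close> (\<open>division\<close>,
  \<open>is_normal_form_unique\<close>). Hence the quotient is free over \<open>H\<close> on the monomials outside \<open>Exp(I)\<close>,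
  and so it is flat (\<open>flat_quotient\<close>).

  For the maximal open set of flatness, the exponent 0 is the least one, so \<open>C(0; I)\<close> consists of the
  \<open>h \<in> H\<close> for which multiplication by \<open>h\<close> lies in \<open>I\<close>. At a prime \<open>P\<close> outside
  \<open>V(C(0; I))\<close> such an \<open>h\<close> is invertible, the localised ideal contains 1, and the quotient is the zero module.
  Conversely let \<open>P\<close> be a prime at which the localised quotient is flat, and suppose that \<open>C(0; I)\<close>
  contains some \<open>h \<noteq> 0\<close>. It kills the class of 1, so this class is zero by torsion-freeness. The
  localised ideal consists of the fractions \<open>Q / s\<close> with \<open>Q \<in> I\<close> and \<open>s\<close> not in \<open>P\<close>
  (\<open>localized_ideal_subset_fractions\<close>), so \<open>1 = Q / s\<close> for one of them; then \<open>s = Q\<close> lies in \<open>C(0; I)\<close> and not in \<open>P\<close>. Thus flatness fails at every point of \<open>V(C(0; I))\<close>, and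
  the complement is the largest possible open set.
\<close>


section \<open>Tensor products of modules\<close>

locale module_pair = M: Module.module R M + N: Module.module R N
  for R :: "('a, 'b) ring_scheme" (structure)
    and M :: "('a, 'c, 'e) module_scheme" and N :: "('a, 'd, 'f) module_scheme"
begin

abbreviation F where "F \<equiv> free_Abelian_group (carrier M \<times> carrier N)"

abbreviation T where "T \<equiv> tensor_relations R M N"

lemma subgroup_tensor_relations: "subgroup T F"
proof -
  have "Poly_Mapping.keys (frag_of p - frag_of q) \<subseteq> carrier M \<times> carrier N"
    "Poly_Mapping.keys (frag_of p - frag_of q - frag_of s) \<subseteq> carrier M \<times> carrier N"
    if "p \<in> carrier M \<times> carrier N" "q \<in> carrier M \<times> carrier N" "s \<in> carrier M \<times> carrier N"
    for p q s
    using that keys_diff[of "frag_of p - frag_of q" "frag_of s"] keys_diff[of "frag_of p" "frag_of q"]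
    by auto
  then show ?thesis
    unfolding tensor_relations_def
    by (intro group.generate_is_subgroup) auto
qed

lemma tensor_relations_diff: "a - b \<in> T" if "a \<in> T" "b \<in> T"
proof -
  have "a \<otimes>\<^bsub>F\<^esub> inv\<^bsub>F\<^esub> b \<in> T"
    using subgroup_tensor_relations that
    by (intro subgroup.m_closed subgroup.m_inv_closed)
  then show ?thesis
    using subgroup.mem_carrier[OF subgroup_tensor_relations that(2)] by simp
qed

lemma zero_in_tensor_relations [simp]: "0 \<in> T"
  using subgroup.one_closed[OF subgroup_tensor_relations] by simp

lemma tensor_relations_add: "a + b \<in> T" if "a \<in> T" "b \<in> T"
  using subgroup.m_closed[OF subgroup_tensor_relations that] by simp

lemma tensor_relations_sum: "(\<And>b. b \<in> B \<Longrightarrow> g b \<in> T) \<Longrightarrow> sum g B \<in> T"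
  by (induction B rule: infinite_finite_induct) (auto intro: tensor_relations_add)

lemma tensor_relation_add_left:
  "frag_of (x \<oplus>\<^bsub>M\<^esub> x', y) - frag_of (x, y) - frag_of (x', y) \<in> T"
  if "x \<in> carrier M" "x' \<in> carrier M" "y \<in> carrier N"
  unfolding tensor_relations_def using that by (intro generate.incl) blast

lemma tensor_relation_add_right:
  "frag_of (x, y \<oplus>\<^bsub>N\<^esub> y') - frag_of (x, y) - frag_of (x, y') \<in> T"
  if "x \<in> carrier M" "y \<in> carrier N" "y' \<in> carrier N"
  unfolding tensor_relations_def using that by (intro generate.incl) blast

lemma tensor_relation_smult:
  "frag_of (r \<odot>\<^bsub>M\<^esub> x, y) - frag_of (x, r \<odot>\<^bsub>N\<^esub> y) \<in> T"
  if "r \<in> carrier R" "x \<in> carrier M" "y \<in> carrier N"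
  unfolding tensor_relations_def using that by (intro generate.incl) blast

lemma zero_tensor: "frag_of (\<zero>\<^bsub>M\<^esub>, y) \<in> T" if "y \<in> carrier N"
proof -
  have "0 - (frag_of (\<zero>\<^bsub>M\<^esub> \<oplus>\<^bsub>M\<^esub> \<zero>\<^bsub>M\<^esub>, y) - frag_of (\<zero>\<^bsub>M\<^esub>, y) - frag_of (\<zero>\<^bsub>M\<^esub>, y)) \<in> T"
    using that by (intro tensor_relations_diff tensor_relation_add_left) auto
  then show ?thesis by simp
qed

lemma tensor_zero: "frag_of (x, \<zero>\<^bsub>N\<^esub>) \<in> T" if "x \<in> carrier M"
proof -
  have "0 - (frag_of (x, \<zero>\<^bsub>N\<^esub> \<oplus>\<^bsub>N\<^esub> \<zero>\<^bsub>N\<^esub>) - frag_of (x, \<zero>\<^bsub>N\<^esub>) - frag_of (x, \<zero>\<^bsub>N\<^esub>)) \<in> T"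
    using that by (intro tensor_relations_diff tensor_relation_add_right) auto
  then show ?thesis by simp
qed

lemma tensor_diff:
  assumes "x \<in> carrier M" "y \<in> carrier N" "y' \<in> carrier N"
  shows "frag_of (x, y \<ominus>\<^bsub>N\<^esub> y') - (frag_of (x, y) - frag_of (x, y')) \<in> T"
proof -
  have eq: "y \<ominus>\<^bsub>N\<^esub> y' \<oplus>\<^bsub>N\<^esub> y' = y"
    using assms by (simp add: a_minus_def N.a_assoc N.l_neg)
  have "frag_of (x, y \<ominus>\<^bsub>N\<^esub> y' \<oplus>\<^bsub>N\<^esub> y') - frag_of (x, y \<ominus>\<^bsub>N\<^esub> y') - frag_of (x, y') \<in> T"
    using assms by (intro tensor_relation_add_right) auto
  from tensor_relations_diff[OF zero_in_tensor_relations this] show ?thesis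
    unfolding eq by (simp add: algebra_simps)
qed

lemma tensor_finsum_left:
  assumes "finite B" "\<And>b. b \<in> B \<Longrightarrow> m b \<in> carrier M" "y \<in> carrier N"
  shows "frag_of (\<Oplus>\<^bsub>M\<^esub>b\<in>B. m b, y) - (\<Sum>b\<in>B. frag_of (m b, y)) \<in> T"
  using assms(1,2)
proof (induction B)
  case empty
  then show ?case using zero_tensor[OF assms(3)] by simp
next
  case (insert b B)
  let ?s = "\<Oplus>\<^bsub>M\<^esub>b\<in>B. m b"
  have "m \<in> B \<rightarrow> carrier M" and s: "?s \<in> carrier M"
    using insert.prems by (auto intro: M.finsum_closed)
  then have "(\<Oplus>\<^bsub>M\<^esub>b\<in>insert b B. m b) = m b \<oplus>\<^bsub>M\<^esub> ?s"
    using insert by simp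
  moreover have "frag_of (m b \<oplus>\<^bsub>M\<^esub> ?s, y) - frag_of (m b, y) - frag_of (?s, y) \<in> T"
    using s insert.prems assms(3) by (intro tensor_relation_add_left) auto
  from tensor_relations_add[OF this insert.IH] insert.prems
  have "frag_of (m b \<oplus>\<^bsub>M\<^esub> ?s, y) - (frag_of (m b, y) + (\<Sum>b\<in>B. frag_of (m b, y))) \<in> T"
    by (simp add: algebra_simps)
  ultimately show ?case
    using insert.hyps by simp
qed

text \<open>
  The universal property of the tensor product, for targets that are groups in the sense of
  carriers: on the free group \<open>F\<close> a homomorphism may be prescribed on generators, and biadditivity and
  balancedness say that this homomorphism kills the generators of the group \<open>T\<close> of relations.
\<close>

lemma balanced_map_extends:
  assumes K: "comm_group K"
    and closed: "\<And>x y. x \<in> carrier M \<Longrightarrow> y \<in> carrier N \<Longrightarrow> g x y \<in> carrier K"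
    and add_left: "\<And>x x' y. x \<in> carrier M \<Longrightarrow> x' \<in> carrier M \<Longrightarrow> y \<in> carrier N \<Longrightarrow>
      g (x \<oplus>\<^bsub>M\<^esub> x') y = g x y \<otimes>\<^bsub>K\<^esub> g x' y"
    and add_right: "\<And>x y y'. x \<in> carrier M \<Longrightarrow> y \<in> carrier N \<Longrightarrow> y' \<in> carrier N \<Longrightarrow>
      g x (y \<oplus>\<^bsub>N\<^esub> y') = g x y \<otimes>\<^bsub>K\<^esub> g x y'"
    and balanced: "\<And>r x y. r \<in> carrier R \<Longrightarrow> x \<in> carrier M \<Longrightarrow> y \<in> carrier N \<Longrightarrow>
      g (r \<odot>\<^bsub>M\<^esub> x) y = g x (r \<odot>\<^bsub>N\<^esub> y)"
  obtains \<phi> where "\<phi> \<in> hom F K"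
    "\<And>x y. x \<in> carrier M \<Longrightarrow> y \<in> carrier N \<Longrightarrow> \<phi> (frag_of (x, y)) = g x y"
    "\<And>t. t \<in> T \<Longrightarrow> \<phi> t = \<one>\<^bsub>K\<^esub>"
proof -
  interpret K: comm_group K by fact
  have "case_prod g ` (carrier M \<times> carrier N) \<subseteq> carrier K"
    using closed by auto
  then obtain \<phi> where hom: "\<phi> \<in> hom F K"
    and of: "\<And>p. p \<in> carrier M \<times> carrier N \<Longrightarrow> \<phi> (frag_of p) = case_prod g p"
    using K.free_Abelian_group_universal by blast
  interpret \<phi>: group_hom F K \<phi>
    using hom by (simp add: group_hom_def group_hom_axioms_def K.is_group)
  have diff: "\<phi> (a - b) = \<phi> a \<otimes>\<^bsub>K\<^esub> inv\<^bsub>K\<^esub> \<phi> b"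
    if "a \<in> carrier F" "b \<in> carrier F" for a b
    using that \<phi>.hom_mult[of a "inv\<^bsub>F\<^esub> b"] \<phi>.hom_inv[of b] by simp
  have "T \<subseteq> kernel F K \<phi>"
    unfolding tensor_relations_def
  proof (rule group.generate_subgroup_incl[OF _ _ \<phi>.subgroup_kernel], simp, intro Un_least subsetI)
    have two: "frag_of p - frag_of q \<in> kernel F K \<phi>"
      if "p \<in> carrier M \<times> carrier N" "q \<in> carrier M \<times> carrier N" "case_prod g p = case_prod g q"
      for p q
      using that closed keys_diff[of "frag_of p" "frag_of q"]
      by (auto simp: kernel_def diff of)
    have three: "frag_of p - frag_of q - frag_of s \<in> kernel F K \<phi>"
      if "p \<in> carrier M \<times> carrier N" "q \<in> carrier M \<times> carrier N" "s \<in> carrier M \<times> carrier N"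
        "case_prod g p = case_prod g q \<otimes>\<^bsub>K\<^esub> case_prod g s" for p q s
    proof -
      have c: "frag_of p - frag_of q \<in> carrier F"
        using that keys_diff[of "frag_of p" "frag_of q"] by auto
      then have "frag_of p - frag_of q - frag_of s \<in> carrier F"
        using that keys_diff[of "frag_of p - frag_of q" "frag_of s"] by auto
      moreover have K: "case_prod g q \<in> carrier K" "case_prod g s \<in> carrier K"
        using that closed by auto
      moreover have "u \<otimes>\<^bsub>K\<^esub> v \<otimes>\<^bsub>K\<^esub> inv\<^bsub>K\<^esub> u \<otimes>\<^bsub>K\<^esub> inv\<^bsub>K\<^esub> v = \<one>\<^bsub>K\<^esub>"
        if "u \<in> carrier K" "v \<in> carrier K" for u v
        using that by (simp add: K.m_comm[of u v] K.m_assoc[of v u])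
      ultimately show ?thesis
        using that(1-3) c unfolding kernel_def
        by (simp add: diff of that(4))
    qed
    fix t
    show "t \<in> kernel F K \<phi>"
      if "t \<in> {frag_of (x \<oplus>\<^bsub>M\<^esub> x', y) - frag_of (x, y) - frag_of (x', y) | x x' y.
         x \<in> carrier M \<and> x' \<in> carrier M \<and> y \<in> carrier N}"
      using that by (auto intro!: three simp: add_left)
    show "t \<in> kernel F K \<phi>"
      if "t \<in> {frag_of (x, y \<oplus>\<^bsub>N\<^esub> y') - frag_of (x, y) - frag_of (x, y') | x y y'.
         x \<in> carrier M \<and> y \<in> carrier N \<and> y' \<in> carrier N}"
      using that by (auto intro!: three simp: add_right)
    show "t \<in> kernel F K \<phi>"
      if "t \<in> {frag_of (r \<odot>\<^bsub>M\<^esub> x, y) - frag_of (x, r \<odot>\<^bsub>N\<^esub> y) | r x y.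
         r \<in> carrier R \<and> x \<in> carrier M \<and> y \<in> carrier N}"
      using that by (auto intro!: two simp: balanced)
  qed
  then show thesis
    using that[OF hom] of by (auto simp: kernel_def)
qed

lemma mem_tensor_coset: "c \<in> T #>\<^bsub>F\<^esub> d \<longleftrightarrow> c - d \<in> T"
  by (auto simp: r_coset_def algebra_simps intro!: bexI[of _ "c - d"])

lemma tensor_coset_eq_iff: "T #>\<^bsub>F\<^esub> a = T #>\<^bsub>F\<^esub> b \<longleftrightarrow> a - b \<in> T"
proof
  show "a - b \<in> T" if "T #>\<^bsub>F\<^esub> a = T #>\<^bsub>F\<^esub> b"
    unfolding mem_tensor_coset[symmetric] that[symmetric] by (simp add: mem_tensor_coset)
  assume ab: "a - b \<in> T"
  have "c - a \<in> T \<longleftrightarrow> c - b \<in> T" for c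
    using tensor_relations_add[OF _ ab, of "c - a"] tensor_relations_diff[OF _ ab, of "c - b"] by auto
  then show "T #>\<^bsub>F\<^esub> a = T #>\<^bsub>F\<^esub> b"
    by (auto simp: mem_tensor_coset)
qed

lemma carrier_tensor_product:
  "carrier (tensor_product R M N) = {T #>\<^bsub>F\<^esub> c | c. c \<in> carrier F}"
  by (auto simp: tensor_product_def FactGroup_def RCOSETS_def)

end


lemma frag_extend_tensor_relations:
  assumes "Module.module R M" and N': "Module.module R N'" and N: "Module.module R N"
    and f: "f \<in> linear_maps R N' N" and t: "t \<in> tensor_relations R M N'"
  shows "frag_extend (\<lambda>(x, y). frag_of (x, f y)) t \<in> tensor_relations R M N"
proof -
  interpret M: Module.module R M by fact
  interpret N': Module.module R N' by fact
  interpret N: Module.module R N by fact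
  interpret N': module_pair R M N' ..
  interpret N: module_pair R M N ..
  have f_closed: "f y \<in> carrier N" if "y \<in> carrier N'" for y
    using f that by (auto simp: linear_maps_def)
  from t[unfolded tensor_relations_def] show ?thesis
  proof (induction t rule: generate.induct)
    case one
    show ?case by simp
  next
    case (incl h)
    then show ?case
      using f
      by (auto simp: frag_extend_diff linear_maps_def intro!: f_closed N.tensor_relation_add_left
          N.tensor_relation_add_right N.tensor_relation_smult)
  next
    case (inv h)
    from generate.incl[OF this] have "h \<in> N'.T"
      by (simp only: tensor_relations_def)
    then have "inv\<^bsub>N'.F\<^esub> h = - h"
      using subgroup.mem_carrier[OF N'.subgroup_tensor_relations] by simp
    moreover have "frag_extend (\<lambda>(x, y). frag_of (x, f y)) h \<in> N.T"
      using inv f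
      by (auto simp: frag_extend_diff linear_maps_def intro!: f_closed N.tensor_relation_add_left
          N.tensor_relation_add_right N.tensor_relation_smult)
    ultimately show ?case
      using N.tensor_relations_diff[OF N.zero_in_tensor_relations] by (simp add: frag_extend_minus)
  next
    case (eng a b)
    then show ?case by (simp add: frag_extend_add N.tensor_relations_add)
  qed
qed

text \<open>
  On cosets \<^const>\<open>tensor_map\<close> is a union over all representatives; linearity of \<open>f\<close> makes
  their images congruent, so one representative suffices.
\<close>

lemma tensor_map_coset:
  assumes M: "Module.module R M" and N': "Module.module R N'" and N: "Module.module R N"
    and f: "f \<in> linear_maps R N' N"
  shows "tensor_map R M N f
      (tensor_relations R M N' #>\<^bsub>free_Abelian_group (carrier M \<times> carrier N')\<^esub> c) =
    tensor_relations R M N #>\<^bsub>free_Abelian_group (carrier M \<times> carrier N)\<^esub>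
      frag_extend (\<lambda>(x, y). frag_of (x, f y)) c"
proof -
  interpret M: Module.module R M by fact
  interpret N': Module.module R N' by fact
  interpret N: Module.module R N by fact
  interpret N': module_pair R M N' ..
  interpret N: module_pair R M N ..
  let ?g = "frag_extend (\<lambda>(x, y). frag_of (x, f y))"
  have "N.T #>\<^bsub>N.F\<^esub> ?g d = N.T #>\<^bsub>N.F\<^esub> ?g c" if "d \<in> N'.T #>\<^bsub>N'.F\<^esub> c" for d
    using frag_extend_tensor_relations[OF assms, of "d - c"] that
    by (simp add: N'.mem_tensor_coset N.tensor_coset_eq_iff frag_extend_diff)
  moreover have "c \<in> N'.T #>\<^bsub>N'.F\<^esub> c"
    by (simp add: N'.mem_tensor_coset)
  ultimately show ?thesis
    unfolding tensor_map_def by blast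
qed


section \<open>Flatness\<close>

text \<open>
  A dual basis: elements \<open>e b\<close> and linear forms \<open>coord b\<close> such that each \<open>x\<close> is the finite sum of
  all \<open>coord b x \<odot> e b\<close>. It exists exactly for projective modules, and the \<open>e b\<close> may be linearly dependent.
  Free modules and the zero module are the two instances of interest here.
\<close>

locale dual_basis = Module.module R M
  for R :: "('a, 'b) ring_scheme" (structure) and M :: "('a, 'd, 'e) module_scheme" +
  fixes e :: "'i \<Rightarrow> 'd" and coord :: "'i \<Rightarrow> 'd \<Rightarrow> 'a"
  assumes basis_closed: "\<And>b. e b \<in> carrier M"
    and coord_closed: "\<And>b x. x \<in> carrier M \<Longrightarrow> coord b x \<in> carrier R"
    and coord_add: "\<And>b x y. x \<in> carrier M \<Longrightarrow> y \<in> carrier M \<Longrightarrow>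
      coord b (x \<oplus>\<^bsub>M\<^esub> y) = coord b x \<oplus> coord b y"
    and coord_smult: "\<And>b a x. a \<in> carrier R \<Longrightarrow> x \<in> carrier M \<Longrightarrow>
      coord b (a \<odot>\<^bsub>M\<^esub> x) = a \<otimes> coord b x"
    and expansion: "\<And>x. x \<in> carrier M \<Longrightarrow>
      \<exists>B. finite B \<and> (\<forall>b. b \<notin> B \<longrightarrow> coord b x = \<zero>) \<and> x = (\<Oplus>\<^bsub>M\<^esub>b\<in>B. coord b x \<odot>\<^bsub>M\<^esub> e b)"
begin

text \<open>
  The additive map from \<open>M \<otimes> N\<close> to \<open>N\<close> with \<open>x \<otimes> y \<mapsto> coord b x \<odot> y\<close>, viewed on the
  free group over the pairs \<open>(x, y)\<close>. The choice is made among the homomorphisms which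
  \<open>balanced_map_extends\<close> provides; they agree on that group.
\<close>

definition coordinate_hom ::
  "('a, 'g, 'h) module_scheme \<Rightarrow> 'i \<Rightarrow> ('d \<times> 'g \<Rightarrow>\<^sub>0 int) \<Rightarrow> 'g" where
  "coordinate_hom N b = (SOME \<phi>.
     \<phi> \<in> hom (free_Abelian_group (carrier M \<times> carrier N)) (add_monoid N) \<and>
     (\<forall>x\<in>carrier M. \<forall>y\<in>carrier N. \<phi> (frag_of (x, y)) = coord b x \<odot>\<^bsub>N\<^esub> y) \<and>
     (\<forall>t\<in>tensor_relations R M N. \<phi> t = \<zero>\<^bsub>N\<^esub>))"

lemma coordinate_hom:
  fixes N :: "('a, 'g, 'h) module_scheme"
  assumes "Module.module R N"
  shows hom_coordinate_hom:
      "coordinate_hom N b \<in> hom (free_Abelian_group (carrier M \<times> carrier N)) (add_monoid N)"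
    and coordinate_hom_frag_of:
      "\<And>x y. x \<in> carrier M \<Longrightarrow> y \<in> carrier N \<Longrightarrow>
        coordinate_hom N b (frag_of (x, y)) = coord b x \<odot>\<^bsub>N\<^esub> y"
    and coordinate_hom_relation:
      "\<And>t. t \<in> tensor_relations R M N \<Longrightarrow> coordinate_hom N b t = \<zero>\<^bsub>N\<^esub>"
proof -
  interpret N: Module.module R N by fact
  interpret module_pair R M N ..
  obtain \<phi> where "\<phi> \<in> hom F (add_monoid N)"
    "\<And>x y. x \<in> carrier M \<Longrightarrow> y \<in> carrier N \<Longrightarrow> \<phi> (frag_of (x, y)) = coord b x \<odot>\<^bsub>N\<^esub> y"
    "\<And>t. t \<in> T \<Longrightarrow> \<phi> t = \<one>\<^bsub>add_monoid N\<^esub>"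
  proof (rule balanced_map_extends[where g = "\<lambda>x y. coord b x \<odot>\<^bsub>N\<^esub> y"])
    show "comm_group (add_monoid N)"
      by (rule N.a_comm_group)
    show "coord b (a \<odot>\<^bsub>M\<^esub> x) \<odot>\<^bsub>N\<^esub> y = coord b x \<odot>\<^bsub>N\<^esub> (a \<odot>\<^bsub>N\<^esub> y)"
      if "a \<in> carrier R" "x \<in> carrier M" "y \<in> carrier N" for a x y
    proof -
      have "coord b (a \<odot>\<^bsub>M\<^esub> x) = coord b x \<otimes> a"
        using that coord_smult coord_closed m_comm by metis
      then show ?thesis
        using that coord_closed N.smult_assoc1 by metis
    qed
    show "coord b x \<odot>\<^bsub>N\<^esub> y \<in> carrier (add_monoid N)" if "x \<in> carrier M" "y \<in> carrier N" for x y
      using that coord_closed by simp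
    show "coord b (x \<oplus>\<^bsub>M\<^esub> x') \<odot>\<^bsub>N\<^esub> y = (coord b x \<odot>\<^bsub>N\<^esub> y) \<otimes>\<^bsub>add_monoid N\<^esub> (coord b x' \<odot>\<^bsub>N\<^esub> y)"
      if "x \<in> carrier M" "x' \<in> carrier M" "y \<in> carrier N" for x x' y
      using that coord_closed coord_add N.smult_l_distr by simp
    show "coord b x \<odot>\<^bsub>N\<^esub> (y \<oplus>\<^bsub>N\<^esub> y') = (coord b x \<odot>\<^bsub>N\<^esub> y) \<otimes>\<^bsub>add_monoid N\<^esub> (coord b x \<odot>\<^bsub>N\<^esub> y')"
      if "x \<in> carrier M" "y \<in> carrier N" "y' \<in> carrier N" for x y y'
      using that coord_closed N.smult_r_distr by simp
  qed blast
  then have "\<exists>\<phi>. \<phi> \<in> hom F (add_monoid N) \<and>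
     (\<forall>x\<in>carrier M. \<forall>y\<in>carrier N. \<phi> (frag_of (x, y)) = coord b x \<odot>\<^bsub>N\<^esub> y) \<and>
     (\<forall>t\<in>T. \<phi> t = \<zero>\<^bsub>N\<^esub>)"
    by auto
  from someI_ex[OF this] have "coordinate_hom N b \<in> hom F (add_monoid N) \<and>
     (\<forall>x\<in>carrier M. \<forall>y\<in>carrier N. coordinate_hom N b (frag_of (x, y)) = coord b x \<odot>\<^bsub>N\<^esub> y) \<and>
     (\<forall>t\<in>T. coordinate_hom N b t = \<zero>\<^bsub>N\<^esub>)"
    unfolding coordinate_hom_def .
  then show "coordinate_hom N b \<in> hom F (add_monoid N)"
    and "\<And>x y. x \<in> carrier M \<Longrightarrow> y \<in> carrier N \<Longrightarrow>
        coordinate_hom N b (frag_of (x, y)) = coord b x \<odot>\<^bsub>N\<^esub> y"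
    and "\<And>t. t \<in> T \<Longrightarrow> coordinate_hom N b t = \<zero>\<^bsub>N\<^esub>"
    by simp_all
qed

lemma group_hom_coordinate_hom:
  assumes "Module.module R N"
  shows "group_hom (free_Abelian_group (carrier M \<times> carrier N)) (add_monoid N) (coordinate_hom N b)"
proof -
  interpret N: Module.module R N by fact
  show ?thesis
    by (intro group_hom.intro group_hom_axioms.intro group_free_Abelian_group N.a_group
        hom_coordinate_hom assms)
qed

lemma coordinate_hom_zero: "coordinate_hom N b 0 = \<zero>\<^bsub>N\<^esub>" if "Module.module R N"
  using group_hom.hom_one[OF group_hom_coordinate_hom[OF that]] by simp

lemma coordinate_hom_closed:
  "coordinate_hom N b c \<in> carrier N"
  if "Module.module R N" "Poly_Mapping.keys c \<subseteq> carrier M \<times> carrier N"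
  using group_hom.hom_closed[OF group_hom_coordinate_hom[OF that(1)]] that(2) by simp

lemma coordinate_hom_diff:
  assumes "Module.module R N"
    and "Poly_Mapping.keys c \<subseteq> carrier M \<times> carrier N" "Poly_Mapping.keys d \<subseteq> carrier M \<times> carrier N"
  shows "coordinate_hom N b (c - d) = coordinate_hom N b c \<ominus>\<^bsub>N\<^esub> coordinate_hom N b d"
proof -
  interpret \<phi>: group_hom "free_Abelian_group (carrier M \<times> carrier N)" "add_monoid N" "coordinate_hom N b"
    by (rule group_hom_coordinate_hom[OF assms(1)])
  show ?thesis
    using assms(2,3) \<phi>.hom_mult[of c "- d"] \<phi>.hom_inv[of d]
    by (simp add: a_minus_def a_inv_def)
qed

text \<open>
  Every tensor is the sum of the \<open>e b \<otimes> \<phi>\<^sub>b\<close>, where \<open>\<phi>\<^sub>b\<close> are its coordinates; for \<open>x \<otimes> y\<close> this is the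
  expansion of \<open>x\<close> with its coefficients moved across the tensor sign. The sum is claimed over all large
  finite index sets, so that the sums for two tensors can be subtracted from each other.
\<close>

lemma tensor_expansion:
  fixes N :: "('a, 'g, 'h) module_scheme"
  assumes N: "Module.module R N"
    and c: "Poly_Mapping.keys c \<subseteq> carrier M \<times> carrier N"
  shows "\<exists>B. finite B \<and> (\<forall>C. finite C \<longrightarrow> B \<subseteq> C \<longrightarrow>
    c - (\<Sum>b\<in>C. frag_of (e b, coordinate_hom N b c)) \<in> tensor_relations R M N)"
proof -
  let ?\<phi> = "coordinate_hom N"
  interpret N: Module.module R N by fact
  interpret module_pair R M N ..
  have "Poly_Mapping.keys c \<subseteq> carrier M \<times> carrier N \<and> (\<exists>B. finite B \<and> (\<forall>C. finite C \<longrightarrow> B \<subseteq> C \<longrightarrow>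
    c - (\<Sum>b\<in>C. frag_of (e b, ?\<phi> b c)) \<in> T))"
    using c
  proof (induction c rule: frag_induction)
    case zero
    have "0 - (\<Sum>b\<in>C. frag_of (e b, ?\<phi> b 0)) \<in> T" for C
      by (intro tensor_relations_diff tensor_relations_sum)
        (auto intro: tensor_zero basis_closed simp: coordinate_hom_zero[OF N])
    then show ?case by auto
  next
    case (one p)
    then obtain x y where p: "p = (x, y)" "x \<in> carrier M" "y \<in> carrier N" by auto
    obtain B where B: "finite B" "\<And>b. b \<notin> B \<Longrightarrow> coord b x = \<zero>"
      "x = (\<Oplus>\<^bsub>M\<^esub>b\<in>B. coord b x \<odot>\<^bsub>M\<^esub> e b)"
      using expansion[OF p(2)] by blast
    have "frag_of p - (\<Sum>b\<in>C. frag_of (e b, ?\<phi> b (frag_of p))) \<in> T"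
      if C: "finite C" "B \<subseteq> C" for C
    proof -
      let ?t = "\<lambda>b. frag_of (e b, coord b x \<odot>\<^bsub>N\<^esub> y)"
      let ?s = "\<Sum>b\<in>B. frag_of (coord b x \<odot>\<^bsub>M\<^esub> e b, y)"
      have 1: "frag_of (x, y) - ?s \<in> T"
        using tensor_finsum_left[OF B(1), of "\<lambda>b. coord b x \<odot>\<^bsub>M\<^esub> e b" y] B(3)[symmetric]
          basis_closed p coord_closed by simp
      have 2: "?s - (\<Sum>b\<in>B. ?t b) \<in> T"
        unfolding sum_subtractf[symmetric]
        using basis_closed p coord_closed by (intro tensor_relations_sum tensor_relation_smult)
      have 3: "(\<Sum>b\<in>C - B. ?t b) \<in> T"
        using B(2) basis_closed p by (intro tensor_relations_sum) (auto intro: tensor_zero)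
      have "(\<Sum>b\<in>C. ?t b) = (\<Sum>b\<in>C - B. ?t b) + (\<Sum>b\<in>B. ?t b)"
        by (rule sum.subset_diff[OF C(2,1)])
      then have "frag_of (x, y) - (\<Sum>b\<in>C. ?t b) \<in> T"
        using tensor_relations_diff[OF tensor_relations_add[OF 1 2] 3]
        by (simp add: algebra_simps)
      then show ?thesis using p by (simp add: coordinate_hom_frag_of[OF N])
    qed
    with B(1) p show ?case
      by (intro conjI exI[of _ B] allI impI) simp_all
  next
    case (diff a a')
    from diff(1) obtain B where B: "finite B" "\<forall>C. finite C \<longrightarrow> B \<subseteq> C \<longrightarrow>
        a - (\<Sum>b\<in>C. frag_of (e b, ?\<phi> b a)) \<in> T" by blast
    from diff(2) obtain B' where B': "finite B'" "\<forall>C. finite C \<longrightarrow> B' \<subseteq> C \<longrightarrow>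
        a' - (\<Sum>b\<in>C. frag_of (e b, ?\<phi> b a')) \<in> T" by blast
    have cl: "Poly_Mapping.keys (a - a') \<subseteq> carrier M \<times> carrier N"
      using diff keys_diff by fastforce
    have "a - a' - (\<Sum>b\<in>C. frag_of (e b, ?\<phi> b (a - a'))) \<in> T"
      if C: "finite C" "B \<union> B' \<subseteq> C" for C
    proof -
      have "(\<Sum>b\<in>C. frag_of (e b, ?\<phi> b (a - a')) -
          (frag_of (e b, ?\<phi> b a) - frag_of (e b, ?\<phi> b a'))) \<in> T"
        using diff basis_closed
        by (intro tensor_relations_sum)
          (simp add: coordinate_hom_diff[OF N] tensor_diff coordinate_hom_closed[OF N])
      then have "(\<Sum>b\<in>C. frag_of (e b, ?\<phi> b (a - a'))) -
          ((\<Sum>b\<in>C. frag_of (e b, ?\<phi> b a)) - (\<Sum>b\<in>C. frag_of (e b, ?\<phi> b a'))) \<in> T"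
        by (simp add: sum_subtractf)
      from tensor_relations_diff[OF tensor_relations_diff[OF B(2)[rule_format, of C] B'(2)[rule_format, of C]] this]
      show ?thesis using C by (simp add: algebra_simps)
    qed
    with B(1) B'(1) cl show ?case
      by (intro conjI exI[of _ "B \<union> B'"] allI impI) simp_all
  qed
  then show ?thesis by blast
qed

lemma coordinate_hom_natural:
  fixes N' :: "('a, 'g, 'h) module_scheme" and N :: "('a, 'g2, 'h2) module_scheme"
  assumes N': "Module.module R N'" and N: "Module.module R N"
    and f: "f \<in> linear_maps R N' N"
    and c: "Poly_Mapping.keys c \<subseteq> carrier M \<times> carrier N'"
  shows "coordinate_hom N b (frag_extend (\<lambda>(x, y). frag_of (x, f y)) c) = f (coordinate_hom N' b c)"
proof -
  let ?\<phi>' = "coordinate_hom N'" and ?\<phi> = "coordinate_hom N"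
  let ?g = "frag_extend (\<lambda>(x :: 'd, y). frag_of (x, f y))"
  interpret N': Module.module R N' by fact
  interpret N: Module.module R N by fact
  interpret f: group_hom "add_monoid N'" "add_monoid N" f
    using f by (auto simp: group_hom_def group_hom_axioms_def N'.a_group N.a_group
        linear_maps_def hom_def)
  have f_diff: "f (y \<ominus>\<^bsub>N'\<^esub> y') = f y \<ominus>\<^bsub>N\<^esub> f y'"
    if "y \<in> carrier N'" "y' \<in> carrier N'" for y y'
    using that f.hom_mult[of y "inv\<^bsub>add_monoid N'\<^esub> y'"] f.hom_inv[of y']
    by (simp add: a_minus_def a_inv_def)
  have f_closed: "f y \<in> carrier N" if "y \<in> carrier N'" for y
    using f that by (auto simp: linear_maps_def)
  have "Poly_Mapping.keys c \<subseteq> carrier M \<times> carrier N' \<and>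
      Poly_Mapping.keys (?g c) \<subseteq> carrier M \<times> carrier N \<and> ?\<phi> b (?g c) = f (?\<phi>' b c)"
    using c
  proof (induction c rule: frag_induction)
    case zero
    show ?case
      using f.hom_one by (simp add: coordinate_hom_zero N N')
  next
    case (one p)
    then obtain x y where p: "p = (x, y)" "x \<in> carrier M" "y \<in> carrier N'" by auto
    have "f (coord b x \<odot>\<^bsub>N'\<^esub> y) = coord b x \<odot>\<^bsub>N\<^esub> f y"
      using f p coord_closed by (auto simp: linear_maps_def)
    then show ?case
      using p f_closed by (simp add: coordinate_hom_frag_of N N')
  next
    case (diff a a')
    have "?g (a - a') = ?g a - ?g a'"
      by (simp add: frag_extend_diff)
    moreover have "Poly_Mapping.keys (a - a') \<subseteq> carrier M \<times> carrier N'"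
      "Poly_Mapping.keys (?g a - ?g a') \<subseteq> carrier M \<times> carrier N"
      using diff keys_diff by fastforce+
    ultimately show ?case
      using diff by (simp add: coordinate_hom_diff coordinate_hom_closed N N' f_diff)
  qed
  then show ?thesis by blast
qed

text \<open>
  Coordinates detect injectivity: if \<open>id \<otimes> f\<close> identifies two tensors, then by naturality
  \<open>f\<close> kills the coordinates of their difference, hence these vanish, and a tensor with vanishing
  coordinates is zero by its expansion.
\<close>

theorem flat: "flat_module U R M"
  unfolding flat_module_def
proof (intro conjI allI impI, rule module_axioms, elim conjE)
  fix N' N :: "('a, 'c) module" and f
  assume N': "Module.module R N'" and N: "Module.module R N"
    and f: "f \<in> linear_maps R N' N" and inj: "inj_on f (carrier N')"
  interpret N': Module.module R N' by fact
  interpret N: Module.module R N by fact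
  interpret N': module_pair R M N' ..
  interpret N: module_pair R M N ..
  let ?g = "frag_extend (\<lambda>(x :: 'd, y). frag_of (x, f y))"
  have f_zero: "f \<zero>\<^bsub>N'\<^esub> = \<zero>\<^bsub>N\<^esub>"
  proof -
    have "f (\<zero> \<odot>\<^bsub>N'\<^esub> \<zero>\<^bsub>N'\<^esub>) = \<zero> \<odot>\<^bsub>N\<^esub> f \<zero>\<^bsub>N'\<^esub>" "f \<zero>\<^bsub>N'\<^esub> \<in> carrier N"
      using f zero_closed N'.zero_closed unfolding linear_maps_def by blast+
    then show ?thesis by simp
  qed
  show "inj_on (tensor_map R M N f) (carrier (tensor_product R M N'))"
  proof (rule inj_onI)
    fix C D
    assume "C \<in> carrier (tensor_product R M N')" "D \<in> carrier (tensor_product R M N')"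
      and eq: "tensor_map R M N f C = tensor_map R M N f D"
    then obtain x y where x: "C = N'.T #>\<^bsub>N'.F\<^esub> x" "Poly_Mapping.keys x \<subseteq> carrier M \<times> carrier N'"
      and y: "D = N'.T #>\<^bsub>N'.F\<^esub> y" "Poly_Mapping.keys y \<subseteq> carrier M \<times> carrier N'"
      by (auto simp: N'.carrier_tensor_product)
    have c: "Poly_Mapping.keys (x - y) \<subseteq> carrier M \<times> carrier N'"
      using x(2) y(2) keys_diff[of x y] by auto
    have "?g (x - y) \<in> N.T"
      using eq unfolding x y tensor_map_coset[OF module_axioms N' N f] N.tensor_coset_eq_iff
      by (simp add: frag_extend_diff)
    then have "f (coordinate_hom N' b (x - y)) = f \<zero>\<^bsub>N'\<^esub>" for b
      using coordinate_hom_natural[OF N' N f c, of b]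
        coordinate_hom_relation[OF N, of "?g (x - y)" b] f_zero by simp
    then have 0: "coordinate_hom N' b (x - y) = \<zero>\<^bsub>N'\<^esub>" for b
      using inj coordinate_hom_closed[OF N' c, of b] by (auto dest: inj_onD)
    obtain B where "x - y - (\<Sum>b\<in>B. frag_of (e b, coordinate_hom N' b (x - y))) \<in> N'.T"
      using tensor_expansion[OF N' c] by blast
    moreover have "(\<Sum>b\<in>B. frag_of (e b, coordinate_hom N' b (x - y))) \<in> N'.T"
      unfolding 0 using basis_closed by (intro N'.tensor_relations_sum N'.tensor_zero)
    ultimately have "x - y \<in> N'.T"
      using N'.tensor_relations_add by fastforce
    then show "C = D"
      unfolding x y N'.tensor_coset_eq_iff .
  qed
qed

end

text \<open>
  The ring \<open>R\<close> as a module over itself, transported along \<open>u\<close> into the type whose modules test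
  flatness.
\<close>

definition regular_copy :: "('a \<Rightarrow> 'c) \<Rightarrow> ('a, 'b) ring_scheme \<Rightarrow> ('a, 'c) module" where
  "regular_copy u R = (let v = the_inv_into (carrier R) u in
     \<lparr>carrier = u ` carrier R, monoid.mult = undefined, one = undefined, ring.zero = u \<zero>\<^bsub>R\<^esub>,
      add = (\<lambda>x y. u (v x \<oplus>\<^bsub>R\<^esub> v y)), smult = (\<lambda>a x. u (a \<otimes>\<^bsub>R\<^esub> v x))\<rparr>)"

lemma regular_copy_simps:
  assumes "inj_on u (carrier R)"
  shows "carrier (regular_copy u R) = u ` carrier R"
    and "\<zero>\<^bsub>regular_copy u R\<^esub> = u \<zero>\<^bsub>R\<^esub>"
    and "\<And>x y. x \<in> carrier R \<Longrightarrow> y \<in> carrier R \<Longrightarrow> u x \<oplus>\<^bsub>regular_copy u R\<^esub> u y = u (x \<oplus>\<^bsub>R\<^esub> y)"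
    and "\<And>a x. x \<in> carrier R \<Longrightarrow> a \<odot>\<^bsub>regular_copy u R\<^esub> u x = u (a \<otimes>\<^bsub>R\<^esub> x)"
  using assms by (simp_all add: regular_copy_def Let_def the_inv_into_f_f)

lemma module_regular_copy:
  fixes R :: "('a, 'b) ring_scheme" (structure)
  assumes "cring R" and u: "inj_on u (carrier R)"
  shows "Module.module R (regular_copy u R)"
proof -
  interpret cring R by fact
  let ?C = "regular_copy u R"
  note [simp] = regular_copy_simps[OF u]
  have "abelian_group ?C"
  proof (rule abelian_groupI)
    fix x assume "x \<in> carrier ?C"
    then obtain a where "x = u a" "a \<in> carrier R" by auto
    then show "\<exists>y\<in>carrier ?C. y \<oplus>\<^bsub>?C\<^esub> x = \<zero>\<^bsub>?C\<^esub>"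
      by (intro bexI[of _ "u (\<ominus> a)"]) (auto simp: l_neg)
  qed (auto simp: a_ac)
  then show ?thesis
    by (intro Module.moduleI is_cring) (auto simp: l_distr r_distr m_assoc)
qed

text \<open>
  A regular element \<open>a\<close> acts injectively on \<open>R\<close>, hence by flatness on \<open>M \<otimes> R\<close>. There
  \<open>m \<otimes> 1\<close> goes to \<open>m \<otimes> a = (a \<odot> m) \<otimes> 1 = 0\<close>, so \<open>m \<otimes> 1\<close> vanishes, and the multiplication map from
  \<open>M \<otimes> R\<close> to \<open>M\<close> returns \<open>m = 0\<close>.
\<close>

lemma flat_module_torsion_free:
  fixes R :: "('a, 'b) ring_scheme" (structure) and u :: "'a \<Rightarrow> 'c"
  assumes flat: "flat_module TYPE('c) R M" and u: "inj_on u (carrier R)"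
    and a: "a \<in> carrier R" "\<And>x. x \<in> carrier R \<Longrightarrow> a \<otimes> x = \<zero> \<Longrightarrow> x = \<zero>"
    and m: "m \<in> carrier M" "a \<odot>\<^bsub>M\<^esub> m = \<zero>\<^bsub>M\<^esub>"
  shows "m = \<zero>\<^bsub>M\<^esub>"
proof -
  interpret Module.module R M
    using flat by (simp add: flat_module_def)
  let ?C = "regular_copy u R"
  note simps = regular_copy_simps[OF u]
  interpret C: Module.module R ?C
    by (rule module_regular_copy[OF is_cring u])
  interpret C: module_pair R M ?C ..
  define v where "v = the_inv_into (carrier R) u"
  have v: "v (u x) = x" if "x \<in> carrier R" for x
    unfolding v_def using u that by (rule the_inv_into_f_f)
  let ?f = "\<lambda>x. a \<odot>\<^bsub>?C\<^esub> x"
  have f: "?f \<in> linear_maps R ?C ?C"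
    using a(1) by (auto simp: linear_maps_def C.smult_r_distr C.smult_assoc1[symmetric] m_comm)
  have "inj_on ?f (carrier ?C)"
  proof (rule inj_onI)
    fix x y assume "x \<in> carrier ?C" "y \<in> carrier ?C" and eq: "?f x = ?f y"
    then obtain b c where bc: "x = u b" "b \<in> carrier R" "y = u c" "c \<in> carrier R"
      by (auto simp: simps)
    then have "a \<otimes> b = a \<otimes> c"
      using eq u a(1) by (auto simp: simps dest: inj_onD)
    then have "a \<otimes> (b \<ominus> c) = \<zero>"
      using a(1) bc by (simp add: a_minus_def R.r_distr R.r_minus R.r_neg)
    then have "b \<ominus> c = \<zero>"
      using a(2) bc by simp
    then show "x = y"
      using bc by (simp add: r_right_minus_eq)
  qed
  then have inj: "inj_on (tensor_map R M ?C ?f) (carrier (tensor_product R M ?C))"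
    using flat module_regular_copy[OF is_cring u] f unfolding flat_module_def by blast
  have one: "u \<one> \<in> carrier ?C"
    by (simp add: simps)
  have "frag_of (m, ?f (u \<one>)) \<in> C.T"
  proof -
    have "frag_of (\<zero>\<^bsub>M\<^esub>, u \<one>) - (frag_of (a \<odot>\<^bsub>M\<^esub> m, u \<one>) - frag_of (m, ?f (u \<one>))) \<in> C.T"
      using a(1) m(1) one by (intro C.tensor_relations_diff C.zero_tensor C.tensor_relation_smult)
    then show ?thesis by (simp add: m(2))
  qed
  then have "tensor_map R M ?C ?f (C.T #>\<^bsub>C.F\<^esub> frag_of (m, u \<one>)) =
      tensor_map R M ?C ?f (C.T #>\<^bsub>C.F\<^esub> 0)"
    unfolding tensor_map_coset[OF module_axioms C.module_axioms C.module_axioms f]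
    by (simp add: C.tensor_coset_eq_iff)
  moreover have "C.T #>\<^bsub>C.F\<^esub> c \<in> carrier (tensor_product R M ?C)" if "c \<in> carrier C.F" for c
    unfolding C.carrier_tensor_product using that by blast
  then have "C.T #>\<^bsub>C.F\<^esub> frag_of (m, u \<one>) \<in> carrier (tensor_product R M ?C)"
    "C.T #>\<^bsub>C.F\<^esub> 0 \<in> carrier (tensor_product R M ?C)"
    using m(1) one by simp_all
  ultimately have "C.T #>\<^bsub>C.F\<^esub> frag_of (m, u \<one>) = C.T #>\<^bsub>C.F\<^esub> 0"
    using inj by (auto dest: inj_onD)
  then have 0: "frag_of (m, u \<one>) \<in> C.T"
    by (simp add: C.tensor_coset_eq_iff)
  obtain \<phi> where \<phi>: "\<And>x y. x \<in> carrier M \<Longrightarrow> y \<in> carrier ?C \<Longrightarrow> \<phi> (frag_of (x, y)) = v y \<odot>\<^bsub>M\<^esub> x"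
    "\<And>t. t \<in> C.T \<Longrightarrow> \<phi> t = \<one>\<^bsub>add_monoid M\<^esub>"
  proof (rule C.balanced_map_extends[where g = "\<lambda>x y. v y \<odot>\<^bsub>M\<^esub> x"])
    show "comm_group (add_monoid M)"
      by (rule a_comm_group)
    fix x assume x: "x \<in> carrier M"
    fix y assume "y \<in> carrier ?C"
    then obtain b where b: "y = u b" "b \<in> carrier R"
      by (auto simp: simps)
    show "v y \<odot>\<^bsub>M\<^esub> x \<in> carrier (add_monoid M)"
      using x b by (simp add: v)
    show "v y \<odot>\<^bsub>M\<^esub> (x \<oplus>\<^bsub>M\<^esub> x') = (v y \<odot>\<^bsub>M\<^esub> x) \<otimes>\<^bsub>add_monoid M\<^esub> (v y \<odot>\<^bsub>M\<^esub> x')"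
      if "x' \<in> carrier M" for x'
      using x b that by (simp add: v smult_r_distr)
    show "v y \<odot>\<^bsub>M\<^esub> (c \<odot>\<^bsub>M\<^esub> x) = v (c \<odot>\<^bsub>?C\<^esub> y) \<odot>\<^bsub>M\<^esub> x" if "c \<in> carrier R" for c
      using x b that by (simp add: v simps m_comm[of c b] smult_assoc1)
    fix y' assume "y' \<in> carrier ?C"
    then obtain b' where b': "y' = u b'" "b' \<in> carrier R"
      by (auto simp: simps)
    show "v (y \<oplus>\<^bsub>?C\<^esub> y') \<odot>\<^bsub>M\<^esub> x = (v y \<odot>\<^bsub>M\<^esub> x) \<otimes>\<^bsub>add_monoid M\<^esub> (v y' \<odot>\<^bsub>M\<^esub> x)"
      using x b b' by (simp add: v simps smult_l_distr)
  qed blast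
  have "m = v (u \<one>) \<odot>\<^bsub>M\<^esub> m"
    using m(1) by (simp add: v)
  also have "\<dots> = \<phi> (frag_of (m, u \<one>))"
    by (rule \<phi>(1)[symmetric, OF m(1) one])
  also have "\<dots> = \<zero>\<^bsub>M\<^esub>"
    using \<phi>(2)[OF 0] by simp
  finally show ?thesis .
qed


section \<open>Orders on exponents\<close>

locale exponent_ordering =
  fixes r :: "(nat ^ 'n::finite) rel"
  assumes order: "exponent_order r"
begin

lemma order_refl: "(\<alpha>, \<alpha>) \<in> r"
  and order_total: "(\<alpha>, \<beta>) \<in> r \<or> (\<beta>, \<alpha>) \<in> r"
  and order_antisym: "(\<alpha>, \<beta>) \<in> r \<Longrightarrow> (\<beta>, \<alpha>) \<in> r \<Longrightarrow> \<alpha> = \<beta>"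
  and order_trans: "(\<alpha>, \<beta>) \<in> r \<Longrightarrow> (\<beta>, \<gamma>) \<in> r \<Longrightarrow> (\<alpha>, \<gamma>) \<in> r"
  and order_wf: "wf (r - Id)"
proof -
  have r: "refl_on UNIV r" "trans r" "antisym r" "total_on UNIV r"
    using order by (auto simp: exponent_order_def well_order_on_def linear_order_on_def
        partial_order_on_def preorder_on_def)
  show refl: "(\<alpha>, \<alpha>) \<in> r" for \<alpha>
    using r(1) by (auto simp: refl_on_def)
  show "(\<alpha>, \<beta>) \<in> r \<or> (\<beta>, \<alpha>) \<in> r"
    using r(4) refl[of \<alpha>] by (cases "\<alpha> = \<beta>") (auto simp: total_on_def)
  show "(\<alpha>, \<beta>) \<in> r \<Longrightarrow> (\<beta>, \<alpha>) \<in> r \<Longrightarrow> \<alpha> = \<beta>"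
    using r(3) by (auto simp: antisym_def)
  show "(\<alpha>, \<beta>) \<in> r \<Longrightarrow> (\<beta>, \<gamma>) \<in> r \<Longrightarrow> (\<alpha>, \<gamma>) \<in> r"
    using r(2) by (auto simp: trans_def)
  show "wf (r - Id)"
    using order by (simp add: exponent_order_def well_order_on_def)
qed

lemma order_add_right: "(\<alpha>, \<beta>) \<in> r \<Longrightarrow> (\<alpha> + \<gamma>, \<beta> + \<gamma>) \<in> r"
  using order order_refl by (cases "\<alpha> = \<beta>") (auto simp: exponent_order_def)

text \<open>
  A least exponent \<open>m\<close> satisfies \<open>m + m \<le> 0 + m = m\<close>, hence \<open>m + m = m\<close>, which forces \<open>m = 0\<close>.
\<close>

lemma order_zero: "(0, \<alpha>) \<in> r"
proof -
  have "\<exists>m\<in>UNIV. \<forall>\<beta>. (\<beta>, m) \<in> r - Id \<longrightarrow> \<beta> \<notin> UNIV"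
    using order_wf unfolding wf_eq_minimal by blast
  then obtain m where "\<And>\<beta>. (\<beta>, m) \<notin> r - Id"
    by auto
  then have m: "(m, \<beta>) \<in> r" for \<beta>
    using order_total[of m \<beta>] order_refl by blast
  have "m = m + m"
    using order_add_right[OF m[of 0], of m] m[of "m + m"] by (intro order_antisym) simp_all
  then show ?thesis
    using m[of \<alpha>] by simp
qed

lemma order_add: "(\<alpha>, \<alpha> + \<gamma>) \<in> r"
  using order_add_right[OF order_zero[of \<gamma>], of \<alpha>] by (simp add: add.commute)

lemma order_max:
  assumes "finite {\<alpha>. p \<alpha> \<noteq> 0}" and "p \<noteq> (\<lambda>_. 0)"
  obtains \<alpha> where "p \<alpha> \<noteq> 0" "\<And>\<beta>. p \<beta> \<noteq> 0 \<Longrightarrow> (\<beta>, \<alpha>) \<in> r"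
proof -
  have "\<exists>\<alpha>\<in>A. \<forall>\<beta>\<in>A. (\<beta>, \<alpha>) \<in> r" if "finite A" "A \<noteq> {}" for A
    using that
  proof (induction rule: finite_ne_induct)
    case (singleton \<alpha>)
    then show ?case using order_refl by auto
  next
    case (insert \<beta> A)
    then obtain \<alpha> where "\<alpha> \<in> A" "\<forall>\<gamma>\<in>A. (\<gamma>, \<alpha>) \<in> r" by blast
    then show ?case
      using order_total[of \<alpha> \<beta>] order_trans order_refl by (metis insert_iff)
  qed
  from this[OF assms(1)] show thesis
    using assms(2) that by (auto simp: fun_eq_iff)
qed

end


section \<open>Rings of differential operators\<close>

lemma a_inv_ring_on: "\<ominus>\<^bsub>ring_on R\<^esub> x = - x" if "cring (ring_on R)" "x \<in> R" "- x \<in> R"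
  using that by (intro abelian_group.minus_equality) (auto simp: cring_def ring_def)

locale diff_subring =
  fixes \<iota> :: "'n::finite \<Rightarrow> 'v::finite" and R :: "('k::field_char_0, 'v) mvfrac set"
  assumes inj_\<iota>: "inj \<iota>"
    and subring: "subring R (ring_on UNIV)"
    and stable: "\<And>i h. h \<in> R \<Longrightarrow> pderiv_frac (\<iota> i) h \<in> R"
begin

abbreviation D where "D \<equiv> diffop_ring \<iota> R"

lemma cring_ring_on: "cring (ring_on R)"
proof -
  interpret K: cring "ring_on UNIV :: ('k, 'v) mvfrac ring"
    by (rule cring_ring_on_UNIV)
  have "subcring R (ring_on UNIV)"
    using K.subcringI'[OF subring] .
  then have "cring ((ring_on UNIV)\<lparr>carrier := R\<rparr>)"
    using K.subcring_iff[of R] subringE(1)[OF subring] by simp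
  then show ?thesis by (simp add: ring_on_def)
qed

lemma zero_closed: "0 \<in> R" and one_closed: "1 \<in> R"
  and add_closed: "a \<in> R \<Longrightarrow> b \<in> R \<Longrightarrow> a + b \<in> R"
  and mult_closed: "a \<in> R \<Longrightarrow> b \<in> R \<Longrightarrow> a * b \<in> R"
  using subringE(2,3,6,7)[OF subring] by auto

lemma uminus_closed: "a \<in> R \<Longrightarrow> - a \<in> R"
proof -
  assume a: "a \<in> R"
  interpret K: cring "ring_on UNIV :: ('k, 'v) mvfrac ring"
    by (rule cring_ring_on_UNIV)
  show "- a \<in> R"
    using subringE(5)[OF subring a] by (simp add: a_inv_ring_on[OF K.is_cring])
qed

lemma diff_closed: "a \<in> R \<Longrightarrow> b \<in> R \<Longrightarrow> a - b \<in> R"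
  using add_closed[of a "- b"] uminus_closed[of b] by simp

lemma ideal_ring_onI:
  assumes "J \<subseteq> R" "0 \<in> J" "\<And>a b. a \<in> J \<Longrightarrow> b \<in> J \<Longrightarrow> a + b \<in> J"
    and mult: "\<And>a b. a \<in> R \<Longrightarrow> b \<in> J \<Longrightarrow> a * b \<in> J"
  shows "ideal J (ring_on R)"
proof (rule idealI)
  interpret S: cring "ring_on R" by (rule cring_ring_on)
  show "ring (ring_on R)" by (rule S.ring_axioms)
  show "subgroup J (add_monoid (ring_on R))"
  proof (rule group.subgroupI)
    show "group (add_monoid (ring_on R))"
      by (rule S.a_group)
    fix a assume a: "a \<in> J"
    have "- a \<in> J"
      using mult[of "- 1" a] uminus_closed[OF one_closed] a by simp
    then have "\<ominus>\<^bsub>ring_on R\<^esub> a \<in> J"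
      using a assms(1) by (subst a_inv_ring_on[OF S.is_cring]) auto
    then show "inv\<^bsub>add_monoid (ring_on R)\<^esub> a \<in> J"
      by (simp add: a_inv_def)
  qed (use assms in auto)
  fix a x assume a: "a \<in> J" and "x \<in> carrier (ring_on R)"
  then have "x * a \<in> J" using mult by simp
  then show "x \<otimes>\<^bsub>ring_on R\<^esub> a \<in> J" and "a \<otimes>\<^bsub>ring_on R\<^esub> x \<in> J"
    by (simp_all add: mult.commute)
qed

lemma diffop_ring_simps:
  "P \<otimes>\<^bsub>D\<^esub> Q = P \<circ> Q" "\<one>\<^bsub>D\<^esub> = id" "\<zero>\<^bsub>D\<^esub> = (\<lambda>_. 0)" "P \<oplus>\<^bsub>D\<^esub> Q = (\<lambda>f. P f + Q f)"
  by (auto simp: diffop_ring_def operator_ring_def)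

lemma diffop_closed: "diffop \<iota> p \<in> carrier D" if "finite {\<alpha>. p \<alpha> \<noteq> 0}" "range p \<subseteq> R"
proof -
  have "\<exists>q. finite {\<alpha>. q \<alpha> \<noteq> 0} \<and> range q \<subseteq> R \<and> diffop \<iota> p = diffop \<iota> q"
    using that by (intro exI[of _ p] conjI refl)
  then show ?thesis
    by (simp only: diffop_ring_normal_form[OF subring stable])
qed

lemma diffop_ringE:
  assumes "P \<in> carrier D"
  obtains p where "finite {\<alpha>. p \<alpha> \<noteq> 0}" "range p \<subseteq> R" "P = diffop \<iota> p"
proof -
  have "\<exists>p. finite {\<alpha>. p \<alpha> \<noteq> 0} \<and> range p \<subseteq> R \<and> P = diffop \<iota> p"
    using assms by (simp only: diffop_ring_normal_form[OF subring stable])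
  then show thesis
    using that by (elim exE conjE)
qed

lemma diffop_closed_iff:
  assumes "finite {\<alpha>. p \<alpha> \<noteq> 0}"
  shows "diffop \<iota> p \<in> carrier D \<longleftrightarrow> range p \<subseteq> R"
proof
  assume "diffop \<iota> p \<in> carrier D"
  then obtain q where q: "finite {\<alpha>. q \<alpha> \<noteq> 0}" "range q \<subseteq> R" "diffop \<iota> p = diffop \<iota> q"
    by (rule diffop_ringE)
  have "p = diffop_coeff \<iota> (diffop \<iota> q)"
    unfolding q(3)[symmetric] by (rule diffop_coeff_diffop[OF inj_\<iota> assms, symmetric])
  also have "\<dots> = q"
    by (rule diffop_coeff_diffop[OF inj_\<iota> q(1)])
  finally show "range p \<subseteq> R"
    using q(2) by simp
qed (rule diffop_closed[OF assms])

lemma diffop_linear: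
  fixes p q :: "nat ^ 'n \<Rightarrow> ('k, 'v) mvfrac"
  assumes p: "finite {\<alpha>. p \<alpha> \<noteq> 0}" and q: "finite {\<alpha>. q \<alpha> \<noteq> 0}"
  shows "finite {\<alpha>. p \<alpha> + h * q \<alpha> \<noteq> 0}"
    and "diffop \<iota> (\<lambda>\<alpha>. p \<alpha> + h * q \<alpha>) = (\<lambda>f. diffop \<iota> p f + h * diffop \<iota> q f)"
proof -
  let ?A = "{\<alpha>. p \<alpha> \<noteq> 0} \<union> {\<alpha>. q \<alpha> \<noteq> 0}"
  have A: "finite ?A" and sub: "{\<alpha>. p \<alpha> + h * q \<alpha> \<noteq> 0} \<subseteq> ?A"
    using p q by auto
  then show "finite {\<alpha>. p \<alpha> + h * q \<alpha> \<noteq> 0}"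
    using finite_subset by blast
  show "diffop \<iota> (\<lambda>\<alpha>. p \<alpha> + h * q \<alpha>) = (\<lambda>f. diffop \<iota> p f + h * diffop \<iota> q f)"
    using A sub by (simp add: fun_eq_iff diffop_superset[of ?A] sum.distrib sum_distrib_left
        distrib_right mult.assoc)
qed

lemma diffop_single: "diffop \<iota> (\<lambda>\<beta>. if \<beta> = \<alpha> then h else 0) = (\<lambda>f. h * diff_monom \<iota> \<alpha> f)"
  by (subst fun_eq_iff, subst diffop_superset[of "{\<alpha>}"]) auto

lemma diff_monom_closed: "diff_monom \<iota> \<alpha> \<in> carrier D"
proof -
  have "diffop \<iota> (\<lambda>\<beta>. if \<beta> = \<alpha> then 1 else 0) \<in> carrier D"
    using zero_closed one_closed by (intro diffop_closed) auto
  then show ?thesis by (simp add: diffop_single)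
qed

lemma mult_op_closed: "(\<lambda>f. h * f) \<in> carrier D" if "h \<in> R"
proof -
  have "diffop \<iota> (\<lambda>\<beta>. if \<beta> = 0 then h else 0) \<in> carrier D"
    using zero_closed that by (intro diffop_closed) auto
  then show ?thesis by (simp add: diffop_single)
qed

text \<open>
  The Leibniz rule on coefficients: \<open>\<partial>\<^sub>i\<close> composed with \<open>p \<partial>\<^sup>\<beta>\<close> is \<open>(\<partial>\<^sub>i p) \<partial>\<^sup>\<beta> + p \<partial>\<^sup>\<gamma>\<close>, where \<open>\<gamma>\<close>
  raises the \<open>i\<close>-th entry of \<open>\<beta>\<close> by one. The case distinction keeps the truncated subtraction of
  exponents from contributing when there is no preimage to shift.
\<close>

lemma pderiv_frac_comp_diffop:
  fixes p :: "nat ^ 'n \<Rightarrow> ('k, 'v) mvfrac" and i :: 'n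
  assumes p: "finite {\<alpha>. p \<alpha> \<noteq> 0}"
  defines "q \<equiv> \<lambda>\<beta>. pderiv_frac (\<iota> i) (p \<beta>) + (if \<beta> $ i = 0 then 0 else p (\<beta> - unit_exponent i))"
  shows "finite {\<alpha>. q \<alpha> \<noteq> 0}" and "pderiv_frac (\<iota> i) \<circ> diffop \<iota> p = diffop \<iota> q"
proof -
  let ?e = "unit_exponent i :: nat ^ 'n"
  let ?S = "{\<alpha>. p \<alpha> \<noteq> 0}"
  let ?S' = "(\<lambda>\<alpha>. \<alpha> + ?e) ` ?S"
  have cancel: "\<alpha> + ?e - ?e = \<alpha>" for \<alpha>
    by (simp add: vec_eq_iff)
  have sub': "{\<beta>. (if \<beta> $ i = 0 then 0 else p (\<beta> - ?e)) \<noteq> 0} \<subseteq> ?S'"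
  proof
    fix \<beta> assume \<beta>: "\<beta> \<in> {\<beta>. (if \<beta> $ i = 0 then 0 else p (\<beta> - ?e)) \<noteq> 0}"
    then obtain \<gamma> where "\<beta> = \<gamma> + ?e"
      using exponent_decomp[of \<beta> i] by (auto split: if_splits)
    then show "\<beta> \<in> ?S'"
      using \<beta> by (auto simp: cancel split: if_splits)
  qed
  have A: "finite (?S \<union> ?S')" using p by simp
  have sub: "{\<alpha>. q \<alpha> \<noteq> 0} \<subseteq> ?S \<union> ?S'"
  proof
    fix \<beta> assume \<beta>: "\<beta> \<in> {\<alpha>. q \<alpha> \<noteq> 0}"
    show "\<beta> \<in> ?S \<union> ?S'"
    proof (cases "p \<beta> = 0")
      case True
      then have "\<beta> \<in> {\<beta>. (if \<beta> $ i = 0 then 0 else p (\<beta> - ?e)) \<noteq> 0}"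
        using \<beta> by (simp add: q_def)
      then show ?thesis using sub' by blast
    qed simp
  qed
  with A show "finite {\<alpha>. q \<alpha> \<noteq> 0}"
    using finite_subset by blast
  show "pderiv_frac (\<iota> i) \<circ> diffop \<iota> p = diffop \<iota> q"
  proof
    fix f
    have "(\<Sum>\<beta>\<in>?S'. (if \<beta> $ i = 0 then 0 else p (\<beta> - ?e)) * diff_monom \<iota> \<beta> f) =
        (\<Sum>\<alpha>\<in>?S. p \<alpha> * diff_monom \<iota> (\<alpha> + ?e) f)"
      by (subst sum.reindex) (auto simp: inj_on_def cancel)
    moreover have "(\<Sum>\<beta>\<in>?S \<union> ?S'. (if \<beta> $ i = 0 then 0 else p (\<beta> - ?e)) * diff_monom \<iota> \<beta> f) =
        (\<Sum>\<beta>\<in>?S'. (if \<beta> $ i = 0 then 0 else p (\<beta> - ?e)) * diff_monom \<iota> \<beta> f)"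
    proof (rule sum.mono_neutral_right[OF A], blast, rule ballI)
      fix \<beta> assume "\<beta> \<in> ?S \<union> ?S' - ?S'"
      then have "(if \<beta> $ i = 0 then 0 else p (\<beta> - ?e)) = 0"
        using sub' by blast
      then show "(if \<beta> $ i = 0 then 0 else p (\<beta> - ?e)) * diff_monom \<iota> \<beta> f = 0"
        by (simp only: mult_zero_left)
    qed
    moreover have "(\<Sum>\<beta>\<in>?S \<union> ?S'. pderiv_frac (\<iota> i) (p \<beta>) * diff_monom \<iota> \<beta> f) =
        (\<Sum>\<beta>\<in>?S. pderiv_frac (\<iota> i) (p \<beta>) * diff_monom \<iota> \<beta> f)"
      using A by (intro sum.mono_neutral_right) auto
    ultimately have "diffop \<iota> q f = (\<Sum>\<alpha>\<in>?S. pderiv_frac (\<iota> i) (p \<alpha>) * diff_monom \<iota> \<alpha> f) +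
        (\<Sum>\<alpha>\<in>?S. p \<alpha> * diff_monom \<iota> (\<alpha> + ?e) f)"
      unfolding diffop_superset[OF A sub] by (simp only: q_def distrib_right sum.distrib)
    then show "(pderiv_frac (\<iota> i) \<circ> diffop \<iota> p) f = diffop \<iota> q f"
      by (simp add: diffop_def pderiv_frac_sum pderiv_frac_mult diff_monom_step sum.distrib)
  qed
qed

text \<open>
  Composing with \<open>\<partial>\<^sup>\<gamma>\<close> on the left shifts the leading exponent by \<open>\<gamma>\<close> and keeps the leading
  coefficient, because derivatives of coefficients appear only at exponents that are not shifted
  as far, and these are smaller.
\<close>

lemma diff_monom_comp_diffop:
  fixes p :: "nat ^ 'n \<Rightarrow> ('k, 'v) mvfrac" and \<gamma> :: "nat ^ 'n"
  assumes "exponent_order r" and p: "finite {\<alpha>. p \<alpha> \<noteq> 0}" "\<And>\<beta>. p \<beta> \<noteq> 0 \<Longrightarrow> (\<beta>, \<alpha>) \<in> r"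
  shows "\<exists>q. finite {\<alpha>. q \<alpha> \<noteq> 0} \<and> (\<forall>\<beta>. q \<beta> \<noteq> 0 \<longrightarrow> (\<beta>, \<alpha> + \<gamma>) \<in> r) \<and>
    q (\<alpha> + \<gamma>) = p \<alpha> \<and> diff_monom \<iota> \<gamma> \<circ> diffop \<iota> p = diffop \<iota> q"
proof (induction \<gamma> rule: exponent_induct)
  case 0
  show ?case using p by (auto intro!: exI[of _ p])
next
  case (step \<gamma> i)
  interpret exponent_ordering r by unfold_locales fact
  let ?e = "unit_exponent i :: nat ^ 'n"
  obtain q where q: "finite {\<alpha>. q \<alpha> \<noteq> 0}" "\<And>\<beta>. q \<beta> \<noteq> 0 \<Longrightarrow> (\<beta>, \<alpha> + \<gamma>) \<in> r"
    "q (\<alpha> + \<gamma>) = p \<alpha>" "diff_monom \<iota> \<gamma> \<circ> diffop \<iota> p = diffop \<iota> q"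
    using step by blast
  define q' where
    "q' = (\<lambda>\<beta>. pderiv_frac (\<iota> i) (q \<beta>) + (if \<beta> $ i = 0 then 0 else q (\<beta> - ?e)))"
  have fin: "finite {\<alpha>. q' \<alpha> \<noteq> 0}" and comp: "pderiv_frac (\<iota> i) \<circ> diffop \<iota> q = diffop \<iota> q'"
    using pderiv_frac_comp_diffop[OF q(1), of i] by (simp_all add: q'_def)
  have assoc: "\<alpha> + (\<gamma> + ?e) = \<alpha> + \<gamma> + ?e"
    by (simp add: add.assoc)
  have le: "(\<beta>, \<alpha> + \<gamma> + ?e) \<in> r" if "q' \<beta> \<noteq> 0" for \<beta>
  proof (cases "\<beta> $ i = 0 \<or> q (\<beta> - ?e) = 0")
    case True
    then have "q \<beta> \<noteq> 0"
      using that unfolding q'_def by (cases "\<beta> $ i = 0") auto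
    then show ?thesis
      using q(2) order_trans order_add by blast
  next
    case False
    then obtain \<delta> where \<delta>: "\<beta> = \<delta> + ?e"
      using exponent_decomp[of \<beta> i] by blast
    then have "\<beta> - ?e = \<delta>" by (simp add: vec_eq_iff)
    then show ?thesis
      using False q(2)[of \<delta>] order_add_right \<delta> by simp
  qed
  have "q (\<alpha> + \<gamma> + ?e) = 0"
  proof (rule ccontr)
    assume "q (\<alpha> + \<gamma> + ?e) \<noteq> 0"
    then have "\<alpha> + \<gamma> + ?e = \<alpha> + \<gamma>"
      using q(2) order_add order_antisym by blast
    then show False
      by (metis exponent_degree_step n_not_Suc_n)
  qed
  moreover have "\<alpha> + \<gamma> + ?e - ?e = \<alpha> + \<gamma>"
    by (simp add: vec_eq_iff)
  moreover have "(\<alpha> + \<gamma> + ?e) $ i \<noteq> 0"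
    by (simp add: unit_exponent_nth)
  ultimately have "q' (\<alpha> + \<gamma> + ?e) = p \<alpha>"
    using q(3) by (simp add: q'_def)
  moreover have "diff_monom \<iota> (\<gamma> + ?e) \<circ> diffop \<iota> p = diffop \<iota> q'"
    using comp q(4) by (simp add: diff_monom_step comp_assoc)
  ultimately show ?case
    using fin le unfolding assoc by blast
qed

end


section \<open>Left ideals of operators and their quotient modules\<close>

locale left_ideal_of_operators = diff_subring \<iota> R
  for \<iota> :: "'n::finite \<Rightarrow> 'v::finite" and R :: "('k::field_char_0, 'v) mvfrac set" +
  fixes J :: "(('k, 'v) mvfrac \<Rightarrow> ('k, 'v) mvfrac) set"
  assumes left_ideal: "left_ideal J (diffop_ring \<iota> R)"
begin

lemma ideal_subset: "J \<subseteq> carrier D"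
  and ideal_zero: "(\<lambda>_. 0) \<in> J"
  and ideal_add: "P \<in> J \<Longrightarrow> Q \<in> J \<Longrightarrow> (\<lambda>f. P f + Q f) \<in> J"
  and ideal_comp: "A \<in> carrier D \<Longrightarrow> P \<in> J \<Longrightarrow> A \<circ> P \<in> J"
proof -
  interpret D: ring D by (rule ring_diffop_ring)
  interpret additive_subgroup J D
    using left_ideal by (simp add: left_ideal_def)
  show "J \<subseteq> carrier D" by (rule a_subset)
  show "(\<lambda>_. 0) \<in> J" using zero_closed by (simp add: diffop_ring_simps)
  show "P \<in> J \<Longrightarrow> Q \<in> J \<Longrightarrow> (\<lambda>f. P f + Q f) \<in> J"
    using a_closed[of P Q] by (simp add: diffop_ring_simps)
  show "A \<in> carrier D \<Longrightarrow> P \<in> J \<Longrightarrow> A \<circ> P \<in> J"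
    using left_ideal by (auto simp: left_ideal_def diffop_ring_simps)
qed

lemma ideal_mult: "(\<lambda>f. h * P f) \<in> J" if "h \<in> R" "P \<in> J"
  using ideal_comp[OF mult_op_closed[OF that(1)] that(2)] by (simp add: comp_def)

lemma ideal_uminus: "(\<lambda>f. - P f) \<in> J" if "P \<in> J"
  using ideal_mult[OF uminus_closed[OF one_closed] that] by simp

lemma ideal_diff: "(\<lambda>f. P f - Q f) \<in> J" if "P \<in> J" "Q \<in> J"
  using ideal_add[OF that(1) ideal_uminus[OF that(2)]] by simp

abbreviation M where "M \<equiv> diffop_quotient \<iota> R J"

abbreviation coset where "coset P \<equiv> J +>\<^bsub>D\<^esub> P"

lemma mem_coset: "Q \<in> coset P \<longleftrightarrow> (\<lambda>f. Q f - P f) \<in> J"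
proof
  assume "Q \<in> coset P"
  then show "(\<lambda>f. Q f - P f) \<in> J"
    by (auto simp: a_r_coset_def' diffop_ring_simps)
next
  assume "(\<lambda>f. Q f - P f) \<in> J"
  then have "(\<lambda>f. (Q f - P f) + P f) \<in> coset P"
    unfolding a_r_coset_def' diffop_ring_simps by blast
  then show "Q \<in> coset P" by simp
qed

lemma coset_eq_iff: "coset P = coset Q \<longleftrightarrow> (\<lambda>f. P f - Q f) \<in> J"
proof
  have "P \<in> coset P"
    by (simp add: mem_coset ideal_zero)
  then show "(\<lambda>f. P f - Q f) \<in> J" if "coset P = coset Q"
    using that by (simp add: mem_coset)
  assume PQ: "(\<lambda>f. P f - Q f) \<in> J"
  have "(\<lambda>f. A f - P f) \<in> J \<longleftrightarrow> (\<lambda>f. A f - Q f) \<in> J" for A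
    using ideal_add[OF _ PQ, of "\<lambda>f. A f - P f"] ideal_diff[OF _ PQ, of "\<lambda>f. A f - Q f"] by auto
  then show "coset P = coset Q"
    by (auto simp: mem_coset)
qed

lemma coset_eqI: "Q \<in> coset P \<Longrightarrow> coset P = coset Q"
  using coset_eq_iff[of Q P] by (simp add: mem_coset)

lemma coset_zero: "coset (\<lambda>_. 0) = J"
  by (auto simp: mem_coset)

lemma carrier_quotient: "carrier M = coset ` carrier D"
  by (auto simp: diffop_quotient_def Let_def A_RCOSETS_def')

lemma zero_quotient: "\<zero>\<^bsub>M\<^esub> = coset (\<lambda>_. 0)"
  by (simp add: diffop_quotient_def Let_def coset_zero)

lemma add_quotient: "coset P \<oplus>\<^bsub>M\<^esub> coset Q = coset (\<lambda>f. P f + Q f)"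
proof -
  have "C \<in> set_add D (coset P) (coset Q) \<longleftrightarrow> C \<in> coset (\<lambda>f. P f + Q f)" for C
  proof
    assume "C \<in> set_add D (coset P) (coset Q)"
    then obtain A B where "A \<in> coset P" "B \<in> coset Q" "C = (\<lambda>f. A f + B f)"
      by (auto simp: set_add_def' diffop_ring_simps)
    then show "C \<in> coset (\<lambda>f. P f + Q f)"
      using ideal_add[of "\<lambda>f. A f - P f" "\<lambda>f. B f - Q f"] by (simp add: mem_coset algebra_simps)
  next
    assume "C \<in> coset (\<lambda>f. P f + Q f)"
    then have "(\<lambda>f. C f - P f) \<in> coset Q" "P \<in> coset P"
      by (simp_all add: mem_coset ideal_zero algebra_simps)
    then have "(\<lambda>f. P f + (C f - P f)) \<in> set_add D (coset P) (coset Q)"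
      unfolding set_add_def' diffop_ring_simps by blast
    then show "C \<in> set_add D (coset P) (coset Q)" by simp
  qed
  then show ?thesis
    by (auto simp: diffop_quotient_def Let_def)
qed

lemma smult_quotient: "h \<odot>\<^bsub>M\<^esub> coset P = coset (\<lambda>f. h * P f)" if "h \<in> R"
proof -
  have "coset (\<lambda>f. h * Q f) = coset (\<lambda>f. h * P f)" if "Q \<in> coset P" for Q
    using ideal_mult[OF \<open>h \<in> R\<close>, of "\<lambda>f. Q f - P f"] that
    by (simp add: mem_coset coset_eq_iff algebra_simps)
  moreover have "P \<in> coset P"
    by (simp add: mem_coset ideal_zero)
  ultimately have "(\<Union>Q\<in>coset P. coset (\<lambda>f. h * Q f)) = coset (\<lambda>f. h * P f)"
    by blast
  then show ?thesis
    by (simp add: diffop_quotient_def Let_def diffop_ring_simps comp_def)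
qed

lemma module_quotient: "Module.module (ring_on R) M"
proof -
  interpret D: ring D by (rule ring_diffop_ring)
  have add: "(\<lambda>f. P f + Q f) \<in> carrier D" if "P \<in> carrier D" "Q \<in> carrier D" for P Q
    using D.a_closed[OF that] by (simp add: diffop_ring_simps)
  have zero: "(\<lambda>_. 0) \<in> carrier D"
    using D.zero_closed by (simp add: diffop_ring_simps)
  have smult: "(\<lambda>f. h * P f) \<in> carrier D" if "h \<in> R" "P \<in> carrier D" for h P
    using D.m_closed[OF mult_op_closed[OF that(1)] that(2)] by (simp add: diffop_ring_simps comp_def)
  note simps = carrier_quotient zero_quotient add_quotient smult_quotient
  have "abelian_group M"
  proof (rule abelian_groupI)
    fix C assume "C \<in> carrier M"
    then obtain P where P: "P \<in> carrier D" "C = coset P"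
      by (auto simp: simps)
    then have "(\<lambda>f. - P f) \<in> carrier D"
      using smult[OF uminus_closed[OF one_closed]] by simp
    then show "\<exists>C'\<in>carrier M. C' \<oplus>\<^bsub>M\<^esub> C = \<zero>\<^bsub>M\<^esub>"
      using P by (intro bexI[of _ "coset (\<lambda>f. - P f)"]) (auto simp: simps)
    show "\<zero>\<^bsub>M\<^esub> \<oplus>\<^bsub>M\<^esub> C = C"
      using P by (simp add: simps)
    fix C' assume "C' \<in> carrier M"
    then obtain Q where Q: "Q \<in> carrier D" "C' = coset Q"
      by (auto simp: simps)
    show "C \<oplus>\<^bsub>M\<^esub> C' \<in> carrier M"
      using P Q by (simp add: simps add)
    show "C \<oplus>\<^bsub>M\<^esub> C' = C' \<oplus>\<^bsub>M\<^esub> C"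
      using P Q by (simp add: simps add.commute)
    fix C'' assume "C'' \<in> carrier M"
    then show "C \<oplus>\<^bsub>M\<^esub> C' \<oplus>\<^bsub>M\<^esub> C'' = C \<oplus>\<^bsub>M\<^esub> (C' \<oplus>\<^bsub>M\<^esub> C'')"
      using P Q unfolding carrier_quotient by (elim imageE) (simp add: simps add.assoc)
  next
    show "\<zero>\<^bsub>M\<^esub> \<in> carrier M"
      using zero by (simp add: simps)
  qed
  moreover have "a \<odot>\<^bsub>M\<^esub> C \<in> carrier M" if "a \<in> R" "C \<in> carrier M" for a C
    using that by (auto simp: simps smult)
  moreover have "(a + b) \<odot>\<^bsub>M\<^esub> C = a \<odot>\<^bsub>M\<^esub> C \<oplus>\<^bsub>M\<^esub> b \<odot>\<^bsub>M\<^esub> C"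
    if "a \<in> R" "b \<in> R" "C \<in> carrier M" for a b C
    using that unfolding carrier_quotient
    by (elim imageE) (simp add: simps add_closed distrib_right)
  moreover have "a \<odot>\<^bsub>M\<^esub> (C \<oplus>\<^bsub>M\<^esub> C') = a \<odot>\<^bsub>M\<^esub> C \<oplus>\<^bsub>M\<^esub> a \<odot>\<^bsub>M\<^esub> C'"
    if "a \<in> R" "C \<in> carrier M" "C' \<in> carrier M" for a C C'
    using that unfolding carrier_quotient
    by (elim imageE) (simp add: simps distrib_left)
  moreover have "(a * b) \<odot>\<^bsub>M\<^esub> C = a \<odot>\<^bsub>M\<^esub> (b \<odot>\<^bsub>M\<^esub> C)"
    if "a \<in> R" "b \<in> R" "C \<in> carrier M" for a b C
    using that unfolding carrier_quotient
    by (elim imageE) (simp add: simps mult_closed mult.assoc)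
  moreover have "1 \<odot>\<^bsub>M\<^esub> C = C" if "C \<in> carrier M" for C
    using that unfolding carrier_quotient
    by (elim imageE) (simp add: simps one_closed)
  ultimately show ?thesis
    by (intro Module.moduleI cring_ring_on) (simp_all only: ring_on_simps)
qed

lemma finsum_quotient:
  assumes "finite B" "\<And>b. b \<in> B \<Longrightarrow> P b \<in> carrier D"
  shows "(\<Oplus>\<^bsub>M\<^esub>b\<in>B. coset (P b)) = coset (\<lambda>f. \<Sum>b\<in>B. P b f)"
  using assms
proof (induction B)
  interpret M: Module.module "ring_on R" M by (rule module_quotient)
  case empty
  show ?case by (simp add: zero_quotient)
next
  interpret M: Module.module "ring_on R" M by (rule module_quotient)
  case (insert b B)
  then have "(\<Oplus>\<^bsub>M\<^esub>b\<in>insert b B. coset (P b)) = coset (P b) \<oplus>\<^bsub>M\<^esub> (\<Oplus>\<^bsub>M\<^esub>b\<in>B. coset (P b))"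
    by (intro M.finsum_insert) (auto simp: carrier_quotient)
  then show ?case
    using insert by (simp add: add_quotient)
qed

end


section \<open>Leading coefficients and division\<close>

locale ordered_left_ideal = left_ideal_of_operators \<iota> R J + exponent_ordering r
  for \<iota> :: "'n::finite \<Rightarrow> 'v::finite" and R :: "('k::field_char_0, 'v) mvfrac set"
    and J and r :: "(nat ^ 'n) rel"
begin

lemma delta_exp_eqI:
  fixes p :: "nat ^ 'n \<Rightarrow> ('k, 'v) mvfrac"
  assumes p: "finite {\<alpha>. p \<alpha> \<noteq> 0}" "p \<alpha> \<noteq> 0" "\<And>\<beta>. p \<beta> \<noteq> 0 \<Longrightarrow> (\<beta>, \<alpha>) \<in> r"
  shows "delta_exp r \<iota> (diffop \<iota> p) = \<alpha>" and "delta_coeff r \<iota> (diffop \<iota> p) = p \<alpha>"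
proof -
  have coeff: "diffop_coeff \<iota> (diffop \<iota> p) = p"
    by (rule diffop_coeff_diffop[OF inj_\<iota> p(1)])
  show "delta_exp r \<iota> (diffop \<iota> p) = \<alpha>"
    unfolding delta_exp_def coeff
    using p order_antisym by (intro the_equality) blast+
  then show "delta_coeff r \<iota> (diffop \<iota> p) = p \<alpha>"
    by (simp add: delta_coeff_def coeff)
qed

lemma leading_term:
  fixes p :: "nat ^ 'n \<Rightarrow> ('k, 'v) mvfrac"
  assumes p: "finite {\<alpha>. p \<alpha> \<noteq> 0}" and "diffop \<iota> p \<noteq> (\<lambda>_. 0)"
  shows "p (delta_exp r \<iota> (diffop \<iota> p)) \<noteq> 0"
    and "p \<beta> \<noteq> 0 \<Longrightarrow> (\<beta>, delta_exp r \<iota> (diffop \<iota> p)) \<in> r"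
    and "delta_coeff r \<iota> (diffop \<iota> p) = p (delta_exp r \<iota> (diffop \<iota> p))"
proof -
  have "p \<noteq> (\<lambda>_. 0)"
    using assms(2) by (auto simp: diffop_def[abs_def])
  with p obtain \<alpha> where \<alpha>: "p \<alpha> \<noteq> 0" "\<And>\<beta>. p \<beta> \<noteq> 0 \<Longrightarrow> (\<beta>, \<alpha>) \<in> r"
    by (rule order_max) blast
  note eq = delta_exp_eqI[OF p \<alpha>]
  show "p (delta_exp r \<iota> (diffop \<iota> p)) \<noteq> 0"
    and "p \<beta> \<noteq> 0 \<Longrightarrow> (\<beta>, delta_exp r \<iota> (diffop \<iota> p)) \<in> r"
    and "delta_coeff r \<iota> (diffop \<iota> p) = p (delta_exp r \<iota> (diffop \<iota> p))"
    using \<alpha> by (simp_all add: eq)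
qed

text \<open>
  The coefficient ideal at \<open>\<alpha>\<close>, described by the operators in \<open>J\<close> without exponents above \<open>\<alpha>\<close>
  instead of by generators. In this form an element comes with a single operator that realises it, so
  \<open>1 \<in> lead_coeffs \<alpha>\<close> provides an operator in \<open>J\<close> with leading term \<open>\<partial>\<^sup>\<alpha>\<close>.
\<close>

definition lead_coeffs :: "nat ^ 'n \<Rightarrow> ('k, 'v) mvfrac set" where
  "lead_coeffs \<alpha> = {p \<alpha> | p. finite {\<alpha>. p \<alpha> \<noteq> 0} \<and> (\<forall>\<beta>. p \<beta> \<noteq> 0 \<longrightarrow> (\<beta>, \<alpha>) \<in> r) \<and>
     diffop \<iota> p \<in> J}"

lemma lead_coeffsE:
  assumes "c \<in> lead_coeffs \<alpha>"
  obtains p where "finite {\<alpha>. p \<alpha> \<noteq> 0}" "range p \<subseteq> R" "\<And>\<beta>. p \<beta> \<noteq> 0 \<Longrightarrow> (\<beta>, \<alpha>) \<in> r"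
    "diffop \<iota> p \<in> J" "p \<alpha> = c"
proof -
  obtain p where p: "c = p \<alpha>" "finite {\<alpha>. p \<alpha> \<noteq> 0}" "\<forall>\<beta>. p \<beta> \<noteq> 0 \<longrightarrow> (\<beta>, \<alpha>) \<in> r"
    "diffop \<iota> p \<in> J"
    using assms unfolding lead_coeffs_def by blast
  then have "range p \<subseteq> R"
    using ideal_subset diffop_closed_iff[OF p(2)] by blast
  with p show thesis
    by (intro that[of p]) simp_all
qed

lemma lead_coeffsI:
  "finite {\<alpha>. p \<alpha> \<noteq> 0} \<Longrightarrow> (\<And>\<beta>. p \<beta> \<noteq> 0 \<Longrightarrow> (\<beta>, \<alpha>) \<in> r) \<Longrightarrow> diffop \<iota> p \<in> J \<Longrightarrow>
    p \<alpha> \<in> lead_coeffs \<alpha>"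
  unfolding lead_coeffs_def by blast

lemma ideal_lead_coeffs: "ideal (lead_coeffs \<alpha>) (ring_on R)"
proof -
  have zero: "0 \<in> lead_coeffs \<alpha>"
    using lead_coeffsI[of "\<lambda>_. 0" \<alpha>] ideal_zero by (simp add: diffop_def[abs_def])
  have linear: "a + h * b \<in> lead_coeffs \<alpha>"
    if ab: "a \<in> lead_coeffs \<alpha>" "b \<in> lead_coeffs \<alpha>" and "h \<in> R" for a b h
  proof -
    obtain p where p: "finite {\<alpha>. p \<alpha> \<noteq> 0}" "range p \<subseteq> R" "\<And>\<beta>. p \<beta> \<noteq> 0 \<Longrightarrow> (\<beta>, \<alpha>) \<in> r"
        "diffop \<iota> p \<in> J" "p \<alpha> = a"
      using ab(1) by (rule lead_coeffsE) blast
    obtain q where q: "finite {\<alpha>. q \<alpha> \<noteq> 0}" "range q \<subseteq> R" "\<And>\<beta>. q \<beta> \<noteq> 0 \<Longrightarrow> (\<beta>, \<alpha>) \<in> r"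
        "diffop \<iota> q \<in> J" "q \<alpha> = b"
      using ab(2) by (rule lead_coeffsE) blast
    have "diffop \<iota> (\<lambda>\<alpha>. p \<alpha> + h * q \<alpha>) \<in> J"
      unfolding diffop_linear[OF p(1) q(1)] by (intro ideal_add ideal_mult p q \<open>h \<in> R\<close>)
    moreover have "(\<beta>, \<alpha>) \<in> r" if "p \<beta> + h * q \<beta> \<noteq> 0" for \<beta>
      using that p(3)[of \<beta>] q(3)[of \<beta>] by (cases "p \<beta> = 0") auto
    ultimately have "p \<alpha> + h * q \<alpha> \<in> lead_coeffs \<alpha>"
      by (intro lead_coeffsI diffop_linear(1) p(1) q(1))
    then show ?thesis by (simp add: p q)
  qed
  show ?thesis
  proof (rule ideal_ring_onI)
    show "lead_coeffs \<alpha> \<subseteq> R"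
      by (auto elim!: lead_coeffsE)
    show "a + b \<in> lead_coeffs \<alpha>" if "a \<in> lead_coeffs \<alpha>" "b \<in> lead_coeffs \<alpha>" for a b
      using linear[OF that one_closed] by simp
    show "a * b \<in> lead_coeffs \<alpha>" if "a \<in> R" "b \<in> lead_coeffs \<alpha>" for a b
      using linear[OF zero that(2,1)] by simp
  qed (rule zero)
qed

lemma lead_coeffs_add: "lead_coeffs \<alpha> \<subseteq> lead_coeffs (\<alpha> + \<gamma>)"
proof
  fix c assume "c \<in> lead_coeffs \<alpha>"
  then obtain p where p: "finite {\<alpha>. p \<alpha> \<noteq> 0}" "range p \<subseteq> R" "\<And>\<beta>. p \<beta> \<noteq> 0 \<Longrightarrow> (\<beta>, \<alpha>) \<in> r"
    "diffop \<iota> p \<in> J" "p \<alpha> = c"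
    by (rule lead_coeffsE) blast
  obtain q where q: "finite {\<alpha>. q \<alpha> \<noteq> 0}" "\<forall>\<beta>. q \<beta> \<noteq> 0 \<longrightarrow> (\<beta>, \<alpha> + \<gamma>) \<in> r"
    "q (\<alpha> + \<gamma>) = p \<alpha>" "diff_monom \<iota> \<gamma> \<circ> diffop \<iota> p = diffop \<iota> q"
    using diff_monom_comp_diffop[OF order p(1,3), of \<gamma>] by blast
  have "diffop \<iota> q \<in> J"
    unfolding q(4)[symmetric] by (rule ideal_comp[OF diff_monom_closed p(4)])
  then have "q (\<alpha> + \<gamma>) \<in> lead_coeffs (\<alpha> + \<gamma>)"
    using q by (intro lead_coeffsI) auto
  then show "c \<in> lead_coeffs (\<alpha> + \<gamma>)"
    by (simp add: q p)
qed

lemma delta_coeff_in_lead_coeffs: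
  assumes "P \<in> J" "P \<noteq> (\<lambda>_. 0)"
  shows "delta_coeff r \<iota> P \<in> lead_coeffs (delta_exp r \<iota> P)"
proof -
  obtain p where p: "finite {\<alpha>. p \<alpha> \<noteq> 0}" "P = diffop \<iota> p"
    using ideal_subset assms(1) by (auto elim!: diffop_ringE)
  show ?thesis
    using leading_term[OF p(1)] assms p lead_coeffsI[OF p(1)] by simp
qed

lemma coeff_generators_subset:
  "{delta_coeff r \<iota> P | P. P \<in> J - {\<lambda>_. 0} \<and> \<alpha> \<in> exponent_cone (delta_exp r \<iota> P)} \<subseteq> lead_coeffs \<alpha>"
proof
  fix c
  assume "c \<in> {delta_coeff r \<iota> P | P. P \<in> J - {\<lambda>_. 0} \<and> \<alpha> \<in> exponent_cone (delta_exp r \<iota> P)}"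
  then obtain P \<gamma> where "c = delta_coeff r \<iota> P" "P \<in> J" "P \<noteq> (\<lambda>_. 0)" "\<alpha> = delta_exp r \<iota> P + \<gamma>"
    by (auto simp: exponent_cone_def)
  then show "c \<in> lead_coeffs \<alpha>"
    using delta_coeff_in_lead_coeffs lead_coeffs_add by blast
qed

lemma coeff_ideal_subset: "coeff_ideal r \<iota> R J \<alpha> \<subseteq> lead_coeffs \<alpha>"
proof -
  interpret S: cring "ring_on R" by (rule cring_ring_on)
  show ?thesis
    unfolding coeff_ideal_def
    by (rule S.genideal_minimal[OF ideal_lead_coeffs coeff_generators_subset])
qed

text \<open>
  Division with remainder, with respect to a set \<open>Z\<close> of exponents at which \<open>J\<close> contains monic
  operators: the remainder has no exponents in \<open>Z\<close>. The leading term is removed by well-founded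
  induction; it is cancelled by a multiple of a monic operator if its exponent lies in \<open>Z\<close>, and put
  into the remainder otherwise.
\<close>

lemma division:
  fixes p :: "nat ^ 'n \<Rightarrow> ('k, 'v) mvfrac"
  assumes monic: "\<And>\<beta>. \<beta> \<in> Z \<Longrightarrow> 1 \<in> lead_coeffs \<beta>"
    and p: "finite {\<alpha>. p \<alpha> \<noteq> 0}" "range p \<subseteq> R"
  shows "\<exists>q. finite {\<alpha>. q \<alpha> \<noteq> 0} \<and> range q \<subseteq> R \<and> (\<forall>\<beta>\<in>Z. q \<beta> = 0) \<and>
    (\<lambda>f. diffop \<iota> p f - diffop \<iota> q f) \<in> J"
proof -
  let ?reducible = "\<lambda>p. \<exists>q. finite {\<alpha>. q \<alpha> \<noteq> 0} \<and> range q \<subseteq> R \<and> (\<forall>\<beta>\<in>Z. q \<beta> = 0) \<and>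
    (\<lambda>f. diffop \<iota> p f - diffop \<iota> q f) \<in> J"
  have step: "?reducible p"
    if "finite {\<alpha>. p \<alpha> \<noteq> 0}" "range p \<subseteq> R" "\<And>\<beta>. p \<beta> \<noteq> 0 \<Longrightarrow> (\<beta>, \<alpha>) \<in> r"
    for p :: "nat ^ 'n \<Rightarrow> ('k, 'v) mvfrac" and \<alpha>
    using that
  proof (induction \<alpha> arbitrary: p rule: wf_induct_rule[OF order_wf])
    case (1 \<alpha>)
    \<comment> \<open>An operator with leading term \<open>\<partial>\<^sup>\<alpha>\<close>: from \<open>J\<close> if \<open>\<alpha> \<in> Z\<close>, and \<open>\<partial>\<^sup>\<alpha>\<close> itself otherwise.
      Subtracting \<open>p \<alpha>\<close> times it cancels the term of \<open>p\<close> at \<open>\<alpha>\<close>.\<close>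
    let ?single = "\<lambda>\<beta>. if \<beta> = \<alpha> then 1 else 0 :: ('k, 'v) mvfrac"
    have "\<exists>g. finite {\<beta>. g \<beta> \<noteq> 0} \<and> range g \<subseteq> R \<and> (\<forall>\<beta>. g \<beta> \<noteq> 0 \<longrightarrow> (\<beta>, \<alpha>) \<in> r) \<and> g \<alpha> = 1 \<and>
        (if \<alpha> \<in> Z then diffop \<iota> g \<in> J else g = ?single)"
    proof (cases "\<alpha> \<in> Z")
      case True
      obtain g where "finite {\<alpha>. g \<alpha> \<noteq> 0}" "range g \<subseteq> R" "\<And>\<beta>. g \<beta> \<noteq> 0 \<Longrightarrow> (\<beta>, \<alpha>) \<in> r"
        "diffop \<iota> g \<in> J" "g \<alpha> = 1"
        using monic[OF True] by (rule lead_coeffsE) blast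
      then show ?thesis
        using True by (intro exI[of _ g]) simp
    next
      case False
      then show ?thesis
        using zero_closed one_closed order_refl by (intro exI[of _ ?single]) auto
    qed
    then obtain g where g: "finite {\<beta>. g \<beta> \<noteq> 0}" "range g \<subseteq> R" "\<And>\<beta>. g \<beta> \<noteq> 0 \<Longrightarrow> (\<beta>, \<alpha>) \<in> r"
      "g \<alpha> = 1" "if \<alpha> \<in> Z then diffop \<iota> g \<in> J else g = ?single"
      by blast
    have p_closed: "p \<beta> \<in> R" and g_closed: "g \<beta> \<in> R" for \<beta>
      using 1(3) g(2) by auto
    define p' where "p' = (\<lambda>\<beta>. p \<beta> + - p \<alpha> * g \<beta>)"
    have p': "finite {\<beta>. p' \<beta> \<noteq> 0}" "diffop \<iota> p' = (\<lambda>f. diffop \<iota> p f + - p \<alpha> * diffop \<iota> g f)"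
      unfolding p'_def by (rule diffop_linear[OF 1(2) g(1)])+
    have p'_closed: "range p' \<subseteq> R"
      unfolding p'_def
      by (intro image_subsetI add_closed mult_closed uminus_closed p_closed g_closed)
    have below: "(\<beta>, \<alpha>) \<in> r - Id" if "p' \<beta> \<noteq> 0" for \<beta>
    proof -
      have "\<beta> \<noteq> \<alpha>"
        using that g(4) by (auto simp: p'_def)
      moreover have "p \<beta> \<noteq> 0 \<or> g \<beta> \<noteq> 0"
        using that by (auto simp: p'_def)
      ultimately show ?thesis
        using 1(4) g(3) by blast
    qed
    have "?reducible p'"
    proof (cases "p' = (\<lambda>_. 0)")
      case True
      then show ?thesis
        using zero_closed ideal_zero by (intro exI[of _ p']) auto
    next
      case False
      with p'(1) obtain \<beta> where \<beta>: "p' \<beta> \<noteq> 0" "\<And>\<gamma>. p' \<gamma> \<noteq> 0 \<Longrightarrow> (\<gamma>, \<beta>) \<in> r"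
        by (rule order_max) blast
      show ?thesis
        by (rule 1(1)[OF below[OF \<beta>(1)] p'(1) p'_closed \<beta>(2)])
    qed
    then obtain q' where q': "finite {\<beta>. q' \<beta> \<noteq> 0}" "range q' \<subseteq> R" "\<forall>\<beta>\<in>Z. q' \<beta> = 0"
      "(\<lambda>f. diffop \<iota> p' f - diffop \<iota> q' f) \<in> J"
      by blast
    show ?case
    proof (cases "\<alpha> \<in> Z")
      case True
      have "(\<lambda>f. (diffop \<iota> p' f - diffop \<iota> q' f) + p \<alpha> * diffop \<iota> g f) \<in> J"
        using q'(4) g(5) True p_closed by (intro ideal_add ideal_mult) auto
      then have "(\<lambda>f. diffop \<iota> p f - diffop \<iota> q' f) \<in> J"
        by (simp add: p'(2) algebra_simps)
      then show ?thesis using q' by blast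
    next
      case False
      define q where "q = (\<lambda>\<beta>. q' \<beta> + p \<alpha> * g \<beta>)"
      have q: "finite {\<beta>. q \<beta> \<noteq> 0}" "diffop \<iota> q = (\<lambda>f. diffop \<iota> q' f + p \<alpha> * diffop \<iota> g f)"
        unfolding q_def by (rule diffop_linear[OF q'(1) g(1)])+
      have "range q \<subseteq> R"
        unfolding q_def using q'(2)
        by (intro image_subsetI add_closed mult_closed p_closed g_closed) blast
      moreover have "\<forall>\<beta>\<in>Z. q \<beta> = 0"
        using False q'(3) g(5) by (auto simp: q_def)
      moreover have "(\<lambda>f. diffop \<iota> p f - diffop \<iota> q f) \<in> J"
        using q'(4) by (simp add: p'(2) q(2) algebra_simps)
      ultimately show ?thesis using q(1) by blast
    qed
  qed
  show ?thesis
  proof (cases "p = (\<lambda>_. 0)")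
    case True
    then show ?thesis
      using zero_closed ideal_zero by (intro exI[of _ p]) auto
  next
    case False
    with p(1) obtain \<alpha> where \<alpha>: "p \<alpha> \<noteq> 0" "\<And>\<beta>. p \<beta> \<noteq> 0 \<Longrightarrow> (\<beta>, \<alpha>) \<in> r"
      by (rule order_max) blast
    show ?thesis
      by (rule step[OF p \<alpha>(2)])
  qed
qed

definition is_normal_form where
  "is_normal_form C q \<longleftrightarrow> finite {\<alpha>. q \<alpha> \<noteq> 0} \<and> range q \<subseteq> R \<and> (\<forall>\<beta>\<in>delta_Exp r \<iota> J. q \<beta> = 0) \<and>
     diffop \<iota> q \<in> C"

lemma is_normal_form_linear:
  assumes "is_normal_form (coset P) p" "is_normal_form (coset Q) q" "h \<in> R"
  shows "is_normal_form (coset (\<lambda>f. P f + h * Q f)) (\<lambda>\<alpha>. p \<alpha> + h * q \<alpha>)"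
proof -
  have p: "finite {\<alpha>. p \<alpha> \<noteq> 0}" "(\<lambda>f. diffop \<iota> p f - P f) \<in> J"
    and q: "finite {\<alpha>. q \<alpha> \<noteq> 0}" "(\<lambda>f. diffop \<iota> q f - Q f) \<in> J"
    using assms(1,2) by (simp_all add: is_normal_form_def mem_coset)
  have "(\<lambda>f. (diffop \<iota> p f - P f) + h * (diffop \<iota> q f - Q f)) \<in> J"
    by (intro ideal_add ideal_mult p q assms)
  then have "diffop \<iota> (\<lambda>\<alpha>. p \<alpha> + h * q \<alpha>) \<in> coset (\<lambda>f. P f + h * Q f)"
    unfolding mem_coset diffop_linear[OF p(1) q(1)] by (simp add: algebra_simps)
  moreover have "range (\<lambda>\<alpha>. p \<alpha> + h * q \<alpha>) \<subseteq> R"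
  proof (intro image_subsetI add_closed mult_closed assms)
    fix \<alpha>
    show "p \<alpha> \<in> R" and "q \<alpha> \<in> R"
      using assms(1,2) unfolding is_normal_form_def by blast+
  qed
  ultimately show ?thesis
    using assms diffop_linear(1)[OF p(1) q(1)] by (simp add: is_normal_form_def)
qed

text \<open>
  The difference of two normal forms lies in \<open>J\<close> and has no exponent in \<^const>\<open>delta_Exp\<close>; a nonzero
  element of \<open>J\<close> has its leading exponent there.
\<close>

lemma is_normal_form_unique:
  assumes "is_normal_form (coset P) p" "is_normal_form (coset P) q"
  shows "p = q"
proof (rule ccontr)
  assume "p \<noteq> q"
  define d where "d = (\<lambda>\<alpha>. p \<alpha> + - 1 * q \<alpha>)"
  have "is_normal_form (coset (\<lambda>f. P f + - 1 * P f)) d"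
    unfolding d_def by (rule is_normal_form_linear[OF assms uminus_closed[OF one_closed]])
  then have d: "finite {\<alpha>. d \<alpha> \<noteq> 0}" "\<And>\<beta>. \<beta> \<in> delta_Exp r \<iota> J \<Longrightarrow> d \<beta> = 0" "diffop \<iota> d \<in> J"
    by (simp_all add: is_normal_form_def coset_zero)
  have "diffop \<iota> d \<noteq> (\<lambda>_. 0)"
  proof
    assume 0: "diffop \<iota> d = (\<lambda>_. 0)"
    have "d \<alpha> = 0" for \<alpha>
    proof (cases "d \<alpha> = 0")
      case False
      then show ?thesis
        using diffop_eq_0[OF inj_\<iota> d(1), of d \<alpha>] 0[unfolded diffop_def] by (simp add: fun_eq_iff)
    qed
    then show False
      using \<open>p \<noteq> q\<close> by (auto simp: d_def)
  qed
  then have "d (delta_exp r \<iota> (diffop \<iota> d)) \<noteq> 0" "delta_exp r \<iota> (diffop \<iota> d) \<in> delta_Exp r \<iota> J"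
    using leading_term(1)[OF d(1)] d(3) by (auto simp: delta_Exp_def)
  then show False using d(2) by blast
qed

text \<open>
  If \<open>J\<close> contains monic operators at all its leading exponents, the quotient is free over \<open>R\<close> on the
  classes of the remaining monomials \<open>\<partial>\<^sup>\<beta>\<close>, with the coefficients of normal forms as coordinates. Indexing the
  dual basis by all exponents is harmless: at an exponent in \<^const>\<open>delta_Exp\<close> the coordinate is constantly zero.
\<close>

theorem flat_quotient:
  assumes monic: "\<And>\<beta>. \<beta> \<in> delta_Exp r \<iota> J \<Longrightarrow> 1 \<in> lead_coeffs \<beta>"
  shows "flat_module U (ring_on R) M"
proof -
  interpret M: Module.module "ring_on R" M by (rule module_quotient)
  define nf where "nf = (\<lambda>C. THE q. is_normal_form C q)"
  have nf_eqI: "nf (coset P) = q" if "is_normal_form (coset P) q" for P q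
    unfolding nf_def using that is_normal_form_unique by (intro the_equality)
  have nf: "is_normal_form (coset P) (nf (coset P))" if P: "P \<in> carrier D" for P
  proof -
    obtain p where p: "finite {\<alpha>. p \<alpha> \<noteq> 0}" "range p \<subseteq> R" "P = diffop \<iota> p"
      using P by (rule diffop_ringE)
    obtain q where q: "finite {\<alpha>. q \<alpha> \<noteq> 0}" "range q \<subseteq> R" "\<forall>\<beta>\<in>delta_Exp r \<iota> J. q \<beta> = 0"
      "(\<lambda>f. P f - diffop \<iota> q f) \<in> J"
      using division[OF monic p(1,2)] unfolding p(3) by blast
    then have "is_normal_form (coset P) q"
      using ideal_uminus[OF q(4)] by (simp add: is_normal_form_def mem_coset)
    then show ?thesis
      using nf_eqI by simp
  qed
  have nf_linear: "nf (coset (\<lambda>f. P f + h * Q f)) = (\<lambda>\<alpha>. nf (coset P) \<alpha> + h * nf (coset Q) \<alpha>)"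
    if "P \<in> carrier D" "Q \<in> carrier D" "h \<in> R" for P Q h
    using that by (intro nf_eqI is_normal_form_linear nf)
  have zero_op: "(\<lambda>_. 0) \<in> carrier D"
    using ideal_zero ideal_subset by blast
  have nf_zero: "nf (coset (\<lambda>_. 0)) = (\<lambda>_. 0)"
    using zero_closed ideal_zero
    by (intro nf_eqI) (auto simp: is_normal_form_def coset_zero diffop_def[abs_def])
  interpret dual_basis "ring_on R" M "\<lambda>\<beta>. coset (diff_monom \<iota> \<beta>)" "\<lambda>\<beta> C. nf C \<beta>"
  proof unfold_locales
    show "coset (diff_monom \<iota> \<beta>) \<in> carrier M" for \<beta>
      using diff_monom_closed by (simp add: carrier_quotient)
    fix C assume "C \<in> carrier M"
    then obtain P where P: "P \<in> carrier D" "C = coset P"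
      by (auto simp: carrier_quotient)
    then have C: "finite {\<alpha>. nf C \<alpha> \<noteq> 0}" "range (nf C) \<subseteq> R" "diffop \<iota> (nf C) \<in> coset P"
      using nf[of P] by (simp_all add: is_normal_form_def)
    then have nf_closed: "nf C \<beta> \<in> R" for \<beta>
      by blast
    then show "nf C \<beta> \<in> carrier (ring_on R)" for \<beta>
      by simp
    show "nf (a \<odot>\<^bsub>M\<^esub> C) \<beta> = a \<otimes>\<^bsub>ring_on R\<^esub> nf C \<beta>" if "a \<in> carrier (ring_on R)" for a \<beta>
      using nf_linear[OF zero_op P(1), of a] that P(2) by (simp add: smult_quotient nf_zero)
    show "nf (C \<oplus>\<^bsub>M\<^esub> C') \<beta> = nf C \<beta> \<oplus>\<^bsub>ring_on R\<^esub> nf C' \<beta>" if "C' \<in> carrier M" for C' \<beta>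
    proof -
      obtain Q where "Q \<in> carrier D" "C' = coset Q"
        using \<open>C' \<in> carrier M\<close> by (auto simp: carrier_quotient)
      then show ?thesis
        using nf_linear[OF P(1), of Q 1] P(2) one_closed by (simp add: add_quotient)
    qed
    let ?B = "{\<alpha>. nf C \<alpha> \<noteq> 0}"
    have "(\<Oplus>\<^bsub>M\<^esub>\<beta>\<in>?B. nf C \<beta> \<odot>\<^bsub>M\<^esub> coset (diff_monom \<iota> \<beta>)) =
        (\<Oplus>\<^bsub>M\<^esub>\<beta>\<in>?B. coset (\<lambda>f. nf C \<beta> * diff_monom \<iota> \<beta> f))"
      using nf_closed by (simp add: smult_quotient)
    also have "\<dots> = coset (\<lambda>f. \<Sum>\<beta>\<in>?B. nf C \<beta> * diff_monom \<iota> \<beta> f)"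
    proof (rule finsum_quotient[OF C(1)])
      fix \<beta>
      have "diffop \<iota> (\<lambda>\<gamma>. if \<gamma> = \<beta> then nf C \<beta> else 0) \<in> carrier D"
        using zero_closed nf_closed by (intro diffop_closed) auto
      then show "(\<lambda>f. nf C \<beta> * diff_monom \<iota> \<beta> f) \<in> carrier D"
        by (simp add: diffop_single)
    qed
    also have "\<dots> = coset (diffop \<iota> (nf C))"
      by (simp add: diffop_def[abs_def])
    also have "\<dots> = C"
      using coset_eqI[OF C(3)] P(2) by simp
    finally show "\<exists>B. finite B \<and> (\<forall>\<beta>. \<beta> \<notin> B \<longrightarrow> nf C \<beta> = \<zero>\<^bsub>ring_on R\<^esub>) \<and>
        C = (\<Oplus>\<^bsub>M\<^esub>\<beta>\<in>B. nf C \<beta> \<odot>\<^bsub>M\<^esub> coset (diff_monom \<iota> \<beta>))"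
      using C(1) by (intro exI[of _ ?B]) simp
  qed
  show ?thesis by (rule flat)
qed

end


section \<open>Flat quotients and operators of order zero\<close>

context left_ideal_of_operators
begin

text \<open>
  The quotient is zero, and the zero module has an empty expansion for each of its elements.
\<close>

lemma flat_zero_quotient:
  assumes "id \<in> J"
  shows "flat_module U (ring_on R) M"
proof -
  interpret M: Module.module "ring_on R" M by (rule module_quotient)
  interpret S: cring "ring_on R" by (rule cring_ring_on)
  have zero: "C = \<zero>\<^bsub>M\<^esub>" if C: "C \<in> carrier M" for C
  proof -
    obtain P where P: "P \<in> carrier D" "C = coset P"
      using C by (auto simp: carrier_quotient)
    have "P \<in> J"
      using ideal_comp[OF P(1) assms] by simp
    then show ?thesis
      using coset_eq_iff[of P "\<lambda>_. 0"] P(2) by (simp add: zero_quotient)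
  qed
  interpret dual_basis "ring_on R" M "\<lambda>_ :: unit. \<zero>\<^bsub>M\<^esub>" "\<lambda>_ _. 0"
  proof unfold_locales
    show "\<exists>B. finite B \<and> (\<forall>b :: unit. b \<notin> B \<longrightarrow> 0 = \<zero>\<^bsub>ring_on R\<^esub>) \<and>
        C = (\<Oplus>\<^bsub>M\<^esub>b\<in>B. 0 \<odot>\<^bsub>M\<^esub> \<zero>\<^bsub>M\<^esub>)" if "C \<in> carrier M" for C
      using zero[OF that] by (intro exI[of _ "{}"]) simp
  qed (use zero_closed in simp_all)
  show ?thesis by (rule flat)
qed

text \<open>
  The class of the identity is killed by \<open>h \<noteq> 0\<close>, whereas flat modules over a domain have no
  torsion.
\<close>

lemma one_in_ideal_if_flat:
  fixes u :: "('k, 'v) mvfrac \<Rightarrow> 'c"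
  assumes flat: "flat_module TYPE('c) (ring_on R) M" and u: "inj u"
    and h: "h \<in> R" "h \<noteq> 0" "(\<lambda>f. h * f) \<in> J"
  shows "id \<in> J"
proof -
  interpret D: ring D by (rule ring_diffop_ring)
  have "id \<in> carrier D"
    using D.one_closed by (simp add: diffop_ring_simps)
  then have "coset id \<in> carrier M"
    by (simp add: carrier_quotient)
  moreover have "x = \<zero>\<^bsub>ring_on R\<^esub>" if "h \<otimes>\<^bsub>ring_on R\<^esub> x = \<zero>\<^bsub>ring_on R\<^esub>" for x
    using that h(2) by simp
  moreover have "h \<in> carrier (ring_on R)"
    using h(1) by simp
  moreover have "h \<odot>\<^bsub>M\<^esub> coset id = \<zero>\<^bsub>M\<^esub>"
    using h by (simp add: smult_quotient zero_quotient coset_eq_iff)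
  moreover have "inj_on u (carrier (ring_on R))"
    using u by (rule inj_on_subset) simp
  ultimately have "coset id = \<zero>\<^bsub>M\<^esub>"
    using flat_module_torsion_free[OF flat] by blast
  then show ?thesis
    using coset_eq_iff[of id "\<lambda>_. 0"] by (simp add: zero_quotient id_def)
qed

end

context ordered_left_ideal
begin

lemma coeff_generators_closed:
  "{delta_coeff r \<iota> P | P. P \<in> J - {\<lambda>_. 0} \<and> \<alpha> \<in> exponent_cone (delta_exp r \<iota> P)} \<subseteq> R"
  by (rule subset_trans[OF coeff_generators_subset]) (auto elim!: lead_coeffsE)

lemma ideal_coeff_ideal: "ideal (coeff_ideal r \<iota> R J \<alpha>) (ring_on R)"
proof -
  interpret S: cring "ring_on R" by (rule cring_ring_on)
  show ?thesis
    unfolding coeff_ideal_def using coeff_generators_closed by (intro S.genideal_ideal) simp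
qed

lemma mult_op_in_coeff_ideal:
  assumes s: "(\<lambda>f. s * f) \<in> J" "s \<noteq> 0"
  shows "s \<in> coeff_ideal r \<iota> R J 0"
proof -
  interpret S: cring "ring_on R" by (rule cring_ring_on)
  let ?p = "\<lambda>\<beta> :: nat ^ 'n. if \<beta> = 0 then s else 0"
  have eq: "(\<lambda>f. s * f) = diffop \<iota> ?p"
    by (simp add: diffop_single)
  have "delta_exp r \<iota> (\<lambda>f. s * f) = 0" "delta_coeff r \<iota> (\<lambda>f. s * f) = s"
  proof -
    have fin: "finite {\<beta>. ?p \<beta> \<noteq> 0}" and p0: "?p 0 \<noteq> 0"
      using s(2) by simp_all
    have le: "(\<beta>, 0) \<in> r" if "?p \<beta> \<noteq> 0" for \<beta>
      using that order_refl by (cases "\<beta> = 0") simp_all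
    show "delta_exp r \<iota> (\<lambda>f. s * f) = 0" "delta_coeff r \<iota> (\<lambda>f. s * f) = s"
      unfolding eq using delta_exp_eqI[OF fin p0 le] s(2) by simp_all
  qed
  moreover have "(\<lambda>f. s * f) \<noteq> (\<lambda>_. 0)"
    using s(2) by (auto simp: fun_eq_iff intro!: exI[of _ 1])
  moreover have "0 \<in> exponent_cone (0 :: nat ^ 'n)"
    by (auto simp: exponent_cone_def)
  ultimately have "s \<in> {delta_coeff r \<iota> P | P. P \<in> J - {\<lambda>_. 0} \<and>
      0 \<in> exponent_cone (delta_exp r \<iota> P)}"
    using s(1) by force
  then show ?thesis
    unfolding coeff_ideal_def
    using S.genideal_self[of "{delta_coeff r \<iota> P | P. P \<in> J - {\<lambda>_. 0} \<and>
      0 \<in> exponent_cone (delta_exp r \<iota> P)}"] coeff_generators_closed[of 0] by auto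
qed

text \<open>
  The exponent 0 is the least one, so an operator with this leading exponent is
  multiplication by its leading coefficient.
\<close>

lemma operator_of_exponent_zero:
  assumes P: "P \<in> J" "P \<noteq> (\<lambda>_. 0)" and 0: "0 \<in> exponent_cone (delta_exp r \<iota> P)"
  shows "P = (\<lambda>f. delta_coeff r \<iota> P * f)"
proof -
  obtain p where p: "finite {\<alpha>. p \<alpha> \<noteq> 0}" "P = diffop \<iota> p"
    using ideal_subset P(1) by (auto elim!: diffop_ringE)
  have exp: "delta_exp r \<iota> P = 0"
    using 0 by (auto simp: exponent_cone_def vec_eq_iff)
  have "p \<beta> = 0" if "\<beta> \<noteq> 0" for \<beta>
    using leading_term(2)[OF p(1), of \<beta>] P(2) p(2) exp that order_zero order_antisym by metis
  moreover have "delta_coeff r \<iota> P = p 0"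
    using leading_term(3)[OF p(1)] P(2) p(2) exp by simp
  ultimately have "p = (\<lambda>\<beta>. if \<beta> = 0 then delta_coeff r \<iota> P else 0)"
    by auto
  then have "diffop \<iota> p = (\<lambda>f. delta_coeff r \<iota> P * f)"
    by (metis diffop_single diff_monom_0 id_apply)
  then show ?thesis using p(2) by simp
qed

text \<open>
  An ideal that contains all generators contains the coefficient ideal, so some generator lies
  outside \<open>K\<close>.
\<close>

lemma coeff_ideal_zeroE:
  assumes K: "ideal K (ring_on R)" and not: "\<not> coeff_ideal r \<iota> R J 0 \<subseteq> K"
  obtains h where "h \<in> R" "h \<notin> K" "(\<lambda>f. h * f) \<in> J"
proof -
  interpret S: cring "ring_on R" by (rule cring_ring_on)
  let ?G = "{delta_coeff r \<iota> P | P. P \<in> J - {\<lambda>_. 0} \<and> 0 \<in> exponent_cone (delta_exp r \<iota> P)}"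
  have "\<not> ?G \<subseteq> K"
    using not S.genideal_minimal[OF K, of ?G] by (auto simp: coeff_ideal_def)
  then obtain P where P: "P \<in> J" "P \<noteq> (\<lambda>_. 0)" "0 \<in> exponent_cone (delta_exp r \<iota> P)"
      "delta_coeff r \<iota> P \<notin> K"
    by blast
  have "delta_coeff r \<iota> P \<in> R"
    using coeff_generators_closed[of 0] P by blast
  moreover have "(\<lambda>f. delta_coeff r \<iota> P * f) \<in> J"
    using operator_of_exponent_zero[OF P(1-3)] P(1) by simp
  ultimately show thesis
    using that P(4) by blast
qed

end


section \<open>Localisation\<close>

lemma left_ideal_gen:
  assumes "ring A" and S: "S \<subseteq> carrier A"
  shows left_ideal_left_ideal_gen: "left_ideal (left_ideal_gen A S) A"
    and subset_left_ideal_gen: "S \<subseteq> left_ideal_gen A S"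
    and left_ideal_gen_minimal: "left_ideal K A \<Longrightarrow> S \<subseteq> K \<Longrightarrow> left_ideal_gen A S \<subseteq> K"
proof -
  interpret ring A by fact
  let ?F = "{K. left_ideal K A \<and> S \<subseteq> K}"
  have "left_ideal (carrier A) A"
    using add.subgroup_self by (simp add: left_ideal_def additive_subgroup_def)
  then have ne: "carrier A \<in> ?F"
    using S by simp
  have "subgroup (\<Inter>?F) (add_monoid A)"
    using ne by (intro add.subgroups_Inter) (auto simp: left_ideal_def additive_subgroup_def)
  then show "left_ideal (left_ideal_gen A S) A"
    unfolding left_ideal_gen_def
    by (auto simp: left_ideal_def additive_subgroup_def)
  show "S \<subseteq> left_ideal_gen A S"
    and "left_ideal K A \<Longrightarrow> S \<subseteq> K \<Longrightarrow> left_ideal_gen A S \<subseteq> K"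
    unfolding left_ideal_gen_def by blast+
qed

locale localized_left_ideal = left_ideal_of_operators \<iota> H I
  for \<iota> :: "'n::finite \<Rightarrow> 'v::finite" and H :: "('k::field_char_0, 'v) mvfrac set" and I +
  fixes P
  assumes prime: "primeideal P (ring_on H)"
begin

abbreviation L where "L \<equiv> localization H P"

lemma prime_zero: "0 \<in> P"
  using additive_subgroup.zero_closed[OF ideal.axioms(1)[OF primeideal.axioms(1)[OF prime]]] by simp

lemma denominators:
  shows denominator_one: "1 \<in> H - P"
    and denominator_mult: "s \<in> H - P \<Longrightarrow> t \<in> H - P \<Longrightarrow> s * t \<in> H - P"
    and denominator_nonzero: "s \<in> H - P \<Longrightarrow> s \<noteq> 0"
proof -
  interpret P: primeideal P "ring_on H" by (rule prime)
  show "1 \<in> H - P"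
    using P.one_imp_carrier P.I_notcarr one_closed by auto
  show "s \<in> H - P \<Longrightarrow> t \<in> H - P \<Longrightarrow> s * t \<in> H - P"
    using P.I_prime[of s t] mult_closed by auto
  show "s \<in> H - P \<Longrightarrow> s \<noteq> 0"
    using prime_zero by auto
qed

lemma localizationI: "a \<in> H \<Longrightarrow> s \<in> H - P \<Longrightarrow> a / s \<in> L"
  by (auto simp: localization_def)

lemma localizationE:
  assumes "x \<in> L"
  obtains a s where "x = a / s" "a \<in> H" "s \<in> H - P" "s \<noteq> 0"
  using assms denominator_nonzero unfolding localization_def by blast

lemma subset_localization: "H \<subseteq> L"
  using localizationI[OF _ denominator_one] by auto

lemma pderiv_frac_divide:
  "pderiv_frac v (a / s) = (pderiv_frac v a * s - a * pderiv_frac v s) / (s * s)"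
  if "s \<noteq> 0" for a s :: "('k, 'v) mvfrac"
proof -
  have "pderiv_frac v a = pderiv_frac v (a / s * s)"
    using that by simp
  also have "\<dots> = pderiv_frac v (a / s) * s + a / s * pderiv_frac v s"
    by (rule pderiv_frac_mult)
  finally show ?thesis
    using that by (simp add: field_simps)
qed

sublocale L: diff_subring \<iota> L
proof (rule diff_subring.intro)
  interpret K: cring "ring_on UNIV :: ('k, 'v) mvfrac ring"
    by (rule cring_ring_on_UNIV)
  show "inj \<iota>" by (rule inj_\<iota>)
  show "subring L (ring_on UNIV)"
  proof (rule K.subringI)
    show "\<one>\<^bsub>ring_on UNIV\<^esub> \<in> L"
      using subset_localization one_closed by auto
    fix x assume "x \<in> L"
    then obtain a s where x: "x = a / s" "a \<in> H" "s \<in> H - P" "s \<noteq> 0"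
      by (rule localizationE)
    have "- a / s \<in> L"
      by (intro localizationI uminus_closed x)
    then show "\<ominus>\<^bsub>ring_on UNIV\<^esub> x \<in> L"
      by (simp add: a_inv_ring_on[OF K.is_cring] x)
    fix y assume "y \<in> L"
    then obtain b t where y: "y = b / t" "b \<in> H" "t \<in> H - P" "t \<noteq> 0"
      by (rule localizationE)
    have "(a * b) / (s * t) \<in> L"
      by (intro localizationI mult_closed denominator_mult x y)
    then show "x \<otimes>\<^bsub>ring_on UNIV\<^esub> y \<in> L"
      by (simp add: x y)
    have "(a * t + b * s) / (s * t) \<in> L"
      using x y by (intro localizationI mult_closed add_closed denominator_mult) auto
    moreover have "(a * t + b * s) / (s * t) = x + y"
      using x y by (simp add: field_simps)
    ultimately show "x \<oplus>\<^bsub>ring_on UNIV\<^esub> y \<in> L"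
      by simp
  qed simp
  fix i x assume "x \<in> L"
  then obtain a s where x: "x = a / s" "a \<in> H" "s \<in> H - P" "s \<noteq> 0"
    by (rule localizationE)
  have "(pderiv_frac (\<iota> i) a * s - a * pderiv_frac (\<iota> i) s) / (s * s) \<in> L"
    using x by (intro localizationI denominator_mult diff_closed mult_closed stable) auto
  then show "pderiv_frac (\<iota> i) x \<in> L"
    using x by (simp add: pderiv_frac_divide)
qed

lemma carrier_subset_localization: "carrier D \<subseteq> carrier L.D"
proof
  fix Q assume "Q \<in> carrier D"
  then obtain p where "finite {\<alpha>. p \<alpha> \<noteq> 0}" "range p \<subseteq> H" "Q = diffop \<iota> p"
    by (rule diffop_ringE)
  then show "Q \<in> carrier L.D"
    using subset_localization L.diffop_closed by blast
qed

abbreviation IP where "IP \<equiv> left_ideal_gen L.D I"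

lemma ideal_subset_localization: "I \<subseteq> carrier L.D"
  using ideal_subset carrier_subset_localization by blast

sublocale IP: left_ideal_of_operators \<iota> L IP
  by unfold_locales (rule left_ideal_left_ideal_gen[OF ring_diffop_ring ideal_subset_localization])

text \<open>
  The set \<open>S\<^sup>-\<^sup>1 I\<close>, which is the localised ideal in explicit form.
\<close>

definition fractions where
  "fractions = {\<lambda>f. Q f / s | Q s. Q \<in> I \<and> s \<in> H - P}"

lemma fractionsI: "Q \<in> I \<Longrightarrow> s \<in> H - P \<Longrightarrow> (\<lambda>f. Q f / s) \<in> fractions"
  by (auto simp: fractions_def)

lemma fractionsE:
  assumes "A \<in> fractions"
  obtains Q s where "A = (\<lambda>f. Q f / s)" "Q \<in> I" "s \<in> H - P" "s \<noteq> 0"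
  using assms denominator_nonzero unfolding fractions_def by blast

lemma fractions_zero: "(\<lambda>_. 0) \<in> fractions"
  using fractionsI[OF ideal_zero denominator_one] by simp

lemma fractions_add:
  assumes "A \<in> fractions" "B \<in> fractions"
  shows "(\<lambda>f. A f + B f) \<in> fractions"
proof -
  obtain Q s where A: "A = (\<lambda>f. Q f / s)" "Q \<in> I" "s \<in> H - P" "s \<noteq> 0"
    using assms(1) by (rule fractionsE)
  obtain Q' t where B: "B = (\<lambda>f. Q' f / t)" "Q' \<in> I" "t \<in> H - P" "t \<noteq> 0"
    using assms(2) by (rule fractionsE)
  have "(\<lambda>f. (t * Q f + s * Q' f) / (s * t)) \<in> fractions"
    using A B by (intro fractionsI ideal_add ideal_mult denominator_mult) auto
  moreover have "(t * Q f + s * Q' f) / (s * t) = A f + B f" for f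
    using A B by (simp add: field_simps)
  ultimately show ?thesis by simp
qed

lemma fractions_mult:
  assumes "x \<in> L" "A \<in> fractions"
  shows "(\<lambda>f. x * A f) \<in> fractions"
proof -
  obtain a t where x: "x = a / t" "a \<in> H" "t \<in> H - P" "t \<noteq> 0"
    using assms(1) by (rule localizationE)
  obtain Q s where A: "A = (\<lambda>f. Q f / s)" "Q \<in> I" "s \<in> H - P" "s \<noteq> 0"
    using assms(2) by (rule fractionsE)
  have "(\<lambda>f. (a * Q f) / (t * s)) \<in> fractions"
    by (intro fractionsI ideal_mult denominator_mult x A)
  then show ?thesis
    by (simp add: x A)
qed

lemma fractions_pderiv:
  assumes "A \<in> fractions"
  shows "(\<lambda>f. pderiv_frac (\<iota> i) (A f)) \<in> fractions"
proof -
  obtain Q s where A: "A = (\<lambda>f. Q f / s)" "Q \<in> I" "s \<in> H - P" "s \<noteq> 0"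
    using assms by (rule fractionsE)
  have "diff_monom \<iota> (0 + unit_exponent i) \<in> carrier D"
    by (rule diff_monom_closed)
  then have "pderiv_frac (\<iota> i) \<in> carrier D"
    unfolding diff_monom_step diff_monom_0 by simp
  from ideal_comp[OF this A(2)] have d: "(\<lambda>f. pderiv_frac (\<iota> i) (Q f)) \<in> I"
    by (simp add: comp_def)
  have "(\<lambda>f. (s * pderiv_frac (\<iota> i) (Q f) - pderiv_frac (\<iota> i) s * Q f) / (s * s)) \<in> fractions"
    using A d by (intro fractionsI ideal_diff ideal_mult denominator_mult stable) auto
  then show ?thesis
    using A by (simp add: pderiv_frac_divide mult.commute)
qed

text \<open>
  By the quotient rule the fractions are stable under the derivations, hence under all operators
  with coefficients in the localisation.
\<close>

lemma left_ideal_fractions: "left_ideal fractions L.D"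
proof -
  interpret LD: ring L.D by (rule ring_diffop_ring)
  have sub: "fractions \<subseteq> carrier L.D"
  proof
    fix A assume "A \<in> fractions"
    then obtain Q s where A: "A = (\<lambda>f. Q f / s)" "Q \<in> I" "s \<in> H - P" "s \<noteq> 0"
      by (rule fractionsE)
    have "(\<lambda>f. (1 / s) * f) \<otimes>\<^bsub>L.D\<^esub> Q \<in> carrier L.D"
      using A ideal_subset_localization
      by (intro LD.m_closed L.mult_op_closed localizationI one_closed) auto
    then show "A \<in> carrier L.D"
      by (simp add: A L.diffop_ring_simps comp_def)
  qed
  have monom: "(\<lambda>f. diff_monom \<iota> \<alpha> (A f)) \<in> fractions" if "A \<in> fractions" for \<alpha> A
    by (induction \<alpha> rule: exponent_induct) (simp_all add: that diff_monom_step fractions_pderiv)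
  have comp: "B \<circ> A \<in> fractions" if B: "B \<in> carrier L.D" and A: "A \<in> fractions" for A B
  proof -
    obtain p where p: "finite {\<alpha>. p \<alpha> \<noteq> 0}" "range p \<subseteq> L" "B = diffop \<iota> p"
      using B by (rule L.diffop_ringE)
    have "(\<lambda>f. \<Sum>\<alpha>\<in>C. p \<alpha> * diff_monom \<iota> \<alpha> (A f)) \<in> fractions" for C
      using p(2)
      by (induction C rule: infinite_finite_induct)
        (auto intro!: fractions_zero fractions_add fractions_mult monom A)
    then show ?thesis
      by (simp add: p(3) comp_def diffop_def)
  qed
  have "subgroup fractions (add_monoid L.D)"
  proof (rule LD.add.subgroupI)
    fix A assume A: "A \<in> fractions"
    have "(\<lambda>f. - 1 * A f) \<in> fractions"
      by (rule fractions_mult[OF L.uminus_closed[OF L.one_closed] A])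
    moreover have "\<ominus>\<^bsub>L.D\<^esub> A = (\<lambda>f. - 1 * A f)"
      using A sub calculation by (intro LD.minus_equality) (auto simp: L.diffop_ring_simps)
    ultimately show "\<ominus>\<^bsub>L.D\<^esub> A \<in> fractions"
      by simp
  qed (use sub fractions_zero fractions_add in \<open>auto simp: L.diffop_ring_simps\<close>)
  then show ?thesis
    using comp by (simp add: left_ideal_def additive_subgroup_def L.diffop_ring_simps)
qed

lemma localized_ideal_subset_fractions: "IP \<subseteq> fractions"
proof (rule left_ideal_gen_minimal[OF ring_diffop_ring ideal_subset_localization left_ideal_fractions])
  show "I \<subseteq> fractions"
    using fractionsI[OF _ denominator_one] by auto
qed

lemma id_in_localized_idealI:
  assumes "h \<in> H" "h \<notin> P" "(\<lambda>f. h * f) \<in> I"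
  shows "id \<in> IP"
proof -
  have h: "h \<in> H - P" "h \<noteq> 0"
    using assms prime_zero by auto
  have "1 / h \<in> L"
    using h one_closed by (intro localizationI)
  moreover have "(\<lambda>f. h * f) \<in> IP"
    using subset_left_ideal_gen[OF ring_diffop_ring ideal_subset_localization] assms(3) by blast
  ultimately have "(\<lambda>f. 1 / h * (h * f)) \<in> IP"
    by (rule IP.ideal_mult)
  then show ?thesis
    using h by (simp add: id_def)
qed

text \<open>
  If \<open>1 = Q / s\<close> with \<open>Q \<in> I\<close>, then \<open>Q\<close> is multiplication by the denominator \<open>s\<close>.
\<close>

lemma id_in_localized_idealE:
  assumes "id \<in> IP"
  obtains s where "s \<in> H" "s \<notin> P" "(\<lambda>f. s * f) \<in> I"
proof -
  have "id \<in> fractions"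
    using assms localized_ideal_subset_fractions by blast
  then obtain Q s where Q: "id = (\<lambda>f. Q f / s)" "Q \<in> I" "s \<in> H - P" "s \<noteq> 0"
    by (rule fractionsE)
  have "Q f = s * f" for f
    using fun_cong[OF Q(1), of f] Q(4) by (simp add: field_simps)
  then have "Q = (\<lambda>f. s * f)" by (rule ext)
  then show thesis
    using that Q by auto
qed

end


section \<open>The flat locus of a quotient module\<close>

theorem proposition30:
  fixes \<iota> :: "'n::finite \<Rightarrow> 'v::finite"
    and H :: "('k::field_char_0, 'v) mvfrac set"
    and r :: "(nat ^ 'n) rel"
    and I :: "(('k, 'v) mvfrac \<Rightarrow> ('k, 'v) mvfrac) set"
    and E :: "(nat ^ 'n) set"
    and u :: "('k, 'v) mvfrac \<Rightarrow> 'c"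
  assumes "inj \<iota>"
    and "subring H (ring_on UNIV)"
    and "range mvfrac_const \<subseteq> H"
    and "noetherian_ring (ring_on H)"
    and "\<And>i h. h \<in> H \<Longrightarrow> pderiv_frac (\<iota> i) h \<in> H"
    and "exponent_order r"
    and "left_ideal I (diffop_ring \<iota> H)"
    and "I \<noteq> {\<lambda>_. 0}"
    and "delta_stair r \<iota> I E"
    and "inj u"
  shows "(coeff_ideal r \<iota> H I 0 \<noteq> {0} \<longrightarrow>
           (let U = spectrum (ring_on H) - vanishing_set (ring_on H) (coeff_ideal r \<iota> H I 0)
            in flat_open TYPE('c) \<iota> H I U \<and> (\<forall>W. flat_open TYPE('c) \<iota> H I W \<longrightarrow> W \<subseteq> U))) \<and>
         ((\<forall>\<alpha>\<in>E. coeff_ideal r \<iota> H I \<alpha> = H) \<longrightarrow>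
           flat_module TYPE('c) (ring_on H) (diffop_quotient \<iota> H I))"
proof -
  have "ordered_left_ideal \<iota> H I r"
    using assms(1,2,5,6,7)
    by (intro ordered_left_ideal.intro left_ideal_of_operators.intro diff_subring.intro
        left_ideal_of_operators_axioms.intro exponent_ordering.intro)
  interpret ordered_left_ideal \<iota> H I r by fact
  let ?C = "coeff_ideal r \<iota> H I 0"
  let ?U = "spectrum (ring_on H) - vanishing_set (ring_on H) ?C"
  interpret S: cring "ring_on H" by (rule cring_ring_on)
  have localized: "localized_left_ideal \<iota> H I P" if "P \<in> spectrum (ring_on H)" for P
    using that left_ideal_of_operators_axioms
    by (simp add: localized_left_ideal_def localized_left_ideal_axioms_def spectrum_def)
  have "flat_open TYPE('c) \<iota> H I ?U"
    unfolding flat_open_def Let_def openin_zariski_topology[OF cring_ring_on]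
  proof (intro conjI ballI)
    show "\<exists>K. ideal K (ring_on H) \<and> ?U = spectrum (ring_on H) - vanishing_set (ring_on H) K"
      using ideal_coeff_ideal by blast
    \<comment> \<open>Over \<open>U\<close> some element of \<open>I\<close> becomes a unit, so the localised quotient is zero.\<close>
    fix P assume P: "P \<in> ?U"
    interpret P: localized_left_ideal \<iota> H I P
      using P localized by blast
    have "ideal P (ring_on H)" "\<not> ?C \<subseteq> P"
      using P primeideal.axioms(1)[OF P.prime] by (auto simp: vanishing_set_def)
    then obtain h where "h \<in> H" "h \<notin> P" "(\<lambda>f. h * f) \<in> I"
      by (rule coeff_ideal_zeroE)
    then have "id \<in> P.IP"
      by (rule P.id_in_localized_idealI)
    then show "flat_module TYPE('c) (ring_on P.L) (diffop_quotient \<iota> P.L P.IP)"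
      by (rule P.IP.flat_zero_quotient)
  qed
  moreover have "W \<subseteq> ?U" if C: "?C \<noteq> {0}" and W: "flat_open TYPE('c) \<iota> H I W" for W
  proof
    fix P assume P: "P \<in> W"
    have spec: "P \<in> spectrum (ring_on H)"
      using W P unfolding flat_open_def openin_zariski_topology[OF cring_ring_on] by blast
    interpret P: localized_left_ideal \<iota> H I P
      by (rule localized[OF spec])
    have "ideal {0} (ring_on H)" "0 \<in> ?C"
      using S.zeroideal additive_subgroup.zero_closed[OF ideal.axioms(1)[OF ideal_coeff_ideal]] by auto
    then have "ideal {0} (ring_on H)" "\<not> ?C \<subseteq> {0}"
      using C by auto
    then obtain h where h: "h \<in> H" "h \<notin> {0}" "(\<lambda>f. h * f) \<in> I"
      by (rule coeff_ideal_zeroE)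
    \<comment> \<open>Flatness puts 1 into the localised ideal; clearing its denominator gives an element
      of \<open>I \<inter> H\<close> outside \<open>P\<close>.\<close>
    have "flat_module TYPE('c) (ring_on P.L) (diffop_quotient \<iota> P.L P.IP)"
      using W P by (simp add: flat_open_def Let_def)
    moreover have "h \<in> P.L" "h \<noteq> 0" "(\<lambda>f. h * f) \<in> P.IP"
      using h P.subset_localization
        subset_left_ideal_gen[OF ring_diffop_ring P.ideal_subset_localization] by auto
    ultimately have "id \<in> P.IP"
      using P.IP.one_in_ideal_if_flat \<open>inj u\<close> by blast
    then obtain s where s: "s \<in> H" "s \<notin> P" "(\<lambda>f. s * f) \<in> I"
      by (rule P.id_in_localized_idealE)
    then have "s \<noteq> 0"
      using P.prime_zero by auto
    then have "s \<in> ?C"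
      by (rule mult_op_in_coeff_ideal[OF s(3)])
    then show "P \<in> ?U"
      using spec s(2) by (auto simp: vanishing_set_def)
  qed
  moreover have "flat_module TYPE('c) (ring_on H) (diffop_quotient \<iota> H I)"
    if E: "\<forall>\<alpha>\<in>E. coeff_ideal r \<iota> H I \<alpha> = H"
  proof (rule flat_quotient)
    fix \<beta> assume "\<beta> \<in> delta_Exp r \<iota> I"
    then obtain \<alpha> \<gamma> where \<alpha>: "\<alpha> \<in> E" "\<beta> = \<alpha> + \<gamma>"
      using assms(9) unfolding delta_stair_def exponent_cone_def by blast
    then have "1 \<in> coeff_ideal r \<iota> H I \<alpha>"
      using E one_closed by simp
    then show "1 \<in> lead_coeffs \<beta>"
      unfolding \<alpha>(2) using coeff_ideal_subset lead_coeffs_add by blast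
  qed
  ultimately show ?thesis
    by (simp add: Let_def)
qed

end
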